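(* Let $Z$ be a subvariety of $\mathbb{C}^{(k+1)(n-k)}$, the space of $(k+1)\times(n-k)$ complex matrices. Suppose that $\chi_z>0$ for some $z\in Z$. Then $$\nabla_\chi(Z)=\{z\in Z\mid E^{\mathrm{red}}_\chi(z)=0\}.$$
   Context: A matrix $z\in\mathbb{C}^{(k+1)\times(n-k)}$ has rows indexed by $0,\dots,k$ and columns indexed by $k+1,\dots,n$. Let $C(z)=[\,E_{k+1}\mid z\,]$ be the $(k+1)\times(n+1)$ matrix whose first $k+1$ columns (indexed $0,\dots,k$) form the identity matrix $E_{k+1}$. Its $j$-th column $(c_{0j},\dots,c_{kj})^T$ defines the linear form $h_j(\alpha;z)=c_{0j}\alpha_0+\cdots+c_{kj}\alpha_k$ and $H_j=\{\alpha\in\mathbb{P}^k\mid h_j(\alpha;z)=0\}$ for $j=0,\dots,n$ (possibly $H_j=\mathbb{P}^k$). Put $X_z=\mathbb{P}^k(\mathbb{C})\setminus\bigcup_{j=0}^nH_j$ and $\chi_z=(-1)^k\chi(X_z)$, where $\chi$ is the topological Euler characteristic. Let $\chi^*=\max\{\chi_z\mid z\in Z\}$. The Euler discriminant is $\nabla_\chi(Z)=\{z\in Z\mid\chi_z<\chi^*\}$. For $I\subset\{0,\dots,k\}$ and $J\subset\{k+1,\dots,n\}$ with $|I|=|J|$, let $z_{I,J}$ be the submatrix of $z$ with rows $I$ and columns $J$. Let $S$ be the set of all pairs $(I,J)$ with $|I|=|J|$ and $\det(z_{I,J})\neq 0$, where $z$ is regarded as varying in $Z$, i.e. $\det(z_{I,J})$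 is not the zero function on $Z$. The reduced discriminant is $E^{\mathrm{red}}_\chi(z)=\prod_{(I,J)\in S}\det(z_{I,J})$. *)

theory Defs
  imports "HOL-Homology.Homology" "Jordan_Normal_Form.Determinant" "Jordan_Normal_Form.DL_Submatrix"
begin

section \<open>Topological Euler characteristic\<close>

text \<open>The homology groups of the library are multiplicatively written abelian groups, so an
  integer linear combination of the elements of \<open>B\<close> is a product of powers.\<close>

definition int_independent :: "('a, 'b) monoid_scheme \<Rightarrow> 'a set \<Rightarrow> bool" where
  "int_independent G B \<longleftrightarrow> B \<subseteq> carrier G \<and> finite B \<and>
     (\<forall>c :: 'a \<Rightarrow> int. (\<Otimes>\<^bsub>G\<^esub>b\<in>B. b [^]\<^bsub>G\<^esub> c b) = \<one>\<^bsub>G\<^esub> \<longrightarrow> (\<forall>b\<in>B. c b = 0))"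

definition abelian_rank :: "('a, 'b) monoid_scheme \<Rightarrow> nat" where
  "abelian_rank G = Sup (card ` {B. int_independent G B})"

definition betti :: "nat \<Rightarrow> 'a topology \<Rightarrow> nat" where
  "betti p X = abelian_rank (homology_group (int p) X)"

text \<open>Meaningful for spaces whose integral homology has finite total rank, as is the case for
  all the spaces (complements of hyperplane arrangements) considered below.\<close>

definition euler_characteristic :: "'a topology \<Rightarrow> int" where
  "euler_characteristic X = (\<Sum>p | betti p X \<noteq> 0. (-1) ^ p * int (betti p X))"


section \<open>Complex projective space\<close>

text \<open>Points of $\mathbb{C}^{k+1}$ are functions on \<open>{0..k}\<close>, extended by \<open>undefined\<close>;
  a point of $\mathbb{P}^k$ is the set of all nonzero multiples of a nonzero vector.\<close>

definition complex_space :: "nat \<Rightarrow> (nat \<Rightarrow> complex) topology" where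
  "complex_space k = product_topology (\<lambda>_. euclidean) {0..k}"

definition punctured_space :: "nat \<Rightarrow> (nat \<Rightarrow> complex) topology" where
  "punctured_space k = subtopology (complex_space k) {\<alpha>. \<exists>i\<in>{0..k}. \<alpha> i \<noteq> 0}"

definition proj_point :: "nat \<Rightarrow> (nat \<Rightarrow> complex) \<Rightarrow> (nat \<Rightarrow> complex) set" where
  "proj_point k \<alpha> = {\<lambda>i\<in>{0..k}. t * \<alpha> i | t. t \<noteq> 0}"

definition quotient_topology :: "'a topology \<Rightarrow> ('a \<Rightarrow> 'b) \<Rightarrow> 'b topology" where
  "quotient_topology X f =
     topology (\<lambda>U. U \<subseteq> f ` topspace X \<and> openin X {x \<in> topspace X. f x \<in> U})"

lemma openin_quotient_topology:
  "openin (quotient_topology X f) U \<longleftrightarrow>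
     U \<subseteq> f ` topspace X \<and> openin X {x \<in> topspace X. f x \<in> U}"
proof -
  have "istopology (\<lambda>U. U \<subseteq> f ` topspace X \<and> openin X {x \<in> topspace X. f x \<in> U})"
    unfolding istopology_def
  proof (intro conjI allI impI)
    fix S T
    assume "S \<subseteq> f ` topspace X \<and> openin X {x \<in> topspace X. f x \<in> S}"
      and "T \<subseteq> f ` topspace X \<and> openin X {x \<in> topspace X. f x \<in> T}"
    moreover have "{x \<in> topspace X. f x \<in> S \<inter> T} =
        {x \<in> topspace X. f x \<in> S} \<inter> {x \<in> topspace X. f x \<in> T}"
      by blast
    ultimately show "S \<inter> T \<subseteq> f ` topspace X" "openin X {x \<in> topspace X. f x \<in> S \<inter> T}"
      by auto
  next
    fix \<K>
    assume "\<forall>K\<in>\<K>. K \<subseteq> f ` topspace X \<and> openin X {x \<in> topspace X. f x \<in> K}"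
    moreover have "{x \<in> topspace X. f x \<in> \<Union>\<K>} = (\<Union>K\<in>\<K>. {x \<in> topspace X. f x \<in> K})"
      by blast
    ultimately show "\<Union>\<K> \<subseteq> f ` topspace X" "openin X {x \<in> topspace X. f x \<in> \<Union>\<K>}"
      by auto
  qed
  then show ?thesis
    by (simp add: quotient_topology_def)
qed

lemma quotient_map_quotient_topology: "quotient_map X (quotient_topology X f) f"
proof -
  have "topspace (quotient_topology X f) = f ` topspace X"
  proof
    show "topspace (quotient_topology X f) \<subseteq> f ` topspace X"
      using openin_quotient_topology[of X f "topspace (quotient_topology X f)"] by simp
    have "{x \<in> topspace X. f x \<in> f ` topspace X} = topspace X"
      by auto
    then show "f ` topspace X \<subseteq> topspace (quotient_topology X f)"
      by (intro openin_subset) (simp add: openin_quotient_topology)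
  qed
  then show ?thesis
    by (simp add: quotient_map_def openin_quotient_topology)
qed

definition projective_space :: "nat \<Rightarrow> (nat \<Rightarrow> complex) set topology" where
  "projective_space k = quotient_topology (punctured_space k) (proj_point k)"


section \<open>The hyperplane arrangement of a matrix\<close>

text \<open>Library matrices are indexed from 0, so column \<open>j \<in> {k+1..n}\<close> of \<open>z\<close> is
  \<open>z $$ (_, j - (k + 1))\<close>. In \<open>extended_mat\<close> columns are numbered \<open>0..n\<close> throughout.\<close>

definition extended_mat :: "nat \<Rightarrow> nat \<Rightarrow> complex mat \<Rightarrow> complex mat" where
  "extended_mat k n z = mat (k + 1) (n + 1)
     (\<lambda>(i, j). if j \<le> k then (if i = j then 1 else 0) else z $$ (i, j - (k + 1)))"

definition lin_form :: "nat \<Rightarrow> nat \<Rightarrow> nat \<Rightarrow> (nat \<Rightarrow> complex) \<Rightarrow> complex mat \<Rightarrow> complex" where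
  "lin_form k n j \<alpha> z = (\<Sum>i\<in>{0..k}. extended_mat k n z $$ (i, j) * \<alpha> i)"

definition hyperplane :: "nat \<Rightarrow> nat \<Rightarrow> complex mat \<Rightarrow> nat \<Rightarrow> (nat \<Rightarrow> complex) set set" where
  "hyperplane k n z j =
     proj_point k ` {\<alpha> \<in> topspace (punctured_space k). lin_form k n j \<alpha> z = 0}"

definition arr_complement :: "nat \<Rightarrow> nat \<Rightarrow> complex mat \<Rightarrow> (nat \<Rightarrow> complex) set topology" where
  "arr_complement k n z = subtopology (projective_space k)
     (topspace (projective_space k) - (\<Union>j\<in>{0..n}. hyperplane k n z j))"

definition signed_euler :: "nat \<Rightarrow> nat \<Rightarrow> complex mat \<Rightarrow> int" where
  "signed_euler k n z = (-1) ^ k * euler_characteristic (arr_complement k n z)"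


section \<open>Subvarieties of matrix space\<close>

inductive polynomial_fun :: "nat \<Rightarrow> nat \<Rightarrow> (complex mat \<Rightarrow> complex) \<Rightarrow> bool"
  for r c :: nat where
  const: "polynomial_fun r c (\<lambda>_. a)"
| coord: "i < r \<Longrightarrow> j < c \<Longrightarrow> polynomial_fun r c (\<lambda>z. z $$ (i, j))"
| add: "polynomial_fun r c f \<Longrightarrow> polynomial_fun r c g \<Longrightarrow> polynomial_fun r c (\<lambda>z. f z + g z)"
| mult: "polynomial_fun r c f \<Longrightarrow> polynomial_fun r c g \<Longrightarrow> polynomial_fun r c (\<lambda>z. f z * g z)"

definition zariski_closed :: "nat \<Rightarrow> nat \<Rightarrow> complex mat set \<Rightarrow> bool" where
  "zariski_closed r c Z \<longleftrightarrow>
     (\<exists>F. (\<forall>f\<in>F. polynomial_fun r c f) \<and> Z = {z \<in> carrier_mat r c. \<forall>f\<in>F. f z = 0})"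

text \<open>A variety is irreducible. This is essential below: a minor that vanishes on one component
  of a reducible \<open>Z\<close> only would still be a factor of the reduced discriminant.\<close>

definition subvariety :: "nat \<Rightarrow> nat \<Rightarrow> complex mat set \<Rightarrow> bool" where
  "subvariety r c Z \<longleftrightarrow> zariski_closed r c Z \<and> Z \<noteq> {} \<and>
     (\<forall>A B. zariski_closed r c A \<longrightarrow> zariski_closed r c B \<longrightarrow> Z \<subseteq> A \<union> B \<longrightarrow> Z \<subseteq> A \<or> Z \<subseteq> B)"


section \<open>Euler discriminant and reduced discriminant\<close>

definition max_signed_euler :: "nat \<Rightarrow> nat \<Rightarrow> complex mat set \<Rightarrow> int" where
  "max_signed_euler k n Z = Max (signed_euler k n ` Z)"

definition euler_discriminant :: "nat \<Rightarrow> nat \<Rightarrow> complex mat set \<Rightarrow> complex mat set" where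
  "euler_discriminant k n Z = {z \<in> Z. signed_euler k n z < max_signed_euler k n Z}"

text \<open>For \<open>J \<subseteq> {k+1..n}\<close>, the columns \<open>J\<close> of the extended matrix are those of \<open>z\<close>. The pair
  \<open>({}, {})\<close> is allowed; its minor is 1.\<close>

definition minor :: "nat \<Rightarrow> nat \<Rightarrow> nat set \<Rightarrow> nat set \<Rightarrow> complex mat \<Rightarrow> complex" where
  "minor k n I J z = Determinant.det (submatrix (extended_mat k n z) I J)"

definition nonzero_minors :: "nat \<Rightarrow> nat \<Rightarrow> complex mat set \<Rightarrow> (nat set \<times> nat set) set" where
  "nonzero_minors k n Z = {(I, J). I \<subseteq> {0..k} \<and> J \<subseteq> {k+1..n} \<and> card I = card J \<and>
     (\<exists>z\<in>Z. minor k n I J z \<noteq> 0)}"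

definition reduced_discriminant :: "nat \<Rightarrow> nat \<Rightarrow> complex mat set \<Rightarrow> complex mat \<Rightarrow> complex" where
  "reduced_discriminant k n Z z = (\<Prod>(I, J)\<in>nonzero_minors k n Z. minor k n I J z)"

end

theory Submission
  imports Defs "HOL-Library.Function_Algebras"
begin

text \<open>Dehomogenising at the coordinate hyperplane \<open>H\<^sub>0\<close> turns \<open>X\<^sub>z\<close> into an affine arrangement
  complement, on which the Euler characteristic behaves like a measure: removing a hyperplane \<open>H\<close> subtracts
  the Euler characteristic of the trace on \<open>H\<close>, because a tubular neighbourhood of the trace punctured
  along \<open>H\<close> is a product with a punctured disc and has Euler characteristic 0. Inclusion--exclusion then
  identifies \<open>\<chi>\<^sub>z\<close> with Crapo's beta invariant of the matroid of the columns of \<open>C(z)\<close>. The bases of this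
  matroid correspond to the nonzero minors of \<open>z\<close>, so, \<open>Z\<close> being irreducible, the matroid of every point
  of \<open>Z\<close> is a rank-preserving weak image of the matroid of a generic point. It remains to see that
  a proper weak image of a matroid with positive beta invariant has a strictly smaller beta invariant; this is
  an induction on the ground set by deletion and contraction, using that the invariant vanishes exactly for
  disconnected matroids.\<close>


section \<open>Crapo's beta invariant under weak maps\<close>

text \<open>Two difficulties shape the argument. Euler characteristics are built from ranks of
  integral homology groups, and such a rank is an honest number only if the sizes of independent
  sets are bounded. So each topological step proves finiteness of homology along with its formula,
  and gluing must also work backwards, from the whole space to one of the two open pieces. On the
  matroid side the weak inequality follows from deletion and contraction by induction, but
  strictness does not: if beta vanishes on one of the two minors, the induction says nothing about
  that minor, and the rank function has to be rebuilt from the other one alone. This is possible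
  because vanishing beta yields a separation, which decides whether the element \<open>e\<close> is
  spanned by each of the two parts. Positivity of the generic value is essential here, since a
  proper weak image of a matroid with beta 0 again has beta 0.\<close>

definition rank_fun :: "'a set \<Rightarrow> ('a set \<Rightarrow> nat) \<Rightarrow> bool" where
  "rank_fun E r \<longleftrightarrow> finite E \<and> r {} = 0 \<and>
     (\<forall>A x. A \<subseteq> E \<longrightarrow> x \<in> E \<longrightarrow> r A \<le> r (insert x A) \<and> r (insert x A) \<le> r A + 1) \<and>
     (\<forall>A B x. A \<subseteq> B \<longrightarrow> B \<subseteq> E \<longrightarrow> x \<in> E \<longrightarrow> r (insert x B) + r A \<le> r (insert x A) + r B)"

definition alt_sum :: "'a set \<Rightarrow> ('a set \<Rightarrow> nat) \<Rightarrow> int" where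
  "alt_sum E r = (\<Sum>A\<in>Pow E. (-1) ^ card A * int (r A))"

definition crapo_beta :: "'a set \<Rightarrow> ('a set \<Rightarrow> nat) \<Rightarrow> int" where
  "crapo_beta E r = (-1) ^ r E * alt_sum E r"

text \<open>Truncated subtraction is harmless for \<open>e\<close> in the ground set, where
  \<open>r {e}\<close> is at most the rank of any set containing \<open>e\<close>. For a loop the
  contraction agrees with the deletion.\<close>

definition contract :: "'a \<Rightarrow> ('a set \<Rightarrow> nat) \<Rightarrow> 'a set \<Rightarrow> nat" where
  "contract e r = (\<lambda>A. r (insert e A) - r {e})"

text \<open>A direct sum decomposition into two nonempty parts, that is, disconnectedness of the
  matroid. Additivity for the two parts themselves already forces it for all their subsets.\<close>

definition separated :: "'a set \<Rightarrow> ('a set \<Rightarrow> nat) \<Rightarrow> bool" where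
  "separated E r \<longleftrightarrow> (\<exists>E1 E2. E1 \<noteq> {} \<and> E2 \<noteq> {} \<and> E1 \<inter> E2 = {} \<and> E1 \<union> E2 = E \<and> r E1 + r E2 = r E)"

lemma rank_fun_finite: "rank_fun E r \<Longrightarrow> finite E"
  and rank_fun_empty: "rank_fun E r \<Longrightarrow> r {} = 0"
  and rank_fun_insert_ge: "rank_fun E r \<Longrightarrow> A \<subseteq> E \<Longrightarrow> x \<in> E \<Longrightarrow> r A \<le> r (insert x A)"
  and rank_fun_insert_le: "rank_fun E r \<Longrightarrow> A \<subseteq> E \<Longrightarrow> x \<in> E \<Longrightarrow> r (insert x A) \<le> r A + 1"
  and rank_fun_insert_diminishing:
    "rank_fun E r \<Longrightarrow> A \<subseteq> B \<Longrightarrow> B \<subseteq> E \<Longrightarrow> x \<in> E \<Longrightarrow> r (insert x B) + r A \<le> r (insert x A) + r B"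
  unfolding rank_fun_def by blast+

text \<open>Telescoping: the elements of \<open>C\<close> are added one at a time, and each gains at
  \<open>B\<close> no more than at \<open>A\<close>.\<close>

lemma rank_fun_diminishing:
  assumes "rank_fun E r" "A \<subseteq> B" "B \<subseteq> E" "C \<subseteq> E"
  shows "r (B \<union> C) + r A \<le> r (A \<union> C) + r B"
proof -
  have "finite C" using assms rank_fun_finite finite_subset by blast
  then show ?thesis using assms(4)
  proof induction
    case empty then show ?case by simp
  next
    case (insert x C)
    have "r (insert x (B \<union> C)) + r (A \<union> C) \<le> r (insert x (A \<union> C)) + r (B \<union> C)"
      using insert assms by (intro rank_fun_insert_diminishing[of E]) auto
    with insert show ?case by simp
  qed
qed

lemma rank_fun_submodular:
  assumes "rank_fun E r" "A \<subseteq> E" "B \<subseteq> E"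
  shows "r (A \<union> B) + r (A \<inter> B) \<le> r A + r B"
proof -
  have "r (A \<union> B) + r (A \<inter> B) \<le> r ((A \<inter> B) \<union> B) + r A"
    using assms by (intro rank_fun_diminishing[of E]) auto
  moreover have "(A \<inter> B) \<union> B = B" by blast
  ultimately show ?thesis by simp
qed

lemma rank_fun_mono_bound:
  assumes "rank_fun E r" "A \<subseteq> B" "B \<subseteq> E"
  shows "r A \<le> r B" "r B \<le> r A + card (B - A)"
proof -
  have "finite (B - A)" using assms rank_fun_finite finite_subset by (metis finite_Diff)
  then have "r A \<le> r (A \<union> C) \<and> r (A \<union> C) \<le> r A + card C" if "C \<subseteq> B - A" for C
  proof -
    have "finite C" using \<open>finite (B - A)\<close> that finite_subset by blast
    then show ?thesis using that
    proof induction
      case empty then show ?case by simp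
    next
      case (insert x C)
      have "r (A \<union> C) \<le> r (insert x (A \<union> C))" "r (insert x (A \<union> C)) \<le> r (A \<union> C) + 1"
        using insert assms by (intro rank_fun_insert_ge[of E] rank_fun_insert_le[of E]; auto)+
      with insert show ?case by auto
    qed
  qed
  from this[of "B - A"] show "r A \<le> r B" "r B \<le> r A + card (B - A)"
    using assms(2) by (simp_all add: Un_absorb1 Un_Diff_cancel)
qed

lemma rank_fun_mono: "rank_fun E r \<Longrightarrow> A \<subseteq> B \<Longrightarrow> B \<subseteq> E \<Longrightarrow> r A \<le> r B"
  by (rule rank_fun_mono_bound)

lemma rank_fun_le_card: "rank_fun E r \<Longrightarrow> A \<subseteq> E \<Longrightarrow> r A \<le> card A"
  using rank_fun_mono_bound(2)[of E r "{}" A] by (simp add: rank_fun_empty)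

text \<open>The axioms speak only of subsets of the ground set, so a deletion is the same function
  considered on a smaller set.\<close>

lemma rank_fun_subset: "rank_fun E r \<Longrightarrow> F \<subseteq> E \<Longrightarrow> rank_fun F r"
  unfolding rank_fun_def by (meson finite_subset subset_trans subsetD)

lemma rank_fun_contract:
  assumes r: "rank_fun E r" and e: "e \<in> E"
  shows "rank_fun (E - {e}) (contract e r)"
proof -
  have *: "r {e} \<le> r (insert e A)" if "A \<subseteq> E" for A
    using that e by (intro rank_fun_mono[OF r]) auto
  show ?thesis
    unfolding rank_fun_def
  proof (intro conjI allI impI)
    show "finite (E - {e})" using rank_fun_finite[OF r] by simp
    show "contract e r {} = 0" by (simp add: contract_def)
  next
    fix A x assume "A \<subseteq> E - {e}" "x \<in> E - {e}"
    then have A: "insert e A \<subseteq> E" "x \<in> E" "A \<subseteq> E" using e by auto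
    show "contract e r A \<le> contract e r (insert x A)" "contract e r (insert x A) \<le> contract e r A + 1"
      using rank_fun_insert_ge[OF r A(1,2)] rank_fun_insert_le[OF r A(1,2)] *[OF A(3)]
      unfolding contract_def insert_commute[of e x] by linarith+
  next
    fix A B x assume "A \<subseteq> B" "B \<subseteq> E - {e}" "x \<in> E - {e}"
    then have AB: "insert e A \<subseteq> insert e B" "insert e B \<subseteq> E" "x \<in> E" "A \<subseteq> E" "B \<subseteq> E"
      "insert x A \<subseteq> E" "insert x B \<subseteq> E" using e by auto
    show "contract e r (insert x B) + contract e r A \<le> contract e r (insert x A) + contract e r B"
      using rank_fun_insert_diminishing[OF r AB(1-3)] *[OF AB(4)] *[OF AB(5)] *[OF AB(6)] *[OF AB(7)]
      unfolding contract_def insert_commute[of e x] by linarith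
  qed
qed

section \<open>Alternating sums and the deletion-contraction recursion\<close>

lemma alt_sum_remove:
  assumes "finite E" "e \<in> E"
  shows "alt_sum E r = (\<Sum>A\<in>Pow (E - {e}). (-1) ^ card A * (int (r A) - int (r (insert e A))))"
proof -
  let ?F = "E - {e}"
  have E: "E = insert e ?F" using assms by auto
  have "alt_sum E r = (\<Sum>A\<in>Pow ?F \<union> insert e ` Pow ?F. (-1) ^ card A * int (r A))"
    unfolding alt_sum_def by (subst E, subst Pow_insert) simp
  also have "\<dots> = (\<Sum>A\<in>Pow ?F. (-1) ^ card A * int (r A)) + (\<Sum>A\<in>insert e ` Pow ?F. (-1) ^ card A * int (r A))"
    using assms by (intro sum.union_disjoint) auto
  also have "(\<Sum>A\<in>insert e ` Pow ?F. (-1) ^ card A * int (r A)) =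
      (\<Sum>A\<in>Pow ?F. (-1) ^ card (insert e A) * int (r (insert e A)))"
  proof (subst sum.reindex)
    show "inj_on (insert e) (Pow ?F)" by (rule inj_onI) blast
  qed simp
  also have "\<dots> = (\<Sum>A\<in>Pow ?F. - ((-1) ^ card A * int (r (insert e A))))"
  proof (rule sum.cong[OF refl])
    fix A assume "A \<in> Pow ?F"
    then have "finite A" "e \<notin> A" using assms finite_subset by auto
    then show "(-1) ^ card (insert e A) * int (r (insert e A)) = - ((-1) ^ card A * int (r (insert e A)))"
      by simp
  qed
  finally show ?thesis by (simp add: sum_negf algebra_simps sum_subtractf)
qed

lemma sum_Pow_minus_one:
  assumes "finite E" "E \<noteq> {}"
  shows "(\<Sum>A\<in>Pow E. (-1) ^ card A) = (0::int)"
proof -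
  obtain e where e: "e \<in> E" using assms by blast
  define r where "r A = (if e \<in> A then 0 else 1::nat)" for A
  have "alt_sum E r = (\<Sum>A\<in>Pow (E - {e}). (-1) ^ card A)"
    unfolding alt_sum_remove[OF assms(1) e] by (intro sum.cong) (auto simp: r_def)
  moreover have "alt_sum E (\<lambda>_. 1) = 0"
    unfolding alt_sum_remove[OF assms(1) e] by simp
  ultimately show ?thesis by (simp add: alt_sum_def)
qed

lemma crapo_beta_eqI:
  assumes "\<And>A. A \<subseteq> E \<Longrightarrow> r A = r' A"
  shows "crapo_beta E r = crapo_beta E r'"
  unfolding crapo_beta_def alt_sum_def using assms by (auto intro!: sum.cong)

text \<open>A loop never changes the rank, so the subsets with and without it cancel in
  pairs.\<close>

lemma crapo_beta_loop:
  assumes r: "rank_fun E r" and "e \<in> E" "r {e} = 0"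
  shows "crapo_beta E r = 0"
proof -
  have "r A = r (insert e A)" if "A \<subseteq> E - {e}" for A
  proof -
    have "A \<subseteq> E" using that by auto
    then show ?thesis
      using rank_fun_insert_diminishing[OF r, of "{}" A e] rank_fun_insert_ge[OF r, of A e] assms
        rank_fun_empty[OF r] by (auto simp: le_antisym)
  qed
  then have "alt_sum E r = 0"
    unfolding alt_sum_remove[OF rank_fun_finite[OF r] assms(2)] by (intro sum.neutral) auto
  then show ?thesis by (simp add: crapo_beta_def)
qed

lemma rank_fun_coloop:
  assumes r: "rank_fun E r" and "e \<in> E" "r (E - {e}) < r E" "A \<subseteq> E - {e}"
  shows "r (insert e A) = r A + 1"
proof -
  have "A \<subseteq> E" using assms by auto
  then show ?thesis
    using rank_fun_insert_diminishing[OF r, of A "E - {e}" e] rank_fun_insert_le[OF r, of A e] assms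
    by (auto simp: insert_absorb)
qed

lemma rank_fun_elem_cases:
  assumes r: "rank_fun E r" and "e \<in> E"
  obtains (loop) "r {e} = 0" | (coloop) "r {e} = 1" "r (E - {e}) < r E" | (minor) "r {e} = 1" "r (E - {e}) = r E"
proof -
  have "r {e} \<le> 1" "r (E - {e}) \<le> r E"
    using rank_fun_le_card[OF r, of "{e}"] rank_fun_mono[OF r, of "E - {e}" E] assms by auto
  then show ?thesis using that by linarith
qed

text \<open>After pairing along a coloop every rank difference is -1, and an alternating sum of ones
  over a power set remains. It vanishes because \<open>E - {e}\<close> is nonempty; a lone coloop
  has beta 1.\<close>

lemma crapo_beta_coloop:
  assumes r: "rank_fun E r" and "e \<in> E" "r (E - {e}) < r E" "E \<noteq> {e}"
  shows "crapo_beta E r = 0"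
proof -
  have "alt_sum E r = (\<Sum>A\<in>Pow (E - {e}). (-1) ^ card A * (-1))"
    unfolding alt_sum_remove[OF rank_fun_finite[OF r] assms(2)]
    using rank_fun_coloop[OF assms(1-3)] by (intro sum.cong) auto
  also have "\<dots> = - (\<Sum>A\<in>Pow (E - {e}). (-1) ^ card A)" by (simp add: sum_negf)
  also have "\<dots> = 0" using assms by (subst sum_Pow_minus_one) (auto simp: rank_fun_finite)
  finally show ?thesis by (simp add: crapo_beta_def)
qed

text \<open>In the pairing along \<open>e\<close>, contraction shifts the ranks of the sets
  containing \<open>e\<close> by the constant 1, whose alternating sum vanishes on the nonempty set
  \<open>E - {e}\<close>. The contraction has rank one less, which turns the difference of
  alternating sums into a sum of invariants.\<close>

lemma crapo_beta_deletion_contraction: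
  assumes r: "rank_fun E r" and e: "e \<in> E" "r {e} = 1" "r (E - {e}) = r E" "E \<noteq> {e}"
  shows "crapo_beta E r = crapo_beta (E - {e}) r + crapo_beta (E - {e}) (contract e r)"
proof -
  let ?F = "E - {e}"
  have c: "int (contract e r A) = int (r (insert e A)) - 1" if "A \<subseteq> ?F" for A
  proof -
    have "insert e A \<subseteq> E" using that e by auto
    then show ?thesis using rank_fun_mono[OF r, of "{e}" "insert e A"] e by (auto simp: contract_def)
  qed
  have "alt_sum ?F (contract e r) = (\<Sum>A\<in>Pow ?F. (-1) ^ card A * int (r (insert e A)) - (-1) ^ card A)"
    unfolding alt_sum_def using c by (intro sum.cong) (auto simp: right_diff_distrib)
  also have "\<dots> = (\<Sum>A\<in>Pow ?F. (-1) ^ card A * int (r (insert e A)))"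
    using e rank_fun_finite[OF r] by (simp add: sum_subtractf) (intro sum_Pow_minus_one; auto)
  finally have "alt_sum ?F (contract e r) = (\<Sum>A\<in>Pow ?F. (-1) ^ card A * int (r (insert e A)))" .
  moreover have "alt_sum E r = alt_sum ?F r - (\<Sum>A\<in>Pow ?F. (-1) ^ card A * int (r (insert e A)))"
    unfolding alt_sum_remove[OF rank_fun_finite[OF r] e(1)]
    by (simp add: alt_sum_def sum_subtractf right_diff_distrib)
  ultimately have a: "alt_sum E r = alt_sum ?F r - alt_sum ?F (contract e r)" by simp
  have "r E = Suc (contract e r ?F)" using c[of ?F] e by (simp add: insert_absorb)
  then show ?thesis using e(3) by (simp add: crapo_beta_def a right_diff_distrib)
qed

lemma crapo_beta_singleton:
  assumes "rank_fun {e} r" shows "crapo_beta {e} r = int (r {e})"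
proof -
  have "r {e} \<le> 1" using rank_fun_le_card[OF assms, of "{e}"] by simp
  then have "r {e} = 0 \<or> r {e} = 1" by auto
  moreover have "alt_sum {e} r = - int (r {e})"
    using alt_sum_remove[of "{e}" e r] rank_fun_empty[OF assms] by simp
  ultimately show ?thesis by (elim disjE) (simp_all add: crapo_beta_def)
qed

section \<open>Connectedness and vanishing of beta\<close>

lemma separated_rank:
  assumes r: "rank_fun E r" and "E1 \<inter> E2 = {}" "E1 \<union> E2 = E" "r E1 + r E2 = r E"
    and A: "A \<subseteq> E1" "B \<subseteq> E2"
  shows "r (A \<union> B) = r A + r B"
proof -
  \<comment> \<open>Shrinking \<open>E2\<close> to \<open>B\<close> and then \<open>E1\<close> to
    \<open>A\<close> loses in the union at most what the shrunk part loses. From an additive total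
    this leaves \<open>r A + r B \<le> r (A \<union> B)\<close>.\<close>
  have 1: "r (E1 \<union> E2) + r B \<le> r (E1 \<union> B) + r E2"
    using rank_fun_diminishing[OF r, of B E2 E1] assms by (auto simp: Un_commute)
  have 2: "r (E1 \<union> B) + r A \<le> r (A \<union> B) + r E1"
    using assms by (intro rank_fun_diminishing[OF r]) auto
  have 3: "r (A \<union> B) \<le> r A + r B"
    using assms by (intro order_trans[OF _ rank_fun_submodular[OF r, of A B]]) auto
  from 1 2 3 assms show ?thesis by simp
qed

text \<open>Two parallel elements: deleting \<open>e\<close> leaves a coloop with beta 1,
  contracting \<open>e\<close> turns \<open>f\<close> into a loop with beta 0.\<close>

lemma crapo_beta_doubleton:
  assumes r: "rank_fun {e, f} r" and ef: "e \<noteq> f" "r {e} = 1" "r {f} = r {e, f}"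
  shows "crapo_beta {e, f} r = 1"
proof -
  have "crapo_beta {f} (contract e r) = 0"
    using rank_fun_contract[OF r, of e] ef rank_fun_le_card[OF rank_fun_subset[OF r, of "{f}"], of "{f}"]
      crapo_beta_singleton[of f "contract e r"] by (simp add: contract_def insert_Diff_if)
  moreover have "r {e} \<le> r {e, f}" "r {f} \<le> 1"
    using rank_fun_mono[OF r, of "{e}" "{e,f}"] rank_fun_le_card[OF r, of "{f}"] by auto
  ultimately show ?thesis
    using crapo_beta_deletion_contraction[OF r, of e] ef crapo_beta_singleton[of f r]
      rank_fun_subset[OF r, of "{f}"] by (auto simp: insert_Diff_if)
qed

lemma crapo_beta_nonneg:
  assumes "rank_fun E r"
  shows "crapo_beta E r \<ge> 0"
  using rank_fun_finite[OF assms] assms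
proof (induction E arbitrary: r rule: finite_psubset_induct)
  case (psubset E)
  show ?case
  proof (cases "E = {}")
    case True then show ?thesis using psubset.prems by (simp add: crapo_beta_def alt_sum_def rank_fun_empty)
  next
    case False
    then obtain e where e: "e \<in> E" by blast
    consider "E = {e}" | "E \<noteq> {e}" "r {e} = 0" | "E \<noteq> {e}" "r (E - {e}) < r E"
      | "E \<noteq> {e}" "r {e} = 1" "r (E - {e}) = r E"
      using rank_fun_elem_cases[OF psubset.prems e] by metis
    then show ?thesis
    proof cases
      case 1 then show ?thesis using crapo_beta_singleton psubset.prems by fastforce
    next
      case 2 then show ?thesis using crapo_beta_loop[OF psubset.prems e] by simp
    next
      case 3 then show ?thesis using crapo_beta_coloop[OF psubset.prems e] by simp
    next
      case 4
      have "E - {e} \<subset> E" using e by auto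
      from psubset.IH[OF this rank_fun_subset[OF psubset.prems]] psubset.IH[OF this rank_fun_contract[OF psubset.prems e]]
      show ?thesis using crapo_beta_deletion_contraction[OF psubset.prems e 4(2,3,1)] by auto
    qed
  qed
qed

text \<open>Uncrossing a separation of the deletion with one of the contraction.\<close>

lemma separated_if_minors_separated:
  assumes r: "rank_fun E r" and e: "e \<in> E" "r {e} = 1" "r (E - {e}) = r E"
    and del: "separated (E - {e}) r" and con: "separated (E - {e}) (contract e r)"
  shows "separated E r"
proof (rule ccontr)
  assume ns: "\<not> separated E r"
  from del obtain E1 E2 where E12: "E1 \<noteq> {}" "E2 \<noteq> {}" "E1 \<inter> E2 = {}" "E1 \<union> E2 = E - {e}" "r E1 + r E2 = r E"
    unfolding separated_def e(3) by blast
  from con obtain F1 F2 where F12: "F1 \<noteq> {}" "F2 \<noteq> {}" "F1 \<inter> F2 = {}" "F1 \<union> F2 = E - {e}"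
    and F': "contract e r F1 + contract e r F2 = contract e r (E - {e})"
    unfolding separated_def by blast
  have ge: "r {e} \<le> r (insert e A)" if "A \<subseteq> E" for A
    using that e by (intro rank_fun_mono[OF r]) auto
  have "F1 \<subseteq> E" "F2 \<subseteq> E" using F12 by auto
  then have F: "r (insert e F1) + r (insert e F2) = r E + 1"
    using F' ge[of F1] ge[of F2] ge[of E] e unfolding contract_def by (simp add: insert_absorb)
  \<comment> \<open>The second set contains \<open>e\<close>, so both sides of this partition of
    \<open>E\<close> are nonempty as soon as \<open>X \<inter> Y\<close> is; since \<open>E\<close>
    is not separated, their ranks exceed \<open>r E\<close> by at least 1.\<close>
  have cut: "r (X \<inter> Y) + r (insert e (X' \<union> Y')) \<ge> r E + 1"
    if "X \<inter> Y \<noteq> {}" "X \<inter> X' = {}" "X \<union> X' = E - {e}" "Y \<inter> Y' = {}" "Y \<union> Y' = E - {e}" for X X' Y Y'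
  proof -
    have u: "(X \<inter> Y) \<union> insert e (X' \<union> Y') = E" and i: "(X \<inter> Y) \<inter> insert e (X' \<union> Y') = {}"
      using that e(1) by auto
    have "X \<inter> Y \<subseteq> E" "insert e (X' \<union> Y') \<subseteq> E" using u by blast+
    then have "r E \<le> r (X \<inter> Y) + r (insert e (X' \<union> Y'))"
      using rank_fun_submodular[OF r, of "X \<inter> Y" "insert e (X' \<union> Y')"] unfolding u i by linarith
    moreover have "r (X \<inter> Y) + r (insert e (X' \<union> Y')) \<noteq> r E"
    proof
      assume "r (X \<inter> Y) + r (insert e (X' \<union> Y')) = r E"
      then have "separated E r"
        unfolding separated_def using that(1) u i
        by (intro exI[of _ "X \<inter> Y"] exI[of _ "insert e (X' \<union> Y')"]) simp
      with ns show False ..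
    qed
    ultimately show ?thesis by linarith
  qed
  have sub: "r (insert e (X \<union> Y)) + r (X \<inter> Y) \<le> r X + r (insert e Y)"
    if "X \<in> {E1, E2}" "Y \<in> {F1, F2}" for X Y
  proof -
    have "X \<inter> insert e Y = X \<inter> Y" "X \<union> insert e Y = insert e (X \<union> Y)" "X \<subseteq> E" "insert e Y \<subseteq> E"
      using that E12(4) F12(4) e(1) by auto
    then show ?thesis using rank_fun_submodular[OF r, of X "insert e Y"] by simp
  qed
  \<comment> \<open>The four intersections form a 2 by 2 table without an empty row or column. If
    each diagonal had an empty cell, these two cells would fill a row or a column.\<close>
  have "E1 = E1 \<inter> F1 \<union> E1 \<inter> F2" "E2 = E2 \<inter> F1 \<union> E2 \<inter> F2"
    "F1 = E1 \<inter> F1 \<union> E2 \<inter> F1" "F2 = E1 \<inter> F2 \<union> E2 \<inter> F2"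
    using E12(4) F12(4) by auto
  then have "(E1 \<inter> F1 \<noteq> {} \<and> E2 \<inter> F2 \<noteq> {}) \<or> (E1 \<inter> F2 \<noteq> {} \<and> E2 \<inter> F1 \<noteq> {})"
    using E12(1,2) F12(1,2) by force
  then show False
  proof
      assume *: "E1 \<inter> F1 \<noteq> {} \<and> E2 \<inter> F2 \<noteq> {}"
      \<comment> \<open>The two cuts add up to at least \<open>2 * r E + 2\<close>, but
        submodularity bounds the same four ranks by \<open>2 * r E + 1\<close>: the parts of the
        deletion contribute \<open>r E\<close>, those of the contraction with \<open>e\<close> added
        \<open>r E + 1\<close>.\<close>
      have "r (E1 \<inter> F1) + r (insert e (E2 \<union> F2)) \<ge> r E + 1" "r (E2 \<inter> F2) + r (insert e (E1 \<union> F1)) \<ge> r E + 1"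
        using * E12(3,4) F12(3,4) by (intro cut; simp add: Un_commute Int_commute)+
      then show False using sub[of E1 F1] sub[of E2 F2] E12(5) F by simp
    next
      assume *: "E1 \<inter> F2 \<noteq> {} \<and> E2 \<inter> F1 \<noteq> {}"
      have "r (E1 \<inter> F2) + r (insert e (E2 \<union> F1)) \<ge> r E + 1" "r (E2 \<inter> F1) + r (insert e (E1 \<union> F2)) \<ge> r E + 1"
        using * E12(3,4) F12(3,4) by (intro cut; simp add: Un_commute Int_commute)+
      then show False using sub[of E1 F2] sub[of E2 F1] E12(5) F by simp
  qed
qed

text \<open>Loops and coloops split off as direct summands. Otherwise beta is a sum of two
  nonnegative numbers, so it vanishes on deletion and contraction; both are separated by induction,
  and the two separations are uncrossed.\<close>

lemma crapo_beta_zero_imp_separated: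
  assumes "rank_fun E r" "card E \<ge> 2" "crapo_beta E r = 0"
  shows "separated E r"
  using rank_fun_finite[OF assms(1)] assms
proof (induction E arbitrary: r rule: finite_psubset_induct)
  case (psubset E)
  note r = psubset.prems(1)
  from psubset.prems(2) obtain e where e: "e \<in> E" by fastforce
  have ne: "E - {e} \<noteq> {}" "E \<noteq> {e}" using psubset.prems(2) e
    by (auto simp: subset_singleton_iff Diff_eq_empty_iff)
  have E: "{e} \<inter> (E - {e}) = {}" "{e} \<union> (E - {e}) = E" using e by auto
  from r e show ?case
  proof (cases rule: rank_fun_elem_cases)
    case loop
    have "r E \<le> r (E - {e})"
      using rank_fun_insert_diminishing[OF r, of "{}" "E - {e}" e] loop e rank_fun_empty[OF r] by (auto simp: insert_absorb)
    then have "r {e} + r (E - {e}) = r E" using loop rank_fun_mono[OF r, of "E - {e}" E] by auto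
    then show ?thesis using E ne unfolding separated_def by (metis insert_not_empty)
  next
    case coloop
    have "r {e} + r (E - {e}) = r E" using rank_fun_coloop[OF r e coloop(2), of "E - {e}"] coloop e by (simp add: insert_absorb)
    then show ?thesis using E ne unfolding separated_def by (metis insert_not_empty)
  next
    case minor
    have sub: "E - {e} \<subset> E" using e by auto
    note b = crapo_beta_deletion_contraction[OF r e minor ne(2)]
    have rs: "rank_fun (E - {e}) r" "rank_fun (E - {e}) (contract e r)"
      using rank_fun_subset[OF r] rank_fun_contract[OF r e] by auto
    have z: "crapo_beta (E - {e}) r = 0" "crapo_beta (E - {e}) (contract e r) = 0"
      using b psubset.prems(3) crapo_beta_nonneg[OF rs(1)] crapo_beta_nonneg[OF rs(2)] by auto
    \<comment> \<open>A one-element minor cannot be separated. It means that \<open>E\<close>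
      consists of two parallel elements, and then beta is 1.\<close>
    have "card (E - {e}) \<noteq> 1"
    proof
      assume "card (E - {e}) = 1"
      then obtain f where "E - {e} = {f}" by (auto simp: card_1_singleton_iff)
      then have "E = {e, f}" "e \<noteq> f" "E - {e} = {f}" using e by auto
      then show False using crapo_beta_doubleton[of e f r] r minor psubset.prems(3) by auto
    qed
    moreover have "card (E - {e}) \<noteq> 0" using ne psubset.hyps by auto
    ultimately have "card (E - {e}) \<ge> 2" by linarith
    then show ?thesis
      using separated_if_minors_separated[OF r e minor] psubset.IH[OF sub rs(1) _ z(1)] psubset.IH[OF sub rs(2) _ z(2)]
      by blast
  qed
qed


section \<open>Rigidity of weak maps\<close>

lemma separated_image_of_weak_map:
  assumes "rank_fun E r'" "E1 \<inter> E2 = {}" "E1 \<union> E2 = E" "r E1 + r E2 = r E" "r' E = r E"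
    and "r' E1 \<le> r E1" "r' E2 \<le> r E2"
  shows "r' E1 = r E1" "r' E2 = r E2"
  \<comment> \<open>Equality must hold throughout the chain
    \<open>r' E \<le> r' E1 + r' E2 \<le> r E1 + r E2 = r E\<close>, whose ends agree.\<close>
  using rank_fun_submodular[OF assms(1), of E1 E2] assms rank_fun_empty[OF assms(1)] by auto

text \<open>Ranks of sets containing \<open>e\<close> are recovered from the deletion. The parts
  \<open>E1\<close> and \<open>E2\<close> separate the contraction but not the deletion, which
  forces \<open>e\<close> into the span of each of them. For \<open>B \<subseteq> E1\<close> the set
  \<open>B \<union> E2\<close> therefore spans \<open>e\<close>, so adding \<open>e\<close> to it
  leaves a rank known from the deletion; additivity of the contraction then isolates the rank of
  \<open>insert e B\<close>.\<close>

lemma rank_fun_eq_if_deletion_eq: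
  assumes r: "rank_fun E r" and r': "rank_fun E r'"
    and le: "\<And>A. A \<subseteq> E \<Longrightarrow> r' A \<le> r A"
    and e: "e \<in> E" "r {e} = 1" "r' {e} = 1" "r (E - {e}) = r E" "r' E = r E"
    and del: "\<And>A. A \<subseteq> E - {e} \<Longrightarrow> r' A = r A"
    and conn: "\<not> separated (E - {e}) r"
    and sep: "separated (E - {e}) (contract e r)"
    and A: "A \<subseteq> E"
  shows "r' A = r A"
proof -
  from sep obtain E1 E2 where E12: "E1 \<noteq> {}" "E2 \<noteq> {}" "E1 \<inter> E2 = {}" "E1 \<union> E2 = E - {e}"
    and s: "contract e r E1 + contract e r E2 = contract e r (E - {e})"
    unfolding separated_def by blast
  have sub: "E1 \<subseteq> E - {e}" "E2 \<subseteq> E - {e}" "insert e (E - {e}) = E" "E1 \<subseteq> E" "E2 \<subseteq> E"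
    using E12 e(1) by auto
  have ns: "r E1 + r E2 \<noteq> r E"
    using conn E12 e(4) unfolding separated_def by metis
  have ge: "1 \<le> q (insert e B)" if "q \<in> {r, r'}" "B \<subseteq> E" for B q
  proof -
    have "{e} \<subseteq> insert e B" "insert e B \<subseteq> E" using that e by auto
    then show ?thesis using that rank_fun_mono[OF r, of "{e}" "insert e B"] rank_fun_mono[OF r', of "{e}" "insert e B"] e by auto
  qed
  have con: "Suc (contract e q B) = q (insert e B)" if "q \<in> {r, r'}" "B \<subseteq> E" for B q
    using ge[OF that] that e by (auto simp: contract_def)
  have s1: "r (insert e E1) + r (insert e E2) = r E + 1"
    using s con[of r E1] con[of r E2] con[of r "E - {e}"] sub by simp
  have mono: "q B \<le> q (insert e B)" if "q \<in> {r, r'}" "B \<subseteq> E" for q B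
    using that rank_fun_insert_ge[OF r that(2) e(1)] rank_fun_insert_ge[OF r' that(2) e(1)] by auto
  have "r E \<le> r E1 + r E2"
    using rank_fun_submodular[OF r, of E1 E2] E12 sub e(4) by auto
  \<comment> \<open>With \<open>e\<close> added, the ranks of the two parts sum to
    \<open>r E + 1\<close>; without it they sum to at least that much, as the deletion is connected.
    Hence \<open>e\<close> adds nothing to either part.\<close>
  with s1 ns mono[of r E1] mono[of r E2] sub have cl: "r (insert e E1) = r E1" "r (insert e E2) = r E2"
    by auto
  \<comment> \<open>Squeezed between \<open>r' F = r F\<close> and the weak inequality at
    \<open>insert e F\<close>. It follows that the same parts separate the contraction of
    \<open>r'\<close>.\<close>
  have cl': "r' (insert e F) = r (insert e F)" if "F \<in> {E1, E2}" for F
    using that cl le[of "insert e F"] mono[of r' F] del[of F] sub e(1) by auto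
  have s': "contract e r' E1 + contract e r' E2 = contract e r' (E - {e})"
    using s1 cl'[of E1] cl'[of E2] con[of r' E1] con[of r' E2] con[of r' "E - {e}"] sub e(5) by auto
  have part: "contract e q (B \<union> C) = contract e q B + contract e q C"
    if "q \<in> {r, r'}" "B \<subseteq> E1" "C \<subseteq> E2" for q B C
    using that separated_rank[OF rank_fun_contract[OF r e(1)] E12(3,4) s, of B C]
      separated_rank[OF rank_fun_contract[OF r' e(1)] E12(3,4) s', of B C] by auto
  have cls: "q (insert e (B \<union> F)) = q (B \<union> F)" if "q \<in> {r, r'}" "B \<subseteq> E - {e}" "F \<in> {E1, E2}" for q B F
  proof -
    have "q (insert e F) = q F" using that cl cl' del sub by auto
    moreover have "q (insert e (B \<union> F)) + q F \<le> q (insert e F) + q (B \<union> F)"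
      using that sub e(1) rank_fun_insert_diminishing[OF r, of F "B \<union> F" e]
        rank_fun_insert_diminishing[OF r', of F "B \<union> F" e] by auto
    moreover have "B \<union> F \<subseteq> E" using that sub by auto
    ultimately show ?thesis using mono[OF that(1), of "B \<union> F"] by simp
  qed
  have half: "r' (insert e B) = r (insert e B)"
    if F: "F = E1 \<and> F' = E2 \<or> F = E2 \<and> F' = E1" "B \<subseteq> F" for B F F'
  proof -
    have F': "F' \<in> {E1, E2}" using F by auto
    have B: "B \<subseteq> E - {e}" "F' \<subseteq> E - {e}" "B \<union> F' \<subseteq> E - {e}"
      "B \<subseteq> E" "F' \<subseteq> E" "B \<union> F' \<subseteq> E" using F sub by auto
    have *: "contract e q (B \<union> F') = contract e q B + contract e q F'" if "q \<in> {r, r'}" for q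
      using F part[OF that, of B F'] part[OF that, of F' B] by (auto simp: Un_commute)
    have "r (insert e (B \<union> F')) = r (B \<union> F')" "r' (insert e (B \<union> F')) = r' (B \<union> F')"
      using cls[OF _ B(1) F'] by auto
    then have "r' (insert e (B \<union> F')) = r (insert e (B \<union> F'))"
      using del[OF B(3)] by simp
    then show ?thesis
      using con[of r B] con[of r' B] con[of r F'] con[of r' F'] con[of r "B \<union> F'"] con[of r' "B \<union> F'"]
        cl'[OF F'] B(4-6) *[of r] *[of r'] by simp
  qed
  show ?thesis
  proof (cases "e \<in> A")
    case False then show ?thesis using del A by auto
  next
    case True
    then have A': "insert e (A \<inter> E1 \<union> A \<inter> E2) = A" using A E12 by auto
    have "A \<inter> E1 \<union> A \<inter> E2 \<subseteq> E" "A \<inter> E1 \<subseteq> E" "A \<inter> E2 \<subseteq> E" using A by auto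
    then have "r (insert e (A \<inter> E1 \<union> A \<inter> E2)) = r' (insert e (A \<inter> E1 \<union> A \<inter> E2))"
      using part[of r "A \<inter> E1" "A \<inter> E2"] part[of r' "A \<inter> E1" "A \<inter> E2"] half[of E1 E2 "A \<inter> E1"] half[of E2 E1 "A \<inter> E2"]
        con[of r "A \<inter> E1 \<union> A \<inter> E2"] con[of r' "A \<inter> E1 \<union> A \<inter> E2"] con[of r "A \<inter> E1"] con[of r' "A \<inter> E1"]
        con[of r "A \<inter> E2"] con[of r' "A \<inter> E2"] by auto
    then show ?thesis using A' by simp
  qed
qed

text \<open>The dual situation: \<open>E1\<close> and \<open>E2\<close> separate the deletion but
  not the contraction, so \<open>e\<close> raises the rank of both parts. By diminishing returns it
  raises the rank of each of their subsets, under \<open>r\<close> and under \<open>r'\<close>, and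
  the rank of such a subset is one less than the known rank with \<open>e\<close> added.\<close>

lemma rank_fun_eq_if_contraction_eq:
  assumes r: "rank_fun E r" and r': "rank_fun E r'"
    and le: "\<And>A. A \<subseteq> E \<Longrightarrow> r' A \<le> r A"
    and e: "e \<in> E" "r {e} = 1" "r (E - {e}) = r E" "r' (E - {e}) = r' E" "r' E = r E"
    and con: "\<And>A. A \<subseteq> E - {e} \<Longrightarrow> r' (insert e A) = r (insert e A)"
    and sep: "separated (E - {e}) r"
    and conn: "\<not> separated (E - {e}) (contract e r)"
    and A: "A \<subseteq> E"
  shows "r' A = r A"
proof -
  from sep obtain E1 E2 where E12: "E1 \<noteq> {}" "E2 \<noteq> {}" "E1 \<inter> E2 = {}" "E1 \<union> E2 = E - {e}"
    and s: "r E1 + r E2 = r (E - {e})"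
    unfolding separated_def by blast
  have sub: "E1 \<subseteq> E - {e}" "E2 \<subseteq> E - {e}" "insert e (E - {e}) = E" "E1 \<subseteq> E" "E2 \<subseteq> E" using E12 e(1) by auto
  have rD: "rank_fun (E - {e}) r" "rank_fun (E - {e}) r'" using r r' by (auto intro: rank_fun_subset)
  have E': "r' E1 = r E1" "r' E2 = r E2"
    using separated_image_of_weak_map[OF rD(2) E12(3,4) s] e(3-5) le[OF sub(4)] le[OF sub(5)] by auto
  have rc: "rank_fun (E - {e}) (contract e r)" using r e(1) by (rule rank_fun_contract)
  have ge: "Suc (contract e r B) = r (insert e B)" if "B \<subseteq> E" for B
  proof -
    have "{e} \<subseteq> insert e B" "insert e B \<subseteq> E" using that e by auto
    then show ?thesis using rank_fun_mono[OF r, of "{e}" "insert e B"] e by (auto simp: contract_def)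
  qed
  have "contract e r E1 + contract e r E2 \<noteq> contract e r (E - {e})"
    using conn E12 unfolding separated_def by metis
  moreover have "contract e r (E - {e}) \<le> contract e r E1 + contract e r E2"
    using rank_fun_submodular[OF rc, of E1 E2] E12 sub by auto
  \<comment> \<open>Passing to the contraction costs 1 for each of the two parts but only 1 for the
    whole, so failing additivity there by 1 means an excess of 2 here, the most that adding
    \<open>e\<close> to both parts can produce.\<close>
  ultimately have "r (insert e E1) + r (insert e E2) \<ge> r E + 2"
    using ge[OF sub(4)] ge[OF sub(5)] ge[of "E - {e}"] sub(3) by auto
  then have cl: "r (insert e E1) = r E1 + 1" "r (insert e E2) = r E2 + 1"
    using rank_fun_insert_le[OF r sub(4) e(1)] rank_fun_insert_le[OF r sub(5) e(1)] s e(3) by auto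
  have half: "r' B = r B" if "F \<in> {E1, E2}" "B \<subseteq> F" for B F
  proof -
    have B: "F \<subseteq> E" "B \<subseteq> E" "B \<subseteq> E - {e}" using that sub by auto
    have "r (insert e F) = r F + 1" "r' (insert e F) = r' F + 1"
      using that(1) cl E' con[OF sub(1)] con[OF sub(2)] by (elim insertE; simp)+
    then show ?thesis
      using rank_fun_insert_diminishing[OF r that(2) B(1) e(1)] rank_fun_insert_diminishing[OF r' that(2) B(1) e(1)]
        rank_fun_insert_le[OF r B(2) e(1)] rank_fun_insert_le[OF r' B(2) e(1)] con[OF B(3)] by linarith
  qed
  show ?thesis
  proof (cases "e \<in> A")
    case True
    then have "insert e (A - {e}) = A" "A - {e} \<subseteq> E - {e}" using A by auto
    then show ?thesis using con[of "A - {e}"] by simp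
  next
    case False
    then have A': "A \<inter> E1 \<union> A \<inter> E2 = A" using A E12 by auto
    have s': "r' E1 + r' E2 = r' (E - {e})" using s E' e by simp
    have "r (A \<inter> E1 \<union> A \<inter> E2) = r (A \<inter> E1) + r (A \<inter> E2)" "r' (A \<inter> E1 \<union> A \<inter> E2) = r' (A \<inter> E1) + r' (A \<inter> E2)"
      by (rule separated_rank[OF rD(1) E12(3,4) s] separated_rank[OF rD(2) E12(3,4) s']; simp)+
    then show ?thesis using A' half[of E1 "A \<inter> E1"] half[of E2 "A \<inter> E2"] by simp
  qed
qed

text \<open>For an additive rank the alternating sum splits into two products, each having as a
  factor the alternating sum of ones over a nonempty power set.\<close>

lemma separated_imp_crapo_beta_zero:
  assumes r: "rank_fun E r" and "separated E r"
  shows "crapo_beta E r = 0"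
proof -
  obtain E1 E2 where E: "E1 \<noteq> {}" "E2 \<noteq> {}" "E1 \<inter> E2 = {}" "E1 \<union> E2 = E" "r E1 + r E2 = r E"
    using assms(2) unfolding separated_def by blast
  have fin: "finite E1" "finite E2" using rank_fun_finite[OF r] E by auto
  have "bij_betw (\<lambda>(A, B). A \<union> B) (Pow E1 \<times> Pow E2) (Pow E)"
  proof (rule bij_betw_byWitness[where f' = "\<lambda>A. (A \<inter> E1, A \<inter> E2)"])
    show "\<forall>X\<in>Pow E1 \<times> Pow E2. (\<lambda>A. (A \<inter> E1, A \<inter> E2)) ((\<lambda>(A, B). A \<union> B) X) = X"
      using E(3) by (auto simp: Int_Un_distrib2)
  qed (use E(4) in auto)
  from sum.reindex_bij_betw[OF this, of "\<lambda>A. (-1) ^ card A * int (r A)"]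
  have "alt_sum E r = (\<Sum>(A, B)\<in>Pow E1 \<times> Pow E2. (-1) ^ card (A \<union> B) * int (r (A \<union> B)))"
    unfolding alt_sum_def by (simp add: case_prod_beta)
  also have "\<dots> = (\<Sum>(A, B)\<in>Pow E1 \<times> Pow E2.
      (-1) ^ card B * ((-1) ^ card A * int (r A)) + (-1) ^ card A * ((-1) ^ card B * int (r B)))"
  proof (rule sum.cong[OF refl], clarify)
    fix A B assume AB: "A \<subseteq> E1" "B \<subseteq> E2"
    then have "card (A \<union> B) = card A + card B"
      using E(3) fin by (intro card_Un_disjoint) (auto intro: finite_subset)
    then show "(-1) ^ card (A \<union> B) * int (r (A \<union> B)) =
        (-1) ^ card B * ((-1) ^ card A * int (r A)) + (-1) ^ card A * ((-1) ^ card B * int (r B))"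
      using separated_rank[OF r E(3-5) AB] by (simp add: power_add algebra_simps)
  qed
  also have "\<dots> = (\<Sum>B\<in>Pow E2. (-1) ^ card B) * alt_sum E1 r + (\<Sum>A\<in>Pow E1. (-1) ^ card A) * alt_sum E2 r"
    unfolding alt_sum_def sum_product sum.distrib case_prod_beta
    by (subst sum.swap) (simp add: sum.distrib sum.cartesian_product case_prod_beta)
  also have "\<dots> = 0" using fin E by (simp add: sum_Pow_minus_one)
  finally show ?thesis by (simp add: crapo_beta_def)
qed

text \<open>On two or more elements, a loop or coloop of the weak image makes its beta 0 and settles
  both claims. If \<open>e\<close> is neither, it is neither for \<open>r\<close>, so both
  invariants obey deletion-contraction, and the minors are again weak images of equal rank. Equality
  of the sums means equality for both minors: a minor of positive beta is then rigid by induction,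
  and one of beta 0 is separated, which lets the other minor determine the rank function.\<close>

lemma crapo_beta_weak_map:
  assumes "rank_fun E r" "rank_fun E r'" "r' E = r E" "\<And>A. A \<subseteq> E \<Longrightarrow> r' A \<le> r A"
  shows "crapo_beta E r' \<le> crapo_beta E r \<and>
    (0 < crapo_beta E r \<longrightarrow> crapo_beta E r' = crapo_beta E r \<longrightarrow> (\<forall>A\<subseteq>E. r' A = r A))"
  using rank_fun_finite[OF assms(1)] assms
proof (induction E arbitrary: r r' rule: finite_psubset_induct)
  case (psubset E)
  note r = psubset.prems(1) and r' = psubset.prems(2) and eq = psubset.prems(3) and le = psubset.prems(4)
  show ?case
  proof (cases "\<exists>e. E \<subseteq> {e}")
    case True
    then obtain e where "E \<subseteq> {e}" by blast
    have "r' A = r A" if "A \<subseteq> E" for A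
    proof -
      have "A = {} \<or> A = E" using that \<open>E \<subseteq> {e}\<close> by auto
      then show ?thesis using eq rank_fun_empty[OF r] rank_fun_empty[OF r'] by auto
    qed
    then show ?thesis using crapo_beta_eqI[of E r' r] by auto
  next
    case False
    then obtain e where e: "e \<in> E" by auto
    have ne: "E \<noteq> {e}" "E - {e} \<noteq> {}" "insert e (E - {e}) = E" using e False by auto
    have c2: "card (E - {e}) \<noteq> 0" using ne psubset.hyps by auto
    have nn: "crapo_beta E r \<ge> 0" "crapo_beta E r' \<ge> 0" using r r' by (auto intro: crapo_beta_nonneg)
    from r' e show ?thesis
    proof (cases rule: rank_fun_elem_cases)
      case loop then show ?thesis using crapo_beta_loop[OF r' e] nn by auto
    next
      case coloop then show ?thesis using crapo_beta_coloop[OF r' e _ ne(1)] nn by auto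
    next
      case minor
      \<comment> \<open>A weak image can only gain loops and coloops: its ranks on
        \<open>{e}\<close> and \<open>E - {e}\<close> are no larger, while the total rank is
        kept.\<close>
      have "r (E - {e}) \<ge> r E" using le[of "E - {e}"] minor eq by auto
      moreover have "r {e} \<ge> 1" using le[of "{e}"] minor e by auto
      ultimately have m: "r {e} = 1" "r (E - {e}) = r E"
        using rank_fun_mono[OF r, of "E - {e}" E] rank_fun_le_card[OF r, of "{e}"] e by auto
      let ?F = "E - {e}"
      have F: "?F \<subset> E" using e by auto
      note rs = rank_fun_subset[OF r Diff_subset[of E "{e}"]] rank_fun_subset[OF r' Diff_subset[of E "{e}"]]
        rank_fun_contract[OF r e] rank_fun_contract[OF r' e]
      note b = crapo_beta_deletion_contraction[OF r e m ne(1)] crapo_beta_deletion_contraction[OF r' e minor ne(1)]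
      have D: "crapo_beta ?F r' \<le> crapo_beta ?F r \<and>
        (0 < crapo_beta ?F r \<longrightarrow> crapo_beta ?F r' = crapo_beta ?F r \<longrightarrow> (\<forall>A\<subseteq>?F. r' A = r A))"
        using rs m minor eq le by (intro psubset.IH[OF F]) auto
      have C: "crapo_beta ?F (contract e r') \<le> crapo_beta ?F (contract e r) \<and>
        (0 < crapo_beta ?F (contract e r) \<longrightarrow> crapo_beta ?F (contract e r') = crapo_beta ?F (contract e r) \<longrightarrow>
          (\<forall>A\<subseteq>?F. contract e r' A = contract e r A))"
      proof (rule psubset.IH[OF F])
        show "contract e r' A \<le> contract e r A" if "A \<subseteq> ?F" for A
          using that le[of "insert e A"] e m minor by (auto simp: contract_def intro: diff_le_mono)
        show "contract e r' ?F = contract e r ?F" using ne eq m minor by (simp add: contract_def)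
      qed (use rs in auto)
      have "\<forall>A\<subseteq>E. r' A = r A" if pos: "0 < crapo_beta E r" and beq: "crapo_beta E r' = crapo_beta E r"
      proof -
        have beq': "crapo_beta ?F r' = crapo_beta ?F r" "crapo_beta ?F (contract e r') = crapo_beta ?F (contract e r)"
          using b beq C D by linarith+
        have nn': "crapo_beta ?F r \<ge> 0" "crapo_beta ?F (contract e r) \<ge> 0"
          using rs by (auto intro: crapo_beta_nonneg)
        have con: "r' (insert e A) = r (insert e A)" if "A \<subseteq> ?F" "contract e r' A = contract e r A" for A
        proof -
          have "{e} \<subseteq> insert e A" "insert e A \<subseteq> E" using that e by auto
          then show ?thesis
            using that(2) rank_fun_mono[OF r, of "{e}" "insert e A"] rank_fun_mono[OF r', of "{e}" "insert e A"] m minor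
            by (auto simp: contract_def)
        qed
        show ?thesis
        \<comment> \<open>Vanishing beta yields a separation only from two elements on, so a
          one-element minor is compared directly: its rank is the total rank, which the weak image
          keeps.\<close>
        proof (cases "card ?F = 1")
          case True
          then obtain f where "?F = {f}" by (auto simp: card_1_singleton_iff)
          then have E: "E = {e, f}" "{f} = E - {e}" using e by auto
          have "r' A = r A" if "A \<subseteq> E" for A
          proof -
            have "A \<subseteq> {e, f}" using that E(1) by simp
            then have "A = {} \<or> A = {e} \<or> A = {f} \<or> A = {e, f}" by blast
            moreover have "r' {f} = r {f}" unfolding E(2) using m minor eq by simp
            moreover have "r' {e, f} = r {e, f}" using eq E(1) by simp
            ultimately show ?thesis using rank_fun_empty[OF r] rank_fun_empty[OF r'] m minor by auto
          qed
          then show ?thesis by blast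
        next
          case False
          then have c: "card ?F \<ge> 2" using c2 by linarith
          show ?thesis
          proof (cases "crapo_beta ?F r = 0"; cases "crapo_beta ?F (contract e r) = 0")
            assume "crapo_beta ?F r = 0" "crapo_beta ?F (contract e r) = 0"
            then show ?thesis using b pos by simp
          next
            assume *: "crapo_beta ?F r = 0" "crapo_beta ?F (contract e r) \<noteq> 0"
            then have "contract e r' A = contract e r A" if "A \<subseteq> ?F" for A
              using C beq' nn' that by auto
            moreover have "separated ?F r" "\<not> separated ?F (contract e r)"
              using crapo_beta_zero_imp_separated[OF rs(1) c] * separated_imp_crapo_beta_zero[OF rs(3)] by auto
            ultimately show ?thesis
              using rank_fun_eq_if_contraction_eq[OF r r' le e m minor(2) eq] con by simp
          next
            assume *: "crapo_beta ?F r \<noteq> 0" "crapo_beta ?F (contract e r) = 0"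
            then have "r' A = r A" if "A \<subseteq> ?F" for A
              using D beq' nn' that by auto
            moreover have "separated ?F (contract e r)" "\<not> separated ?F r"
              using crapo_beta_zero_imp_separated[OF rs(3) c] * separated_imp_crapo_beta_zero[OF rs(1)] by auto
            ultimately show ?thesis
              using rank_fun_eq_if_deletion_eq[OF r r' le e m(1) minor(1) m(2) eq] by simp
          next
            assume *: "crapo_beta ?F r \<noteq> 0" "crapo_beta ?F (contract e r) \<noteq> 0"
            have "r' A = r A" if "A \<subseteq> E" for A
            proof (cases "e \<in> A")
              case True
              then have "insert e (A - {e}) = A" "A - {e} \<subseteq> ?F" using that by auto
              moreover have "contract e r' (A - {e}) = contract e r (A - {e})"
                using C beq' nn' * \<open>A - {e} \<subseteq> ?F\<close> by simp
              ultimately show ?thesis using con[of "A - {e}"] by simp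
            next
              case False
              then show ?thesis using D beq' nn' * that by auto
            qed
            then show ?thesis by blast
          qed
        qed
      qed
      moreover have "crapo_beta E r' \<le> crapo_beta E r" using b C D by linarith
      ultimately show ?thesis by blast
    qed
  qed
qed

section \<open>Independent sets and bases\<close>

lemma rank_fun_obtain_independent:
  assumes r: "rank_fun E r" and "A \<subseteq> E"
  obtains I where "I \<subseteq> A" "card I = r A" "r I = r A"
proof -
  have "finite A" using assms rank_fun_finite finite_subset by blast
  then have "\<exists>I\<subseteq>A. card I = r A \<and> r I = r A" using assms(2)
  proof induction
    case empty then show ?case using rank_fun_empty[OF r] by simp
  next
    case (insert x A)
    then obtain I where I: "I \<subseteq> A" "card I = r A" "r I = r A" by auto
    have A: "A \<subseteq> E" "x \<in> E" "x \<notin> I" "finite I" using insert I finite_subset by auto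
    have "r (insert x A) = r A \<or> r (insert x A) = r A + 1"
      using rank_fun_insert_ge[OF r A(1,2)] rank_fun_insert_le[OF r A(1,2)] by linarith
    then show ?case
    proof
      assume "r (insert x A) = r A" then show ?thesis using I by auto
    next
      assume *: "r (insert x A) = r A + 1"
      have "r (insert x I) = r A + 1"
        using * I rank_fun_insert_diminishing[OF r I(1) A(1,2)] rank_fun_insert_le[OF r _ A(2), of I] A(1) by auto
      then show ?thesis using * I A by (intro exI[of _ "insert x I"]) auto
    qed
  qed
  then show ?thesis using that by blast
qed

lemma rank_fun_extend_to_basis:
  assumes r: "rank_fun E r" and "I \<subseteq> E" "card I = r I"
  obtains B where "I \<subseteq> B" "B \<subseteq> E" "card B = r E" "r B = r E"
proof -
  have "\<exists>B. I \<subseteq> B \<and> B \<subseteq> I \<union> A \<and> card B = r (I \<union> A) \<and> r B = r (I \<union> A)" if "finite A" "A \<subseteq> E" for A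
    using that
  proof induction
    case empty then show ?case using assms by auto
  next
    case (insert x A)
    then obtain B where B: "I \<subseteq> B" "B \<subseteq> I \<union> A" "card B = r (I \<union> A)" "r B = r (I \<union> A)" by auto
    have A: "I \<union> A \<subseteq> E" "x \<in> E" "B \<subseteq> E" using insert B assms(2) by auto
    have finB: "finite B" using A(3) rank_fun_finite[OF r] finite_subset by auto
    have "r (insert x (I \<union> A)) = r (I \<union> A) \<or> r (insert x (I \<union> A)) = r (I \<union> A) + 1"
      using rank_fun_insert_ge[OF r A(1,2)] rank_fun_insert_le[OF r A(1,2)] by linarith
    then show ?case
    proof
      assume "r (insert x (I \<union> A)) = r (I \<union> A)"
      then show ?thesis using B by (intro exI[of _ B]) auto
    next
      assume *: "r (insert x (I \<union> A)) = r (I \<union> A) + 1"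
      have rx: "r (insert x B) = r (I \<union> A) + 1"
        using * B rank_fun_insert_diminishing[OF r B(2) A(1,2)] rank_fun_insert_le[OF r A(3) A(2)] by auto
      then have "x \<notin> B" using B(4) by (auto simp: insert_absorb)
      then show ?thesis using * B rx finB by (intro exI[of _ "insert x B"]) auto
    qed
  qed
  from this[of E] obtain B where "I \<subseteq> B" "B \<subseteq> E" "card B = r E" "r B = r E"
    using rank_fun_finite[OF r] assms(2) by (auto simp: Un_absorb1)
  then show ?thesis using that by blast
qed

text \<open>The weak order can be tested on bases. A maximal independent subset of \<open>A\<close>
  for \<open>r'\<close> extends to a basis of \<open>r'\<close>; that basis is independent for
  \<open>r\<close>, hence so is the subset, because rank grows by at most one per element.\<close>

lemma rank_fun_le_if_bases_subset:
  assumes r: "rank_fun E r" and r': "rank_fun E r'"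
    and bases: "\<And>B. B \<subseteq> E \<Longrightarrow> card B = r' E \<Longrightarrow> r' B = r' E \<Longrightarrow> r B = card B"
    and A: "A \<subseteq> E"
  shows "r' A \<le> r A"
proof -
  obtain I where I: "I \<subseteq> A" "card I = r' A" "r' I = r' A"
    using rank_fun_obtain_independent[OF r' A] .
  then obtain B where B: "I \<subseteq> B" "B \<subseteq> E" "card B = r' E" "r' B = r' E"
    using rank_fun_extend_to_basis[OF r', of I] A by (metis subset_trans)
  have "finite B" using B rank_fun_finite[OF r] finite_subset by blast
  then have "card B = card I + card (B - I)" using B(1) by (metis card_Diff_subset card_mono finite_subset le_add_diff_inverse)
  then have "card I \<le> r I"
    using rank_fun_mono_bound(2)[OF r B(1,2)] bases[OF B(2-4)] by linarith
  also have "r I \<le> r A" using I(1) A by (rule rank_fun_mono[OF r])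
  finally show ?thesis using I by simp
qed


section \<open>Ranks of abelian groups\<close>

text \<open>Fraction-free elimination: a pivot \<open>c b0 s\<close> removes one equation and one
  unknown, and the other equations are cross-multiplied so that everything stays integral.\<close>

lemma integer_homogeneous_system:
  fixes c :: "'b \<Rightarrow> 't \<Rightarrow> int"
  assumes "finite T" "finite B" "card T < card B"
  shows "\<exists>x :: 'b \<Rightarrow> int. (\<exists>b\<in>B. x b \<noteq> 0) \<and> (\<forall>t\<in>T. (\<Sum>b\<in>B. x b * c b t) = 0)"
  using assms
proof (induction T arbitrary: B c rule: finite_induct)
  case empty
  then have "B \<noteq> {}" by auto
  then show ?case by (intro exI[of _ "\<lambda>_. 1"]) auto
next
  case (insert s T)
  show ?case
  proof (cases "\<forall>b\<in>B. c b s = 0")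
    case True
    from insert have "card T < card B" by simp
    from insert.IH[OF insert.prems(1) this, of c] show ?thesis using True by auto
  next
    case False
    then obtain b0 where b0: "b0 \<in> B" "c b0 s \<noteq> 0" by auto
    let ?B = "B - {b0}"
    have fin: "finite ?B" "b0 \<notin> ?B" "insert b0 ?B = B" using insert b0 by auto
    have "card T < card ?B" using insert b0 by simp
    from insert.IH[OF fin(1) this, of "\<lambda>b t. c b0 s * c b t - c b s * c b0 t"]
    obtain x where x: "\<exists>b\<in>?B. x b \<noteq> 0" "\<And>t. t \<in> T \<Longrightarrow> (\<Sum>b\<in>?B. x b * (c b0 s * c b t - c b s * c b0 t)) = 0"
      by blast
    \<comment> \<open>Back substitution: the solution of the smaller system is scaled by the pivot,
      so that the eliminated unknown solves equation \<open>s\<close> without division.\<close>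
    define y where "y b = (if b = b0 then - (\<Sum>b\<in>?B. x b * c b s) else c b0 s * x b)" for b
    have y: "(\<Sum>b\<in>B. y b * c b t) = c b0 s * (\<Sum>b\<in>?B. x b * c b t) - (\<Sum>b\<in>?B. x b * c b s) * c b0 t" for t
    proof -
      have "(\<Sum>b\<in>B. y b * c b t) = y b0 * c b0 t + (\<Sum>b\<in>?B. y b * c b t)"
        using insert.prems(1) b0(1) by (rule sum.remove)
      also have "(\<Sum>b\<in>?B. y b * c b t) = (\<Sum>b\<in>?B. c b0 s * (x b * c b t))"
        by (intro sum.cong) (auto simp: y_def)
      finally show ?thesis by (simp add: y_def sum_distrib_left)
    qed
    have "(\<Sum>b\<in>B. y b * c b t) = 0" if "t \<in> T" for t
      using x(2)[OF that] unfolding y by (simp add: right_diff_distrib sum_subtractf sum_distrib_left sum_distrib_right mult_ac)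
    moreover have "(\<Sum>b\<in>B. y b * c b s) = 0" unfolding y by simp
    moreover from x(1) obtain b where b: "b \<in> ?B" "x b \<noteq> 0" by blast
    then have "y b \<noteq> 0" "b \<in> B" using b0 by (auto simp: y_def)
    ultimately show ?thesis by (intro exI[of _ y]) blast
  qed
qed

section \<open>Integer combinations and spanning up to torsion\<close>

definition int_comb :: "('a, 'b) monoid_scheme \<Rightarrow> ('a \<Rightarrow> int) \<Rightarrow> 'a set \<Rightarrow> 'a" where
  "int_comb G c B = (\<Otimes>\<^bsub>G\<^esub>b\<in>B. b [^]\<^bsub>G\<^esub> c b)"

text \<open>The supremum of an unbounded set of natural numbers carries no information, so this
  predicate accompanies every rank. Independence is always measured in the ambient group, so that
  kernels and images are handled as plain subsets.\<close>

definition finite_rank_on :: "('a, 'b) monoid_scheme \<Rightarrow> 'a set \<Rightarrow> bool" where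
  "finite_rank_on G S \<longleftrightarrow> (\<exists>N. \<forall>B. int_independent G B \<longrightarrow> B \<subseteq> S \<longrightarrow> card B \<le> N)"

definition rank_on :: "('a, 'b) monoid_scheme \<Rightarrow> 'a set \<Rightarrow> nat" where
  "rank_on G S = Sup (card ` {B. int_independent G B \<and> B \<subseteq> S})"

lemma abelian_rank_eq_rank_on: "abelian_rank G = rank_on G (carrier G)"
proof -
  have "{B. int_independent G B} = {B. int_independent G B \<and> B \<subseteq> carrier G}"
    by (auto simp: int_independent_def)
  then show ?thesis unfolding abelian_rank_def rank_on_def by simp
qed

context comm_group
begin

lemma int_comb_closed [simp]: "B \<subseteq> carrier G \<Longrightarrow> int_comb G c B \<in> carrier G"
  unfolding int_comb_def by (intro finprod_closed) auto

lemma int_comb_empty [simp]: "int_comb G c {} = \<one>"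
  by (simp add: int_comb_def)

lemma int_comb_insert:
  "finite B \<Longrightarrow> x \<notin> B \<Longrightarrow> insert x B \<subseteq> carrier G \<Longrightarrow> int_comb G c (insert x B) = x [^] c x \<otimes> int_comb G c B"
  unfolding int_comb_def by (intro finprod_insert) auto

lemma int_comb_cong: "(\<And>b. b \<in> B \<Longrightarrow> c b = d b) \<Longrightarrow> B \<subseteq> carrier G \<Longrightarrow> int_comb G c B = int_comb G d B"
  unfolding int_comb_def by (intro finprod_cong') auto

lemma int_comb_Un_disjoint:
  "finite A \<Longrightarrow> finite B \<Longrightarrow> A \<inter> B = {} \<Longrightarrow> A \<subseteq> carrier G \<Longrightarrow> B \<subseteq> carrier G \<Longrightarrow>
     int_comb G c (A \<union> B) = int_comb G c A \<otimes> int_comb G c B"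
  unfolding int_comb_def by (intro finprod_Un_disjoint) auto

lemma int_comb_add:
  assumes "B \<subseteq> carrier G"
  shows "int_comb G (\<lambda>b. c b + d b) B = int_comb G c B \<otimes> int_comb G d B"
proof -
  have "int_comb G (\<lambda>b. c b + d b) B = (\<Otimes>b\<in>B. b [^] c b \<otimes> b [^] d b)"
    unfolding int_comb_def using assms by (intro finprod_cong') (auto simp: int_pow_mult subsetD)
  also have "\<dots> = int_comb G c B \<otimes> int_comb G d B"
    unfolding int_comb_def using assms by (intro finprod_multf) auto
  finally show ?thesis .
qed

lemma int_comb_zero: "(\<And>b. b \<in> B \<Longrightarrow> c b = 0) \<Longrightarrow> int_comb G c B = \<one>"
  unfolding int_comb_def by (intro finprod_one_eqI) auto

lemma int_comb_minus:
  assumes "B \<subseteq> carrier G"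
  shows "int_comb G (\<lambda>b. - c b) B = inv (int_comb G c B)"
proof -
  have "int_comb G (\<lambda>b. - c b) B \<otimes> int_comb G c B = \<one>"
    using int_comb_add[OF assms, of "\<lambda>b. - c b" c] by (simp add: int_comb_zero)
  then show ?thesis using assms by (simp add: inv_equality)
qed

lemma int_comb_pow:
  fixes k :: int
  assumes "finite B" "B \<subseteq> carrier G"
  shows "int_comb G c B [^] k = int_comb G (\<lambda>b. k * c b) B"
  using assms
proof induction
  case (insert x B)
  then show ?case by (simp add: int_comb_insert int_pow_distrib int_pow_pow mult.commute)
qed simp

lemma int_comb_single:
  assumes "finite B" "B \<subseteq> carrier G" "x \<in> B"
  shows "int_comb G (\<lambda>b. if b = x then k else 0) B = x [^] k"
proof -
  have "int_comb G (\<lambda>b. if b = x then k else 0) (insert x (B - {x})) = x [^] k"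
    using assms int_comb_zero[of "B - {x}" "\<lambda>b. if b = x then k else 0"]
    by (subst int_comb_insert) (auto simp: subset_iff)
  moreover have "insert x (B - {x}) = B" using assms by auto
  ultimately show ?thesis by simp
qed

lemma finprod_int_comb:
  assumes "finite B" "T \<subseteq> carrier G"
  shows "(\<Otimes>b\<in>B. int_comb G (c b) T) = int_comb G (\<lambda>t. \<Sum>b\<in>B. c b t) T"
  using assms
proof induction
  case empty then show ?case by (simp add: int_comb_zero)
next
  case (insert x B)
  then show ?case by (simp add: int_comb_add)
qed

lemma int_independentD:
  "int_independent G B \<Longrightarrow> int_comb G c B = \<one> \<Longrightarrow> b \<in> B \<Longrightarrow> c b = 0"
  unfolding int_independent_def int_comb_def by blast

lemma int_independentI:
  "B \<subseteq> carrier G \<Longrightarrow> finite B \<Longrightarrow> (\<And>c b. int_comb G c B = \<one> \<Longrightarrow> b \<in> B \<Longrightarrow> c b = 0) \<Longrightarrow> int_independent G B"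
  unfolding int_independent_def int_comb_def by blast

lemma int_independent_carrier: "int_independent G B \<Longrightarrow> B \<subseteq> carrier G"
  and int_independent_finite: "int_independent G B \<Longrightarrow> finite B"
  unfolding int_independent_def by blast+

lemma int_independent_empty: "int_independent G {}"
  by (simp add: int_independent_def)

lemma one_notin_int_independent:
  assumes "int_independent G B"
  shows "\<one> \<notin> B"
proof
  assume "\<one> \<in> B"
  then have "int_comb G (\<lambda>b. if b = \<one> then 1 else 0) B = \<one>"
    using int_comb_single[of B \<one> 1] assms by (simp add: int_independent_def)
  then show False using int_independentD[OF assms, of _ \<one>] \<open>\<one> \<in> B\<close> by fastforce
qed

text \<open>The exchange bound, with spanning only up to torsion. If \<open>B\<close> were larger
  than \<open>T\<close>, the system given by the exponents on \<open>T\<close> would have a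
  nontrivial integer solution \<open>x\<close>; the powers with exponents \<open>m b * x b\<close>
  then multiply to 1, a nontrivial relation in \<open>B\<close> because each \<open>m b\<close> is
  nonzero.\<close>

lemma int_independent_card_le:
  assumes B: "int_independent G B" and T: "finite T" "T \<subseteq> carrier G"
    and span: "\<And>b. b \<in> B \<Longrightarrow> \<exists>m c. m \<noteq> (0::int) \<and> b [^] m = int_comb G c T"
  shows "card B \<le> card T"
proof (rule ccontr)
  assume "\<not> card B \<le> card T"
  then have "card T < card B" by simp
  have "\<forall>b\<in>B. \<exists>m c. m \<noteq> (0::int) \<and> b [^] m = int_comb G c T" using span by blast
  then obtain m c where mc: "\<And>b. b \<in> B \<Longrightarrow> m b \<noteq> (0::int)" "\<And>b. b \<in> B \<Longrightarrow> b [^] m b = int_comb G (c b) T"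
    by metis
  obtain x where x: "\<exists>b\<in>B. x b \<noteq> 0" "\<forall>t\<in>T. (\<Sum>b\<in>B. x b * c b t) = (0::int)"
    using integer_homogeneous_system[OF T(1) int_independent_finite[OF B] \<open>card T < card B\<close>] by blast
  have "int_comb G (\<lambda>b. m b * x b) B = (\<Otimes>b\<in>B. int_comb G (\<lambda>t. x b * c b t) T)"
    unfolding int_comb_def[of G _ B]
  proof (rule finprod_cong')
    fix b assume b: "b \<in> B"
    then have "b \<in> carrier G" using int_independent_carrier[OF B] by blast
    then show "b [^] (m b * x b) = int_comb G (\<lambda>t. x b * c b t) T"
      using mc(2)[OF b] int_comb_pow[OF T] by (metis int_pow_pow)
  qed (use T in auto)
  also have "\<dots> = int_comb G (\<lambda>t. \<Sum>b\<in>B. x b * c b t) T"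
    using int_independent_finite[OF B] T(2) by (rule finprod_int_comb)
  also have "\<dots> = \<one>" using x(2) by (intro int_comb_zero) auto
  finally have "m b * x b = 0" if "b \<in> B" for b using int_independentD[OF B] that by blast
  with x(1) mc(1) show False by auto
qed

lemma rank_on_upper: "finite_rank_on G S \<Longrightarrow> int_independent G B \<Longrightarrow> B \<subseteq> S \<Longrightarrow> card B \<le> rank_on G S"
  unfolding rank_on_def finite_rank_on_def by (intro cSup_upper) (auto simp: bdd_above_def)

lemma rank_on_attained:
  assumes "finite_rank_on G S"
  obtains B where "int_independent G B" "B \<subseteq> S" "card B = rank_on G S"
proof -
  let ?C = "card ` {B. int_independent G B \<and> B \<subseteq> S}"
  have "?C \<noteq> {}" using int_independent_empty by auto
  moreover have "finite ?C"
    using assms unfolding finite_rank_on_def by (auto simp: finite_nat_set_iff_bounded_le)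
  ultimately have "rank_on G S \<in> ?C" unfolding rank_on_def by (simp add: cSup_eq_Max)
  then show ?thesis using that by auto
qed

lemma rank_on_leI:
  assumes "\<And>B. int_independent G B \<Longrightarrow> B \<subseteq> S \<Longrightarrow> card B \<le> n"
  shows "finite_rank_on G S" "rank_on G S \<le> n"
proof -
  show "finite_rank_on G S" unfolding finite_rank_on_def using assms by blast
  then show "rank_on G S \<le> n" using rank_on_attained assms by metis
qed

text \<open>By maximality, adjoining \<open>y\<close> creates a relation, and it involves
  \<open>y\<close> since \<open>B\<close> alone has none. Torsion is the reason why only a nonzero
  power of \<open>y\<close> is reached.\<close>

lemma maximal_independent_span:
  assumes fr: "finite_rank_on G S" and B: "int_independent G B" "B \<subseteq> S" "card B = rank_on G S"
    and y: "y \<in> S" "y \<in> carrier G"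
  shows "\<exists>m c. m \<noteq> (0::int) \<and> y [^] m = int_comb G c B"
proof (cases "y \<in> B")
  case True
  note int_comb_single[OF int_independent_finite[OF B(1)] int_independent_carrier[OF B(1)] True, of 1]
  then show ?thesis by (metis zero_neq_one)
next
  case False
  note fin = int_independent_finite[OF B(1)] and car = int_independent_carrier[OF B(1)]
  have "card (insert y B) > rank_on G S" using False fin B(3) by simp
  then have "\<not> int_independent G (insert y B)" using rank_on_upper[OF fr, of "insert y B"] B y by auto
  then obtain c b where c: "int_comb G c (insert y B) = \<one>" "b \<in> insert y B" "c b \<noteq> 0"
    using int_independentI[of "insert y B"] fin car y by auto
  have eq: "y [^] c y \<otimes> int_comb G c B = \<one>"
    using c(1) int_comb_insert[OF fin False] car y by simp
  have "c y \<noteq> 0"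
  proof
    assume "c y = 0"
    then have "int_comb G c B = \<one>" using eq car by simp
    then have "c b = 0" if "b \<in> B" for b using int_independentD[OF B(1)] that by blast
    with c \<open>c y = 0\<close> show False by auto
  qed
  moreover have "y [^] c y = int_comb G (\<lambda>b. - c b) B"
    using eq car y by (simp add: int_comb_minus inv_equality[symmetric])
  ultimately show ?thesis by blast
qed

end

section \<open>Homomorphisms and rank-nullity\<close>

lemma hom_int_comb:
  assumes "comm_group G" "comm_group H" "f \<in> hom G H" "finite B" "B \<subseteq> carrier G"
  shows "f (int_comb G c B) = (\<Otimes>\<^bsub>H\<^esub>b\<in>B. f b [^]\<^bsub>H\<^esub> c b)"
proof -
  interpret G: comm_group G by fact
  interpret H: comm_group H by fact
  interpret group_hom G H f
    using assms by (simp add: group_hom_def group_hom_axioms_def G.is_group H.is_group)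
  show ?thesis using assms(4,5)
  proof induction
    case empty then show ?case by simp
  next
    case (insert x B)
    then have "(\<lambda>b. f b [^]\<^bsub>H\<^esub> c b) \<in> B \<rightarrow> carrier H" by (auto simp: subset_iff)
    with insert show ?case by (simp add: G.int_comb_insert hom_int_pow)
  qed
qed

text \<open>A section \<open>g\<close> over \<open>B\<close> is injective, so the image can be
  written as a combination over \<open>B\<close> itself. For a general homomorphism images may
  coincide, and the product has to stay indexed by the source.\<close>

lemma hom_int_comb_lift:
  assumes "comm_group G" "comm_group H" "f \<in> hom G H" "finite B" "g ` B \<subseteq> carrier G"
    and "\<And>y. y \<in> B \<Longrightarrow> f (g y) = y"
  shows "f (int_comb G c (g ` B)) = int_comb H (c \<circ> g) B"
proof -
  interpret H: comm_group H by fact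
  have inj: "inj_on g B" using assms(6) by (metis inj_onI)
  have car: "B \<subseteq> carrier H"
  proof
    fix y assume "y \<in> B"
    then have "g y \<in> carrier G" "f (g y) = y" using assms(5,6) by auto
    then show "y \<in> carrier H" using hom_in_carrier[OF assms(3)] by metis
  qed
  have "f (int_comb G c (g ` B)) = (\<Otimes>\<^bsub>H\<^esub>b\<in>g ` B. f b [^]\<^bsub>H\<^esub> c b)"
    using assms by (intro hom_int_comb) auto
  also have "\<dots> = (\<Otimes>\<^bsub>H\<^esub>y\<in>B. f (g y) [^]\<^bsub>H\<^esub> c (g y))"
    using inj car assms(6) by (intro H.finprod_reindex) (auto simp: subset_iff)
  also have "\<dots> = int_comb H (c \<circ> g) B"
    unfolding int_comb_def using car assms(6) by (intro H.finprod_cong') (auto simp: subset_iff)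
  finally show ?thesis .
qed

text \<open>Lifts of \<open>B2\<close> are joined to \<open>B1\<close>. Under \<open>f\<close> a
  relation loses its \<open>B1\<close> part and becomes a relation in \<open>B2\<close>; once those
  exponents vanish, the rest is a relation in \<open>B1\<close>.\<close>

lemma rank_nullity_lower:
  assumes "comm_group G" "comm_group H" "f \<in> hom G H"
    and B1: "int_independent G B1" "B1 \<subseteq> kernel G H f" and B2: "int_independent H B2" "B2 \<subseteq> f ` carrier G"
  obtains B where "int_independent G B" "card B = card B1 + card B2"
proof -
  interpret G: comm_group G by fact
  interpret H: comm_group H by fact
  have hom: "group_hom G H f"
    using assms by (simp add: group_hom_def group_hom_axioms_def G.is_group H.is_group)
  have "\<forall>y\<in>B2. \<exists>x. x \<in> carrier G \<and> f x = y" using B2(2) by auto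
  then obtain g where g: "\<And>y. y \<in> B2 \<Longrightarrow> g y \<in> carrier G" "\<And>y. y \<in> B2 \<Longrightarrow> f (g y) = y"
    using bchoice[of B2 "\<lambda>y x. x \<in> carrier G \<and> f x = y"] by blast
  have fin: "finite B1" "finite B2" "finite (g ` B2)"
    and car: "B1 \<subseteq> carrier G" "B2 \<subseteq> carrier H" "g ` B2 \<subseteq> carrier G"
    using B1(1) B2(1) g(1) by (auto simp: int_independent_def)
  have dis: "B1 \<inter> g ` B2 = {}"
    using H.one_notin_int_independent[OF B2(1)] B1(2) g(2) by (auto simp: kernel_def)
  have f1: "f (int_comb G c B1) = \<one>\<^bsub>H\<^esub>" for c
    unfolding hom_int_comb[OF assms(1-3) fin(1) car(1)]
    using B1(2) by (intro H.finprod_one_eqI) (auto simp: kernel_def)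
  have "int_independent G (B1 \<union> g ` B2)"
  proof (rule G.int_independentI)
    fix c b assume c: "int_comb G c (B1 \<union> g ` B2) = \<one>\<^bsub>G\<^esub>" "b \<in> B1 \<union> g ` B2"
    have eq: "int_comb G c B1 \<otimes>\<^bsub>G\<^esub> int_comb G c (g ` B2) = \<one>\<^bsub>G\<^esub>"
      using c(1) G.int_comb_Un_disjoint[OF fin(1,3) dis car(1,3)] by simp
    then have "f (int_comb G c B1) \<otimes>\<^bsub>H\<^esub> f (int_comb G c (g ` B2)) = \<one>\<^bsub>H\<^esub>"
      using car by (metis G.int_comb_closed group_hom.hom_mult[OF hom] group_hom.hom_one[OF hom])
    then have "int_comb H (c \<circ> g) B2 = \<one>\<^bsub>H\<^esub>"
      using f1 hom_int_comb_lift[OF assms(1-3) fin(2) car(3) g(2)] car(2) by simp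
    then have z: "c (g y) = 0" if "y \<in> B2" for y
      using H.int_independentD[OF B2(1)] that by fastforce
    then have "int_comb G c (g ` B2) = \<one>\<^bsub>G\<^esub>" by (intro G.int_comb_zero) auto
    then have "int_comb G c B1 = \<one>\<^bsub>G\<^esub>" using eq car(1) by simp
    then show "c b = 0" using c(2) z G.int_independentD[OF B1(1)] by blast
  qed (use fin car in auto)
  moreover have "card (B1 \<union> g ` B2) = card B1 + card B2"
    using dis fin g(2) by (subst card_Un_disjoint) (auto intro!: card_image inj_onI, metis)
  ultimately show ?thesis using that by blast
qed

text \<open>For maximal \<open>B1\<close> and \<open>B2\<close> the union of \<open>B1\<close> with
  lifts of \<open>B2\<close> spans \<open>G\<close> up to torsion and so bounds every independent
  set.\<close>

lemma rank_nullity_upper: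
  assumes "comm_group G" "comm_group H" "f \<in> hom G H"
    and fr: "finite_rank_on G (kernel G H f)" "finite_rank_on H (f ` carrier G)"
    and B: "int_independent G B"
  shows "card B \<le> rank_on G (kernel G H f) + rank_on H (f ` carrier G)"
proof -
  interpret G: comm_group G by fact
  interpret H: comm_group H by fact
  have hom: "group_hom G H f"
    using assms by (simp add: group_hom_def group_hom_axioms_def G.is_group H.is_group)
  obtain B1 where B1: "int_independent G B1" "B1 \<subseteq> kernel G H f" "card B1 = rank_on G (kernel G H f)"
    using G.rank_on_attained[OF fr(1)] .
  obtain B2 where B2: "int_independent H B2" "B2 \<subseteq> f ` carrier G" "card B2 = rank_on H (f ` carrier G)"
    using H.rank_on_attained[OF fr(2)] .
  have "\<forall>y\<in>B2. \<exists>x. x \<in> carrier G \<and> f x = y" using B2(2) by auto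
  then obtain g where g: "\<And>y. y \<in> B2 \<Longrightarrow> g y \<in> carrier G" "\<And>y. y \<in> B2 \<Longrightarrow> f (g y) = y"
    using bchoice[of B2 "\<lambda>y x. x \<in> carrier G \<and> f x = y"] by blast
  have fin: "finite B1" "finite B2" "finite (g ` B2)"
    and car: "B1 \<subseteq> carrier G" "B2 \<subseteq> carrier H" "g ` B2 \<subseteq> carrier G"
    using B1(1) B2(1) g(1) by (auto simp: int_independent_def)
  have dis: "B1 \<inter> g ` B2 = {}"
    using H.one_notin_int_independent[OF B2(1)] B1(2) g(2) by (auto simp: kernel_def)
  let ?T = "B1 \<union> g ` B2"
  have "card B \<le> card ?T"
  proof (rule G.int_independent_card_le[OF B])
    fix b assume "b \<in> B"
    then have b: "b \<in> carrier G" using G.int_independent_carrier[OF B] by blast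
    have "f b \<in> f ` carrier G" "f b \<in> carrier H" using b group_hom.hom_closed[OF hom b] by auto
    from H.maximal_independent_span[OF fr(2) B2 this]
    obtain m c where mc: "m \<noteq> (0::int)" "f b [^]\<^bsub>H\<^esub> m = int_comb H c B2" by auto
    \<comment> \<open>A power of \<open>b\<close> has the same image as the combination
      \<open>?u\<close> of lifts, so the quotient \<open>?v\<close> lies in the kernel and one of
      its powers is a combination of \<open>B1\<close>. The product of the two exponents serves for
      \<open>b\<close>.\<close>
    let ?u = "int_comb G (c \<circ> f) (g ` B2)"
    have u: "?u \<in> carrier G" using car by simp
    have "f ?u = int_comb H ((c \<circ> f) \<circ> g) B2"
      by (rule hom_int_comb_lift[OF assms(1-3) fin(2) car(3) g(2)])
    also have "\<dots> = int_comb H c B2" using g(2) car by (intro H.int_comb_cong) auto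
    finally have fu: "f ?u = f b [^]\<^bsub>H\<^esub> m" using mc by simp
    let ?v = "b [^]\<^bsub>G\<^esub> m \<otimes>\<^bsub>G\<^esub> inv\<^bsub>G\<^esub> ?u"
    have v: "?v \<in> carrier G" using b u by simp
    have "f ?v = \<one>\<^bsub>H\<^esub>"
      using b u fu group_hom.hom_int_pow[OF hom b, of m]
      by (simp add: group_hom.hom_mult[OF hom] group_hom.hom_inv[OF hom] group_hom.hom_closed[OF hom])
    then have "?v \<in> kernel G H f" using v by (simp add: kernel_def)
    from G.maximal_independent_span[OF fr(1) B1 this v]
    obtain m' c' where mc': "m' \<noteq> (0::int)" "?v [^]\<^bsub>G\<^esub> m' = int_comb G c' B1" by auto
    have "b [^]\<^bsub>G\<^esub> m = ?v \<otimes>\<^bsub>G\<^esub> ?u" using b u by (simp add: G.m_assoc)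
    then have "b [^]\<^bsub>G\<^esub> (m * m') = (?v \<otimes>\<^bsub>G\<^esub> ?u) [^]\<^bsub>G\<^esub> m'" using b by (metis G.int_pow_pow)
    also have "\<dots> = int_comb G c' B1 \<otimes>\<^bsub>G\<^esub> int_comb G (\<lambda>t. m' * (c \<circ> f) t) (g ` B2)"
      using v u mc'(2) G.int_comb_pow[OF fin(3) car(3)] by (simp add: G.int_pow_distrib)
    also have "\<dots> = int_comb G (\<lambda>t. if t \<in> B1 then c' t else m' * (c \<circ> f) t) B1 \<otimes>\<^bsub>G\<^esub>
        int_comb G (\<lambda>t. if t \<in> B1 then c' t else m' * (c \<circ> f) t) (g ` B2)"
      using dis car by (intro arg_cong2[where f = "(\<otimes>\<^bsub>G\<^esub>)"] G.int_comb_cong) auto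
    also have "\<dots> = int_comb G (\<lambda>t. if t \<in> B1 then c' t else m' * (c \<circ> f) t) ?T"
      by (rule G.int_comb_Un_disjoint[OF fin(1,3) dis car(1,3), symmetric])
    finally show "\<exists>m c. m \<noteq> (0::int) \<and> b [^]\<^bsub>G\<^esub> m = int_comb G c ?T"
      using mc(1) mc'(1) by (metis mult_eq_0_iff)
  qed (use fin car in auto)
  also have "\<dots> \<le> card B1 + card (g ` B2)" by (rule card_Un_le)
  also have "\<dots> \<le> card B1 + card B2" using card_image_le[OF fin(2)] by simp
  finally show ?thesis using B1 B2 by simp
qed

theorem rank_nullity:
  assumes "comm_group G" "comm_group H" "f \<in> hom G H"
  shows "finite_rank_on G (carrier G) \<longleftrightarrow> finite_rank_on G (kernel G H f) \<and> finite_rank_on H (f ` carrier G)"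
    and "finite_rank_on G (carrier G) \<Longrightarrow>
      rank_on G (carrier G) = rank_on G (kernel G H f) + rank_on H (f ` carrier G)"
proof -
  interpret G: comm_group G by fact
  interpret H: comm_group H by fact
  have le: "card B1 + card B2 \<le> rank_on G (carrier G)"
    if "finite_rank_on G (carrier G)" "int_independent G B1" "B1 \<subseteq> kernel G H f"
      "int_independent H B2" "B2 \<subseteq> f ` carrier G" for B1 B2
    using rank_nullity_lower[OF assms that(2-5)] G.rank_on_upper[OF that(1)] G.int_independent_carrier by metis
  have fwd: "finite_rank_on G (kernel G H f)" "finite_rank_on H (f ` carrier G)"
    if "finite_rank_on G (carrier G)"
    using le[OF that _ _ H.int_independent_empty] le[OF that G.int_independent_empty]
    by (auto intro!: G.rank_on_leI[of _ "rank_on G (carrier G)"] H.rank_on_leI[of _ "rank_on G (carrier G)"])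
  show "finite_rank_on G (carrier G) \<longleftrightarrow> finite_rank_on G (kernel G H f) \<and> finite_rank_on H (f ` carrier G)"
    using fwd rank_nullity_upper[OF assms] G.rank_on_leI(1) by blast
  assume fr: "finite_rank_on G (carrier G)"
  obtain B1 where B1: "int_independent G B1" "B1 \<subseteq> kernel G H f" "card B1 = rank_on G (kernel G H f)"
    using G.rank_on_attained[OF fwd(1)[OF fr]] .
  obtain B2 where B2: "int_independent H B2" "B2 \<subseteq> f ` carrier G" "card B2 = rank_on H (f ` carrier G)"
    using H.rank_on_attained[OF fwd(2)[OF fr]] .
  show "rank_on G (carrier G) = rank_on G (kernel G H f) + rank_on H (f ` carrier G)"
  proof (rule antisym)
    show "rank_on G (carrier G) \<le> rank_on G (kernel G H f) + rank_on H (f ` carrier G)"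
      using rank_nullity_upper[OF assms fwd[OF fr]] by (intro G.rank_on_leI(2)) auto
    show "rank_on G (kernel G H f) + rank_on H (f ` carrier G) \<le> rank_on G (carrier G)"
      using le[OF fr B1(1,2) B2(1,2)] B1(3) B2(3) by simp
  qed
qed

lemma rank_on_trivial:
  assumes "comm_group G" "S \<subseteq> {\<one>\<^bsub>G\<^esub>}"
  shows "finite_rank_on G S" "rank_on G S = 0"
proof -
  interpret comm_group G by fact
  have "card B \<le> 0" if "int_independent G B" "B \<subseteq> S" for B
  proof -
    have "B = {}" using that assms(2) one_notin_int_independent[OF that(1)] by auto
    then show ?thesis by simp
  qed
  then show "finite_rank_on G S" "rank_on G S = 0" using rank_on_leI[of S 0] by auto
qed

lemma rank_on_iso:
  assumes "comm_group G" "comm_group H" "G \<cong> H"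
  shows "finite_rank_on G (carrier G) \<longleftrightarrow> finite_rank_on H (carrier H)"
    and "finite_rank_on G (carrier G) \<Longrightarrow> abelian_rank G = abelian_rank H"
proof -
  interpret G: comm_group G by fact
  interpret H: comm_group H by fact
  obtain f where f: "f \<in> hom G H" "bij_betw f (carrier G) (carrier H)"
    using assms(3) by (auto simp: is_iso_def iso_def)
  have hom: "group_hom G H f"
    using assms f by (simp add: group_hom_def group_hom_axioms_def G.is_group H.is_group)
  have k: "kernel G H f \<subseteq> {\<one>\<^bsub>G\<^esub>}"
  proof
    fix x assume "x \<in> kernel G H f"
    then have "x \<in> carrier G" "f x = f \<one>\<^bsub>G\<^esub>" by (auto simp: kernel_def group_hom.hom_one[OF hom])
    then show "x \<in> {\<one>\<^bsub>G\<^esub>}" using inj_onD[OF bij_betw_imp_inj_on[OF f(2)]] G.one_closed by blast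
  qed
  have im: "f ` carrier G = carrier H" using f(2) by (simp add: bij_betw_def)
  show "finite_rank_on G (carrier G) \<longleftrightarrow> finite_rank_on H (carrier H)"
    using rank_nullity(1)[OF assms(1,2) f(1)] rank_on_trivial[OF assms(1) k] im by simp
  show "abelian_rank G = abelian_rank H" if "finite_rank_on G (carrier G)"
    using rank_nullity(2)[OF assms(1,2) f(1) that] rank_on_trivial[OF assms(1) k] im
    by (simp add: abelian_rank_eq_rank_on)
qed

lemma rank_integer_group:
  "finite_rank_on integer_group (carrier integer_group)" "abelian_rank integer_group = 1"
proof -
  interpret comm_group integer_group by (rule abelian_integer_group)
  have le: "card B \<le> 1" if "int_independent integer_group B" for B
  proof -
    have "card B \<le> card {1::int}"
    proof (rule int_independent_card_le[OF that])
      show "\<exists>m c. m \<noteq> (0::int) \<and> b [^]\<^bsub>integer_group\<^esub> m = int_comb integer_group c {1}" for b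
        by (intro exI[of _ 1] exI[of _ "\<lambda>_. b"]) (simp add: int_comb_def)
    qed auto
    then show ?thesis by simp
  qed
  then show fr: "finite_rank_on integer_group (carrier integer_group)" by (intro rank_on_leI)
  have "int_independent integer_group {1}"
    by (rule int_independentI) (auto simp: int_comb_def)
  then show "abelian_rank integer_group = 1"
    unfolding abelian_rank_eq_rank_on using rank_on_upper[OF fr, of "{1}"] rank_on_leI(2)[OF le]
    by (intro antisym) auto
qed


section \<open>Additivity of the Euler characteristic\<close>

text \<open>Here \<open>a\<close>, \<open>x\<close>, \<open>r\<close> are the ranks of the terms of
  an exact sequence and \<open>\<alpha>\<close>, \<open>\<beta>\<close>, \<open>\<delta>\<close>
  those of the images of its three maps. The sums are truncated, so the image of the connecting map
  out of degree \<open>N + 1\<close> survives as a correction term.\<close>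

lemma euler_sequence_additive:
  fixes a x r \<alpha> \<beta> \<delta> :: "nat \<Rightarrow> nat"
  assumes "\<And>p. a p = \<delta> p + \<alpha> p" "\<And>p. x p = \<alpha> p + \<beta> p"
    and "r 0 = \<beta> 0" "\<And>p. r (Suc p) = \<beta> (Suc p) + \<delta> p"
  shows "(\<Sum>p<Suc N. (-1) ^ p * int (x p)) + (-1) ^ N * int (\<delta> N) =
    (\<Sum>p<Suc N. (-1) ^ p * int (a p)) + (\<Sum>p<Suc N. (-1) ^ p * int (r p))"
proof (induction N)
  case 0
  then show ?case by (simp add: assms(1)[of 0] assms(2)[of 0] assms(3))
next
  case (Suc N)
  have "(\<Sum>p<Suc (Suc N). (-1) ^ p * int (f p)) = (\<Sum>p<Suc N. (-1) ^ p * int (f p)) - (-1) ^ N * int (f (Suc N))" for f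
    by simp
  with Suc show ?case
    by (simp only: assms(1)[of "Suc N"] assms(2)[of "Suc N"] assms(4)[of N]) (simp add: distrib_left)
qed

section \<open>Long exact sequences of groups of finite rank\<close>

definition finite_graded :: "(nat \<Rightarrow> ('a, 'b) monoid_scheme) \<Rightarrow> bool" where
  "finite_graded G \<longleftrightarrow> (\<forall>p. finite_rank_on (G p) (carrier (G p))) \<and> (\<exists>N. \<forall>p\<ge>N. abelian_rank (G p) = 0)"

definition graded_euler :: "(nat \<Rightarrow> ('a, 'b) monoid_scheme) \<Rightarrow> int" where
  "graded_euler G = (\<Sum>p | abelian_rank (G p) \<noteq> 0. (-1) ^ p * int (abelian_rank (G p)))"

lemma graded_euler_eq:
  assumes "\<And>p. p \<ge> N \<Longrightarrow> abelian_rank (G p) = 0"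
  shows "graded_euler G = (\<Sum>p<N. (-1) ^ p * int (abelian_rank (G p)))"
  unfolding graded_euler_def
proof (rule sum.mono_neutral_left)
  show "{p. abelian_rank (G p) \<noteq> 0} \<subseteq> {..<N}"
  proof
    fix p assume "p \<in> {p. abelian_rank (G p) \<noteq> 0}"
    then have "\<not> N \<le> p" using assms[of p] by auto
    then show "p \<in> {..<N}" by simp
  qed
qed auto

text \<open>Only degrees \<open>p \<ge> 0\<close> occur. The connecting map \<open>d p\<close>
  starts in degree \<open>Suc p\<close>, so none leaves \<open>R 0\<close>, and \<open>onto\<close>
  expresses exactness at that end.\<close>

locale long_exact_sequence =
  fixes A :: "nat \<Rightarrow> ('a, 'x) monoid_scheme" and X :: "nat \<Rightarrow> ('b, 'y) monoid_scheme"
    and R :: "nat \<Rightarrow> ('c, 'z) monoid_scheme"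
    and i :: "nat \<Rightarrow> 'a \<Rightarrow> 'b" and j :: "nat \<Rightarrow> 'b \<Rightarrow> 'c" and d :: "nat \<Rightarrow> 'c \<Rightarrow> 'a"
  assumes comm: "\<And>p. comm_group (A p)" "\<And>p. comm_group (X p)" "\<And>p. comm_group (R p)"
    and hom: "\<And>p. i p \<in> hom (A p) (X p)" "\<And>p. j p \<in> hom (X p) (R p)" "\<And>p. d p \<in> hom (R (Suc p)) (A p)"
    and exact: "\<And>p. kernel (A p) (X p) (i p) = d p ` carrier (R (Suc p))"
      "\<And>p. kernel (X p) (R p) (j p) = i p ` carrier (A p)"
      "\<And>p. kernel (R (Suc p)) (A p) (d p) = j (Suc p) ` carrier (X (Suc p))"
    and onto: "j 0 ` carrier (X 0) = carrier (R 0)"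
begin

lemma finite_ranks:
  "finite_rank_on (A p) (carrier (A p)) \<longleftrightarrow>
    finite_rank_on (A p) (d p ` carrier (R (Suc p))) \<and> finite_rank_on (X p) (i p ` carrier (A p))"
  "finite_rank_on (X p) (carrier (X p)) \<longleftrightarrow>
    finite_rank_on (X p) (i p ` carrier (A p)) \<and> finite_rank_on (R p) (j p ` carrier (X p))"
  "finite_rank_on (R (Suc p)) (carrier (R (Suc p))) \<longleftrightarrow>
    finite_rank_on (R (Suc p)) (j (Suc p) ` carrier (X (Suc p))) \<and> finite_rank_on (A p) (d p ` carrier (R (Suc p)))"
  using rank_nullity(1)[OF comm(1) comm(2) hom(1)] rank_nullity(1)[OF comm(2) comm(3) hom(2)]
    rank_nullity(1)[OF comm(3) comm(1) hom(3)] exact by metis+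

lemma finite_ranks_R:
  assumes "\<And>p. finite_rank_on (R (Suc p)) (carrier (R (Suc p)))" "finite_rank_on (R 0) (j 0 ` carrier (X 0))"
  shows "finite_rank_on (R p) (carrier (R p))"
  using assms onto by (cases p) auto

lemma ranks:
  "finite_rank_on (A p) (carrier (A p)) \<Longrightarrow> abelian_rank (A p) =
    rank_on (A p) (d p ` carrier (R (Suc p))) + rank_on (X p) (i p ` carrier (A p))"
  "finite_rank_on (X p) (carrier (X p)) \<Longrightarrow> abelian_rank (X p) =
    rank_on (X p) (i p ` carrier (A p)) + rank_on (R p) (j p ` carrier (X p))"
  "finite_rank_on (R (Suc p)) (carrier (R (Suc p))) \<Longrightarrow> abelian_rank (R (Suc p)) =
    rank_on (R (Suc p)) (j (Suc p) ` carrier (X (Suc p))) + rank_on (A p) (d p ` carrier (R (Suc p)))"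
  "abelian_rank (R 0) = rank_on (R 0) (j 0 ` carrier (X 0))"
  using rank_nullity(2)[OF comm(1) comm(2) hom(1)] rank_nullity(2)[OF comm(2) comm(3) hom(2)]
    rank_nullity(2)[OF comm(3) comm(1) hom(3)] exact onto
  by (simp_all add: abelian_rank_eq_rank_on)

text \<open>Each of the three images is a quotient of one family and a subgroup of another, so of
  any two finite families at least one controls it. The terms in turn are controlled by the
  images.\<close>

lemma finite_rank_two_of_three:
  assumes "(\<forall>p. finite_rank_on (A p) (carrier (A p))) \<and> (\<forall>p. finite_rank_on (X p) (carrier (X p))) \<or>
    (\<forall>p. finite_rank_on (A p) (carrier (A p))) \<and> (\<forall>p. finite_rank_on (R p) (carrier (R p))) \<or>
    (\<forall>p. finite_rank_on (X p) (carrier (X p))) \<and> (\<forall>p. finite_rank_on (R p) (carrier (R p)))"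
  shows "finite_rank_on (A p) (carrier (A p))" "finite_rank_on (X p) (carrier (X p))"
    "finite_rank_on (R p) (carrier (R p))"
proof -
  have "finite_rank_on (X p) (i p ` carrier (A p))" "finite_rank_on (A p) (d p ` carrier (R (Suc p)))" for p
    using assms finite_ranks by metis+
  moreover have j: "finite_rank_on (R p) (j p ` carrier (X p))" for p
    using assms finite_ranks(2)[of p] finite_ranks(3)[of "p - 1"] onto by (cases p) auto
  ultimately show "finite_rank_on (A p) (carrier (A p))" "finite_rank_on (X p) (carrier (X p))"
    "finite_rank_on (R p) (carrier (R p))"
    using finite_ranks(1,2)[of p] finite_ranks_R[OF _ j] finite_ranks(3) by simp_all
qed

theorem two_of_three:
  assumes "finite_graded A \<and> finite_graded X \<or> finite_graded A \<and> finite_graded R \<or> finite_graded X \<and> finite_graded R"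
  shows "finite_graded A" "finite_graded X" "finite_graded R"
    and "graded_euler X = graded_euler A + graded_euler R"
proof -
  have fin: "finite_rank_on (A p) (carrier (A p))" "finite_rank_on (X p) (carrier (X p))"
    "finite_rank_on (R p) (carrier (R p))" for p
    by (rule finite_rank_two_of_three; use assms in \<open>auto simp: finite_graded_def\<close>)+
  define \<alpha> where "\<alpha> p = rank_on (X p) (i p ` carrier (A p))" for p
  define \<beta> where "\<beta> p = rank_on (R p) (j p ` carrier (X p))" for p
  define \<delta> where "\<delta> p = rank_on (A p) (d p ` carrier (R (Suc p)))" for p
  have eq: "abelian_rank (A p) = \<delta> p + \<alpha> p" "abelian_rank (X p) = \<alpha> p + \<beta> p" "abelian_rank (R 0) = \<beta> 0"
    "abelian_rank (R (Suc p)) = \<beta> (Suc p) + \<delta> p" for p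
    unfolding \<alpha>_def \<beta>_def \<delta>_def using ranks fin by simp_all
  have eq': "abelian_rank (R p) = \<beta> p + (if p = 0 then 0 else \<delta> (p - 1))" for p
    using eq(3,4) by (cases p) auto
  obtain N1 N2 where N: "(\<forall>p\<ge>N1. abelian_rank (A p) = 0) \<and> (\<forall>p\<ge>N2. abelian_rank (X p) = 0) \<or>
    (\<forall>p\<ge>N1. abelian_rank (A p) = 0) \<and> (\<forall>p\<ge>N2. abelian_rank (R p) = 0) \<or>
    (\<forall>p\<ge>N1. abelian_rank (X p) = 0) \<and> (\<forall>p\<ge>N2. abelian_rank (R p) = 0)"
    using assms unfolding finite_graded_def by metis
  define N where "N = N1 + N2 + 1"
  have N': "(\<forall>p\<ge>N. abelian_rank (A p) = 0 \<and> abelian_rank (X p) = 0) \<or>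
    (\<forall>p\<ge>N. abelian_rank (A p) = 0 \<and> abelian_rank (R p) = 0) \<or>
    (\<forall>p\<ge>N. abelian_rank (X p) = 0 \<and> abelian_rank (R p) = 0)"
    using N by (auto simp: N_def)
  have z: "\<alpha> p = 0 \<and> \<beta> (Suc p) = 0 \<and> \<delta> p = 0" if "p \<ge> N" for p
    using N' eq(1,2,4)[of p] eq(1,2,4)[of "Suc p"] le_Suc_eq that by force
  \<comment> \<open>The range starts at \<open>Suc N\<close> because the rank of \<open>R p\<close>
    contains \<open>\<delta> (p - 1)\<close>, which is known to vanish only for
    \<open>p - 1 \<ge> N\<close>.\<close>
  have z': "abelian_rank (A p) = 0" "abelian_rank (X p) = 0" "abelian_rank (R p) = 0" if "p \<ge> Suc N" for p
  proof -
    define q where "q = p - 1"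
    then have "p = Suc q" "q \<ge> N" using that by auto
    then show "abelian_rank (A p) = 0" "abelian_rank (X p) = 0" "abelian_rank (R p) = 0"
      using z[of q] z[of p] eq(1,2)[of p] eq(2)[of q] eq(4)[of q] by auto
  qed
  show "finite_graded A" "finite_graded X" "finite_graded R"
    unfolding finite_graded_def using fin z' by blast+
  have "graded_euler X + (-1) ^ N * int (\<delta> N) = graded_euler A + graded_euler R"
  proof -
    have "graded_euler A = (\<Sum>p<Suc N. (-1) ^ p * int (abelian_rank (A p)))"
      by (rule graded_euler_eq) (rule z'(1))
    moreover have "graded_euler X = (\<Sum>p<Suc N. (-1) ^ p * int (abelian_rank (X p)))"
      by (rule graded_euler_eq) (rule z'(2))
    moreover have "graded_euler R = (\<Sum>p<Suc N. (-1) ^ p * int (abelian_rank (R p)))"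
      by (rule graded_euler_eq) (rule z'(3))
    ultimately show ?thesis
      using euler_sequence_additive[of "\<lambda>p. abelian_rank (A p)" \<delta> \<alpha> "\<lambda>p. abelian_rank (X p)" \<beta>
          "\<lambda>p. abelian_rank (R p)" N, OF eq] by simp
  qed
  then show "graded_euler X = graded_euler A + graded_euler R" using z[of N] by simp
qed

end

section \<open>Euler characteristics of spaces and open covers\<close>

definition finite_homology :: "'a topology \<Rightarrow> bool" where
  "finite_homology X \<longleftrightarrow> finite_graded (\<lambda>p. homology_group (int p) X)"

lemma euler_characteristic_graded: "euler_characteristic X = graded_euler (\<lambda>p. homology_group (int p) X)"
  by (simp add: euler_characteristic_def graded_euler_def betti_def)

lemma finite_graded_iso:
  assumes "\<And>p. comm_group (G p)" "\<And>p. comm_group (H p)" "\<And>p. G p \<cong> H p" "finite_graded G"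
  shows "finite_graded H" "graded_euler G = graded_euler H"
proof -
  have "abelian_rank (G p) = abelian_rank (H p)" "finite_rank_on (H p) (carrier (H p))" for p
    using rank_on_iso[OF assms(1-3)] assms(4) by (auto simp: finite_graded_def)
  then show "finite_graded H" "graded_euler G = graded_euler H"
    using assms(4) by (auto simp: finite_graded_def graded_euler_def)
qed

lemma homotopy_equivalent_euler:
  assumes "X homotopy_equivalent_space Y" "finite_homology X"
  shows "finite_homology Y" "euler_characteristic X = euler_characteristic Y"
  using finite_graded_iso[of "\<lambda>p. homology_group (int p) X" "\<lambda>p. homology_group (int p) Y"] assms
    homotopy_equivalent_space_imp_isomorphic_homology_groups[OF assms(1)]
  by (auto simp: finite_homology_def euler_characteristic_graded)

lemma long_exact_sequence_homology:
  "long_exact_sequence (\<lambda>p. homology_group (int p) (subtopology X S)) (\<lambda>p. homology_group (int p) X)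
    (\<lambda>p. relative_homology_group (int p) X S)
    (\<lambda>p. hom_induced (int p) (subtopology X S) {} X {} id) (\<lambda>p. hom_induced (int p) X {} X S id)
    (\<lambda>p. hom_boundary (int (Suc p)) X S)"
proof (rule long_exact_sequence.intro)
  fix p
  note e1 = homology_exactness_axiom_1[of _ X S] and e2 = homology_exactness_axiom_2[of _ X S]
    and e3 = homology_exactness_axiom_3[of _ X S]
  show "hom_induced (int p) (subtopology X S) {} X {} id \<in> hom (homology_group (int p) (subtopology X S)) (homology_group (int p) X)"
    "hom_induced (int p) X {} X S id \<in> hom (homology_group (int p) X) (relative_homology_group (int p) X S)"
    by (simp_all add: hom_induced_hom)
  show "hom_boundary (int (Suc p)) X S \<in> hom (relative_homology_group (int (Suc p)) X S) (homology_group (int p) (subtopology X S))"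
    using e2[of "int (Suc p)"] by (simp add: group_hom_def group_hom_axioms_def)
  show "kernel (homology_group (int p) (subtopology X S)) (homology_group (int p) X)
      (hom_induced (int p) (subtopology X S) {} X {} id) =
      hom_boundary (int (Suc p)) X S ` carrier (relative_homology_group (int (Suc p)) X S)"
    using e2[of "int (Suc p)"] by simp
  show "kernel (homology_group (int p) X) (relative_homology_group (int p) X S) (hom_induced (int p) X {} X S id) =
      hom_induced (int p) (subtopology X S) {} X {} id ` carrier (homology_group (int p) (subtopology X S))"
    using e3[of "int p"] by simp
  show "kernel (relative_homology_group (int (Suc p)) X S) (homology_group (int p) (subtopology X S))
      (hom_boundary (int (Suc p)) X S) =
      hom_induced (int (Suc p)) X {} X S id ` carrier (homology_group (int (Suc p)) X)"
    using e1[of "int (Suc p)"] by simp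
next
  \<comment> \<open>Homology vanishes in degree -1, so the whole relative group in degree 0 lies in
    the kernel of the boundary map and comes from the space.\<close>
  have "trivial_group (homology_group (-1) (subtopology X S))" by simp
  then have "kernel (relative_homology_group 0 X S) (homology_group (-1) (subtopology X S)) (hom_boundary 0 X S) =
      carrier (relative_homology_group 0 X S)"
    using homology_exactness_axiom_1[of 0 X S]
    by (intro group_hom.kernel_to_trivial_group) (auto simp: group_hom_def group_hom_axioms_def)
  then show "hom_induced (int 0) X {} X S id ` carrier (homology_group (int 0) X) =
      carrier (relative_homology_group (int 0) X S)"
    using homology_exactness_axiom_1[of 0 X S] by simp
qed (simp_all add: hom_induced_hom)

text \<open>Excision identifies the relative homology of \<open>U\<close> modulo
  \<open>U \<inter> V\<close> with that of \<open>X\<close> modulo \<open>V\<close>; comparing the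
  two exact sequences gives the formula. The disjunction serves both directions: gluing deduces
  finiteness for \<open>X\<close> from \<open>V\<close>, removing a hyperplane deduces it for
  \<open>V\<close> from \<open>X\<close>.\<close>

lemma euler_open_cover:
  assumes U: "openin X U" and V: "openin X V" and cover: "U \<union> V = topspace X"
    and fin: "finite_homology (subtopology X U)" "finite_homology (subtopology X (U \<inter> V))"
    and "finite_homology (subtopology X V) \<or> finite_homology X"
  shows "finite_homology (subtopology X V)" "finite_homology X"
    and "euler_characteristic X + euler_characteristic (subtopology X (U \<inter> V)) =
      euler_characteristic (subtopology X U) + euler_characteristic (subtopology X V)"
proof -
  let ?R1 = "\<lambda>p. relative_homology_group (int p) (subtopology X U) (V \<inter> U)"
  let ?R2 = "\<lambda>p. relative_homology_group (int p) X V"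
  have sub: "U \<subseteq> topspace X" "V \<subseteq> topspace X" using cover by auto
  have iso: "?R1 p \<cong> ?R2 p" for p
  proof -
    \<comment> \<open>The excised set is the closed complement of \<open>U\<close>, which the cover
      places inside the open set \<open>V\<close>.\<close>
    have "X closure_of (topspace X - U) \<subseteq> X interior_of V"
    proof -
      have "closedin X (topspace X - U)" using U by blast
      then have "X closure_of (topspace X - U) = topspace X - U" by (simp add: closure_of_closedin)
      then show ?thesis using V cover by (auto simp: interior_of_openin)
    qed
    from homology_excision_axiom[OF this sub(2), of "int p"]
    have "relative_homology_group (int p) (subtopology X (topspace X - (topspace X - U))) (V - (topspace X - U))
      \<cong> relative_homology_group (int p) (subtopology X (topspace X)) V"
      by (auto simp: is_iso_def)
    moreover have "topspace X - (topspace X - U) = U" "V - (topspace X - U) = V \<inter> U" using sub by auto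
    ultimately show ?thesis by simp
  qed
  interpret L1: long_exact_sequence
    "\<lambda>p. homology_group (int p) (subtopology (subtopology X U) (V \<inter> U))"
    "\<lambda>p. homology_group (int p) (subtopology X U)" "?R1"
    "\<lambda>p. hom_induced (int p) (subtopology (subtopology X U) (V \<inter> U)) {} (subtopology X U) {} id"
    "\<lambda>p. hom_induced (int p) (subtopology X U) {} (subtopology X U) (V \<inter> U) id"
    "\<lambda>p. hom_boundary (int (Suc p)) (subtopology X U) (V \<inter> U)"
    by (rule long_exact_sequence_homology)
  interpret L2: long_exact_sequence
    "\<lambda>p. homology_group (int p) (subtopology X V)"
    "\<lambda>p. homology_group (int p) X" "?R2"
    "\<lambda>p. hom_induced (int p) (subtopology X V) {} X {} id" "\<lambda>p. hom_induced (int p) X {} X V id"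
    "\<lambda>p. hom_boundary (int (Suc p)) X V"
    by (rule long_exact_sequence_homology)
  have eq: "subtopology (subtopology X U) (V \<inter> U) = subtopology X (U \<inter> V)"
    by (simp add: subtopology_subtopology Int_ac)
  have R1: "finite_graded ?R1" and e1: "euler_characteristic (subtopology X U) =
      euler_characteristic (subtopology X (U \<inter> V)) + graded_euler ?R1"
    using L1.two_of_three(3,4) fin unfolding eq by (auto simp: finite_homology_def euler_characteristic_graded)
  have R2: "finite_graded ?R2" "graded_euler ?R1 = graded_euler ?R2"
    using finite_graded_iso[of ?R1 ?R2] iso R1 by auto
  then show "finite_homology (subtopology X V)" "finite_homology X"
    using L2.two_of_three(1,2) assms(6) by (auto simp: finite_homology_def)
  then have "euler_characteristic X = euler_characteristic (subtopology X V) + graded_euler ?R2"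
    using L2.two_of_three(4) by (auto simp: finite_homology_def euler_characteristic_graded)
  then show "euler_characteristic X + euler_characteristic (subtopology X (U \<inter> V)) =
      euler_characteristic (subtopology X U) + euler_characteristic (subtopology X V)"
    using e1 R2 by simp
qed

lemma rank_trivial_group:
  assumes "comm_group G" "trivial_group G"
  shows "finite_rank_on G (carrier G)" "abelian_rank G = 0"
  using rank_on_trivial[OF assms(1), of "carrier G"] assms(2)
  by (auto simp: trivial_group_def abelian_rank_eq_rank_on)

lemma euler_empty:
  assumes "topspace X = {}"
  shows "finite_homology X" "euler_characteristic X = 0"
proof -
  have "finite_rank_on (homology_group (int p) X) (carrier (homology_group (int p) X))"
    "abelian_rank (homology_group (int p) X) = 0" for p
    using rank_trivial_group[OF abelian_homology_group trivial_homology_group_empty[OF assms, of "int p"]] by auto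
  then show "finite_homology X" "euler_characteristic X = 0"
    by (auto simp: finite_homology_def finite_graded_def euler_characteristic_graded graded_euler_def)
qed

lemma euler_singleton:
  assumes "topspace X = {a}"
  shows "finite_homology X" "euler_characteristic X = 1"
proof -
  have pos: "finite_rank_on (homology_group (int p) X) (carrier (homology_group (int p) X))"
    "abelian_rank (homology_group (int p) X) = 0" if "p \<noteq> 0" for p
    using rank_trivial_group[OF abelian_homology_group homology_dimension_axiom[OF assms, of "int p"]] that by auto
  have zero: "finite_rank_on (homology_group 0 X) (carrier (homology_group 0 X))" "abelian_rank (homology_group 0 X) = 1"
    using rank_on_iso[OF abelian_homology_group abelian_integer_group homology_coefficients[OF assms]]
      rank_integer_group by auto
  have fin: "finite_rank_on (homology_group (int p) X) (carrier (homology_group (int p) X))" for p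
    using pos[of p] zero by (cases "p = 0") auto
  show "finite_homology X"
    unfolding finite_homology_def finite_graded_def using fin pos(2) by (intro conjI exI[of _ 1]) auto
  have "graded_euler (\<lambda>p. homology_group (int p) X) = (\<Sum>p<1. (-1) ^ p * int (abelian_rank (homology_group (int p) X)))"
    using pos(2) by (intro graded_euler_eq) auto
  then show "euler_characteristic X = 1" using zero by (simp add: euler_characteristic_graded)
qed

lemma euler_contractible:
  assumes "contractible_space X" "topspace X \<noteq> {}"
  shows "finite_homology X" "euler_characteristic X = 1"
proof -
  from assms obtain a where a: "a \<in> topspace X" "X homotopy_equivalent_space (subtopology X {a})"
    unfolding contractible_eq_homotopy_equivalent_singleton_subtopology by auto
  then have "topspace (subtopology X {a}) = {a}" by auto
  from euler_singleton[OF this] homotopy_equivalent_euler[of "subtopology X {a}" X]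
    a(2)[unfolded homotopy_equivalent_space_sym[of X]]
  show "finite_homology X" "euler_characteristic X = 1" by auto
qed

section \<open>Products with contractible sets and with the punctured disc\<close>

lemma prod_contractible_homotopy_equivalent:
  assumes "contractible_space T" "topspace T \<noteq> {}"
  shows "Y homotopy_equivalent_space prod_topology Y T"
proof -
  obtain a where a: "a \<in> topspace T" using assms by blast
  have h: "homotopic_with (\<lambda>x. True) T T (\<lambda>x. a) id"
    by (rule homotopic_with_symD) (rule contractible_space_alt[THEN iffD1, OF assms(1), rule_format, OF a])
  have "homotopic_with (\<lambda>x. True) (prod_topology Y T) (prod_topology Y T)
      (\<lambda>z. (id (fst z), (\<lambda>x. a) (snd z))) (\<lambda>z. (id (fst z), id (snd z)))"
    by (rule homotopic_with_prod_topology[OF _ h]) auto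
  then have "homotopic_with (\<lambda>x. True) (prod_topology Y T) (prod_topology Y T) ((\<lambda>y. (y, a)) \<circ> fst) id"
    by (simp add: o_def id_def)
  then have "prod_topology Y T homotopy_equivalent_space Y"
    by (rule deformation_retraction_imp_homotopy_equivalent_space)
       (use a in \<open>simp add: retraction_maps_def continuous_map_fst continuous_map_paired o_def\<close>)
  then show ?thesis unfolding homotopy_equivalent_space_sym[of Y] .
qed

lemma euler_prod_contractible:
  assumes "finite_homology Y" "contractible T" "T \<noteq> {}"
  shows "finite_homology (prod_topology Y (top_of_set T))"
    "euler_characteristic (prod_topology Y (top_of_set T)) = euler_characteristic Y"
  using homotopy_equivalent_euler[OF prod_contractible_homotopy_equivalent[of "top_of_set T" Y]] assms by auto

lemma subtopology_prod_top_of_set: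
  assumes "S \<subseteq> T"
  shows "subtopology (prod_topology Y (top_of_set T)) (topspace Y \<times> S) = prod_topology Y (top_of_set S)"
  using assms by (simp add: subtopology_Times subtopology_subtopology Int_absorb1)

lemma euler_prod_open_cover:
  assumes "open U" "open V" "finite_homology (prod_topology Y (top_of_set U))"
    "finite_homology (prod_topology Y (top_of_set V))"
    "finite_homology (prod_topology Y (top_of_set (U \<inter> V)))"
  shows "finite_homology (prod_topology Y (top_of_set (U \<union> V)))"
    and "euler_characteristic (prod_topology Y (top_of_set (U \<union> V))) +
      euler_characteristic (prod_topology Y (top_of_set (U \<inter> V))) =
      euler_characteristic (prod_topology Y (top_of_set U)) + euler_characteristic (prod_topology Y (top_of_set V))"
proof -
  let ?X = "prod_topology Y (top_of_set (U \<union> V))"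
  have "openin ?X (topspace Y \<times> U)" "openin ?X (topspace Y \<times> V)"
    using assms(1,2) by (auto simp: openin_prod_Times_iff intro!: open_subset)
  moreover have "(topspace Y \<times> U) \<union> (topspace Y \<times> V) = topspace ?X" by auto
  moreover have "(topspace Y \<times> U) \<inter> (topspace Y \<times> V) = topspace Y \<times> (U \<inter> V)" by auto
  ultimately show "finite_homology ?X" "euler_characteristic ?X +
      euler_characteristic (prod_topology Y (top_of_set (U \<inter> V))) =
      euler_characteristic (prod_topology Y (top_of_set U)) + euler_characteristic (prod_topology Y (top_of_set V))"
    using euler_open_cover[of ?X "topspace Y \<times> U" "topspace Y \<times> V"] assms
      subtopology_prod_top_of_set[of U "U \<union> V" Y] subtopology_prod_top_of_set[of V "U \<union> V" Y]
      subtopology_prod_top_of_set[of "U \<inter> V" "U \<union> V" Y, OF le_supI1[OF inf_le1]] by auto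
qed

text \<open>The disc is cut along the real ray that starts at 0, with 0 included, and points in the
  direction of \<open>-s\<close>. What is left is star-shaped about \<open>s / 2\<close>.\<close>

lemma contractible_slit_disc:
  assumes "\<bar>s\<bar> = (1::real)"
  shows "contractible {z \<in> ball (0::complex) 1. s * Re z > 0 \<or> Im z \<noteq> 0}" (is "contractible ?S")
proof (rule starlike_imp_contractible)
  let ?c = "of_real (s / 2) :: complex"
  have s: "s * s = 1" using assms by (metis abs_mult_self_eq mult_1)
  have c: "?c \<in> ?S" using assms s by (auto simp: norm_divide)
  have "closed_segment ?c z \<subseteq> ?S" if z: "z \<in> ?S" for z
  proof
    fix w assume w: "w \<in> closed_segment ?c z"
    then obtain u where u: "0 \<le> u" "u \<le> 1" "w = (1 - u) *\<^sub>R ?c + u *\<^sub>R z"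
      by (auto simp: closed_segment_def)
    have "w \<in> ball 0 1"
      using closed_segment_subset[of ?c "ball 0 1" z] c z w by auto
    \<comment> \<open>A real point of the segment other than the centre forces \<open>z\<close> to
      be real, and then both ends lie on the uncut side.\<close>
    moreover have "s * Re w > 0" if "Im w = 0"
    proof -
      have Re: "s * Re w = (1 - u) / 2 + u * (s * Re z)"
      proof -
        have "s * Re w = (1 - u) * (s * s) / 2 + u * (s * Re z)" by (simp add: u(3) field_simps)
        then show ?thesis by (simp add: s)
      qed
      have "u * Im z = 0" using that by (simp add: u(3))
      then show ?thesis
      proof (cases "u = 0")
        case False
        then have "Im z = 0" using \<open>u * Im z = 0\<close> by simp
        then have "s * Re z > 0" using z by simp
        then have "u * (s * Re z) > 0" using False u by simp
        moreover have "(1 - u) / 2 \<ge> 0" using u by simp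
        ultimately show ?thesis unfolding Re by linarith
      qed (simp add: Re)
    qed
    ultimately show "w \<in> ?S" by auto
  qed
  with c show "starlike ?S" unfolding starlike_def by blast
qed

text \<open>Two oppositely slit discs cover the punctured disc and meet in two disjoint half discs.
  All four pieces are contractible, so the Euler characteristic of \<open>Y\<close> is counted
  \<open>1 + 1 - (1 + 1)\<close> times.\<close>

lemma euler_prod_punctured_disc:
  assumes Y: "finite_homology Y"
  shows "finite_homology (prod_topology Y (top_of_set (ball (0::complex) 1 - {0})))"
    "euler_characteristic (prod_topology Y (top_of_set (ball (0::complex) 1 - {0}))) = 0"
proof -
  let ?S = "\<lambda>s. {z \<in> ball (0::complex) 1. s * Re z > 0 \<or> Im z \<noteq> 0}"
  let ?H = "\<lambda>s. ball (0::complex) 1 \<inter> {z. s * Im z > 0}"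
  have eqS: "?S s = ball 0 1 \<inter> ({z. s * Re z > 0} \<union> {z. Im z > 0} \<union> {z. Im z < 0})" for s by auto
  have openS: "open (?S s)" for s
    unfolding eqS by (intro open_Int open_Un open_ball open_Collect_less continuous_intros)
  have openH: "open (?H s)" for s
    by (intro open_Int open_ball open_Collect_less continuous_intros)
  have conH: "contractible (?H s)" for s
  proof (intro convex_imp_contractible convex_Int convex_ball)
    have "{z. s * Im z > 0} = {z. inner (s *\<^sub>R \<i>) z > 0}" by (simp add: inner_complex_def)
    then show "convex {z. s * Im z > 0}" using convex_halfspace_gt[of 0 "s *\<^sub>R \<i>"] by simp
  qed
  have neH: "?H 1 \<noteq> {}" "?H (-1) \<noteq> {}"
  proof -
    have "\<i> / 2 \<in> ?H 1" "- \<i> / 2 \<in> ?H (-1)" by (auto simp: norm_divide)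
    then show "?H 1 \<noteq> {}" "?H (-1) \<noteq> {}" by blast+
  qed
  have neS: "?S 1 \<noteq> {}" "?S (-1) \<noteq> {}" using neH by auto
  note S1 = euler_prod_contractible[OF Y contractible_slit_disc[of 1] neS(1)]
  note S2 = euler_prod_contractible[OF Y contractible_slit_disc[of "-1"] neS(2)]
  note H1 = euler_prod_contractible[OF Y conH neH(1)]
  note H2 = euler_prod_contractible[OF Y conH neH(2)]
  have "?H 1 \<inter> ?H (-1) = {}" by auto
  then have E: "finite_homology (prod_topology Y (top_of_set (?H 1 \<inter> ?H (-1))))"
    "euler_characteristic (prod_topology Y (top_of_set (?H 1 \<inter> ?H (-1)))) = 0"
    by (intro euler_empty; simp)+
  have I: "?S 1 \<inter> ?S (-1) = ?H 1 \<union> ?H (-1)" by auto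
  have U: "?S 1 \<union> ?S (-1) = ball 0 1 - {0}"
    by (auto simp: complex_eq_iff)
  note H = euler_prod_open_cover[OF openH openH H1(1) H2(1) E(1)]
  note S = euler_prod_open_cover[OF openS openS S1(1) S2(1) H(1)[folded I]]
  from S(1) show "finite_homology (prod_topology Y (top_of_set (ball (0::complex) 1 - {0})))"
    unfolding U by simp
  from S(2) H(2) show "euler_characteristic (prod_topology Y (top_of_set (ball (0::complex) 1 - {0}))) = 0"
    unfolding U I using S1 S2 H1 H2 E by simp
qed


section \<open>Affine arrangements\<close>

definition lform :: "nat \<Rightarrow> (nat \<Rightarrow> nat \<Rightarrow> complex) \<Rightarrow> nat \<Rightarrow> (nat \<Rightarrow> complex) \<Rightarrow> complex" where
  "lform k c j \<alpha> = (\<Sum>i\<le>k. c j i * \<alpha> i)"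

text \<open>Vectors are continued by 0 beyond \<open>k\<close>, unlike the points of
  \<open>complex_space\<close>, so that flats are linear subspaces of a single function
  space.\<close>

definition flat :: "nat \<Rightarrow> (nat \<Rightarrow> nat \<Rightarrow> complex) \<Rightarrow> nat set \<Rightarrow> (nat \<Rightarrow> complex) set" where
  "flat k c B = {\<alpha>. (\<forall>i>k. \<alpha> i = 0) \<and> (\<forall>j\<in>B. lform k c j \<alpha> = 0)}"

text \<open>Keeping the imposed forms \<open>B\<close> apart from the avoided forms \<open>A\<close>
  makes restriction to a hyperplane a mere transfer of its index from \<open>A\<close> to
  \<open>B\<close>.\<close>

definition affine_arr :: "nat \<Rightarrow> (nat \<Rightarrow> nat \<Rightarrow> complex) \<Rightarrow> nat set \<Rightarrow> nat set \<Rightarrow> (nat \<Rightarrow> complex) set" where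
  "affine_arr k c B A = {\<alpha> \<in> flat k c B. \<alpha> 0 = 1 \<and> (\<forall>j\<in>A. lform k c j \<alpha> \<noteq> 0)}"

lemma lform_comb: "lform k c j (\<lambda>i. a * x i + b * y i) = a * lform k c j x + b * lform k c j y"
  by (simp add: lform_def sum.distrib sum_distrib_left algebra_simps)

lemma lform_shift: "lform k c j (\<lambda>i. x i + b * y i) = lform k c j x + b * lform k c j y"
  using lform_comb[of k c j 1 x b y] by simp

lemma flat_comb: "x \<in> flat k c B \<Longrightarrow> y \<in> flat k c B \<Longrightarrow> (\<lambda>i. a * x i + b * y i) \<in> flat k c B"
  by (simp add: flat_def lform_comb)

lemma continuous_on_lform:
  assumes "continuous_on S f"
  shows "continuous_on S (\<lambda>x. lform k c j (f x))"
  unfolding lform_def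
  by (intro continuous_intros continuous_on_product_then_coordinatewise[OF assms])

lemma contractible_affine_arr_empty: "contractible (affine_arr k c B {})"
proof (cases "affine_arr k c B {} = {}")
  case True
  have "homotopic_with_canon (\<lambda>x. True) ({} :: (nat \<Rightarrow> complex) set) {} id (\<lambda>x. a)" for a
    by (rule homotopic_with_equal) auto
  then show ?thesis unfolding True contractible_def by blast
next
  case False
  let ?S = "affine_arr k c B {}"
  from False obtain a where a: "a \<in> ?S" by blast
  let ?h = "\<lambda>z::real \<times> (nat \<Rightarrow> complex). \<lambda>i. of_real (1 - fst z) * snd z i + of_real (fst z) * a i"
  have "?h (t, y) \<in> ?S" if "y \<in> ?S" for t y
  proof -
    have "(\<lambda>i. of_real (1 - t) * y i + of_real t * a i) \<in> flat k c B"
      using that a by (intro flat_comb) (auto simp: affine_arr_def)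
    then show ?thesis using that a by (simp add: affine_arr_def)
  qed
  moreover have "continuous_on ({0..1} \<times> ?S) ?h"
    by (intro continuous_intros continuous_on_product_then_coordinatewise)
  ultimately have "continuous_map (prod_topology (top_of_set {0..1}) (top_of_set ?S)) (top_of_set ?S) ?h"
    by (auto simp: continuous_map_in_subtopology simp flip: subtopology_Times)
  then have "homotopic_with_canon (\<lambda>x. True) ?S ?S id (\<lambda>x. a)"
    unfolding homotopic_with_def by (intro exI[of _ ?h]) auto
  then show ?thesis unfolding contractible_def by blast
qed

text \<open>The tubular neighbourhood of the hyperplane \<open>h\<^sub>x = 0\<close> inside the arrangement, rescaled so that all its
  fibres become the unit disc.\<close>

lemma tubular_neighbourhood:
  assumes A: "finite A"
    and v: "v \<in> flat k c B" "v 0 = 0" "lform k c x v = 1"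
  defines "X \<equiv> affine_arr k c B A" and "Y \<equiv> affine_arr k c (insert x B) A"
  obtains N where "N \<subseteq> X" "openin (top_of_set X) N" "Y \<subseteq> N"
    "top_of_set N homeomorphic_space top_of_set (Y \<times> ball (0::complex) 1)"
    "top_of_set (N - {\<alpha>. lform k c x \<alpha> = 0}) homeomorphic_space top_of_set (Y \<times> (ball (0::complex) 1 - {0}))"
proof -
  let ?h = "lform k c"
  \<comment> \<open>Projection along \<open>v\<close> onto the hyperplane. Since
    \<open>v 0 = 0\<close> it stays in the chart, and since the form of \<open>x\<close> is 1 on
    \<open>v\<close> it removes exactly the right multiple.\<close>
  define \<pi> where "\<pi> \<alpha> = (\<lambda>i. \<alpha> i + (- ?h x \<alpha>) * v i)" for \<alpha>
  \<comment> \<open>From \<open>y\<close>, a step along \<open>v\<close> shorter than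
    \<open>1 / s y\<close> changes each \<open>?h j\<close> by less than its own size, so no
    hyperplane of \<open>A\<close> is met. The summand 1 makes \<open>s y\<close> positive and
    strictly larger than every single quotient.\<close>
  define s where "s y = 1 + (\<Sum>j\<in>A. norm (?h j v) / norm (?h j y))" for y
  define \<Phi> where "\<Phi> z = (\<lambda>i. fst z i + (snd z / of_real (s (fst z))) * v i)" for z
  define \<Psi> where "\<Psi> \<alpha> = (\<pi> \<alpha>, ?h x \<alpha> * of_real (s (\<pi> \<alpha>)))" for \<alpha>
  \<comment> \<open>Where some \<open>?h j (\<pi> \<alpha>)\<close> vanishes, a summand of
    \<open>s\<close> is a division by zero with value 0 and continuity may fail; \<open>D\<close>
    excludes these points.\<close>
  define D where "D = {\<alpha>. \<forall>j\<in>A. ?h j (\<pi> \<alpha>) \<noteq> 0}"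
  define N where "N = {\<alpha> \<in> X. \<alpha> \<in> D \<and> norm (?h x \<alpha>) * s (\<pi> \<alpha>) < 1}"
  have s1: "s y \<ge> 1" for y unfolding s_def by (simp add: sum_nonneg)
  have s0: "s y > 0" "s y \<noteq> 0" for y using s1[of y] by auto
  have h\<pi>: "?h j (\<pi> \<alpha>) = ?h j \<alpha> - ?h x \<alpha> * ?h j v" for j \<alpha>
    unfolding \<pi>_def by (subst lform_shift) simp
  have h\<Phi>: "?h j (\<Phi> z) = ?h j (fst z) + snd z / of_real (s (fst z)) * ?h j v" for j z
    unfolding \<Phi>_def by (subst lform_shift) simp
  have \<pi>Y: "\<pi> \<alpha> \<in> Y" if "\<alpha> \<in> N" for \<alpha>
  proof -
    have "\<alpha> \<in> flat k c B" "\<alpha> 0 = 1" "\<alpha> \<in> D" using that by (auto simp: N_def X_def affine_arr_def)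
    then show ?thesis
      using v h\<pi> by (auto simp: Y_def affine_arr_def flat_def D_def) (simp_all add: \<pi>_def)
  qed
  have hxY: "?h x y = 0" if "y \<in> Y" for y using that by (auto simp: Y_def affine_arr_def flat_def)
  have \<Phi>1: "?h x (\<Phi> (y, t)) = t / of_real (s y)" "\<pi> (\<Phi> (y, t)) = y" if "y \<in> Y" for y t
  proof -
    show *: "?h x (\<Phi> (y, t)) = t / of_real (s y)" using hxY[OF that] v(3) by (simp add: h\<Phi>)
    show "\<pi> (\<Phi> (y, t)) = y" unfolding \<pi>_def * by (simp add: \<Phi>_def)
  qed
  have \<Phi>N: "\<Phi> (y, t) \<in> N" if y: "y \<in> Y" and t: "norm t < 1" for y t
  proof -
    have yB: "y \<in> flat k c B" "y 0 = 1" "\<And>j. j \<in> A \<Longrightarrow> ?h j y \<noteq> 0"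
      using y by (auto simp: Y_def affine_arr_def flat_def)
    have "?h j (\<Phi> (y, t)) \<noteq> 0" if j: "j \<in> A" for j
    proof
      assume "?h j (\<Phi> (y, t)) = 0"
      then have "norm (?h j y) = norm (t / of_real (s y) * ?h j v)"
        using h\<Phi>[of j "(y, t)"] by (metis add_eq_0_iff fst_conv snd_conv norm_minus_cancel)
      also have "\<dots> = norm t * (norm (?h j v) / s y)" using s0[of y] by (simp add: norm_mult norm_divide)
      finally have eq: "norm (?h j y) = norm t * (norm (?h j v) / s y)" .
      have "norm (?h j v) / norm (?h j y) \<le> s y - 1"
        unfolding s_def
        using member_le_sum[OF j, of "\<lambda>j. norm (?h j v) / norm (?h j y)"] A by simp
      then have "norm (?h j v) / norm (?h j y) < s y" by simp
      then have "norm (?h j v) / s y < norm (?h j y)"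
        using yB(3)[OF j] s0[of y] by (simp add: field_simps)
      moreover have "norm t * (norm (?h j v) / s y) \<le> 1 * (norm (?h j v) / s y)"
        using t s0(1)[of y] by (intro mult_right_mono) auto
      ultimately show False using eq by simp
    qed
    moreover have "\<Phi> (y, t) \<in> flat k c B"
      using flat_comb[OF yB(1) v(1), of 1 "t / of_real (s y)"] by (simp add: \<Phi>_def)
    moreover have "\<Phi> (y, t) 0 = 1" using yB v by (simp add: \<Phi>_def)
    moreover have "norm (?h x (\<Phi> (y, t))) * s y < 1" using \<Phi>1(1)[OF y] t s0[of y] by (simp add: norm_divide)
    ultimately show ?thesis using \<Phi>1(2)[OF y] yB(3) by (simp add: N_def X_def D_def affine_arr_def)
  qed
  have \<Psi>\<Phi>: "\<Psi> (\<Phi> z) = z" if "fst z \<in> Y" for z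
    using \<Phi>1[OF that, of "snd z"] s0[of "fst z"] by (simp add: \<Psi>_def)
  have \<Phi>\<Psi>: "\<Phi> (\<Psi> \<alpha>) = \<alpha>" for \<alpha>
    using s0[of "\<pi> \<alpha>"] by (simp add: \<Phi>_def \<Psi>_def) (simp add: \<pi>_def)
  have \<Psi>N: "\<Psi> \<alpha> \<in> Y \<times> ball 0 1" if "\<alpha> \<in> N" for \<alpha>
    using \<pi>Y[OF that] that s0[of "\<pi> \<alpha>"] by (simp add: \<Psi>_def N_def norm_mult)
  have cont\<pi>: "continuous_on S \<pi>" for S
    unfolding \<pi>_def
    by (intro continuous_intros continuous_on_lform continuous_on_product_then_coordinatewise)
  have conts: "continuous_on S (\<lambda>x. s (f x))"
    if "continuous_on S f" "\<And>x j. x \<in> S \<Longrightarrow> j \<in> A \<Longrightarrow> ?h j (f x) \<noteq> 0" for S :: "'z::topological_space set" and f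
    unfolding s_def
    by (intro continuous_intros continuous_on_lform[OF that(1)]) (use that(2) in auto)
  have contsd: "continuous_on D (\<lambda>\<alpha>. s (\<pi> \<alpha>))"
    by (intro conts cont\<pi>) (auto simp: D_def)
  have cont\<Psi>: "continuous_on N \<Psi>"
    unfolding \<Psi>_def
    by (intro continuous_intros cont\<pi> continuous_on_lform continuous_on_subset[OF contsd]) (auto simp: N_def)
  have cont\<Phi>: "continuous_on (Y \<times> T) \<Phi>" for T
  proof -
    have 1: "continuous_on (Y \<times> T) (\<lambda>z. fst z i)" for i
      by (rule continuous_on_product_then_coordinatewise) (intro continuous_intros)
    have 2: "continuous_on (Y \<times> T) (\<lambda>z. s (fst z))"
      by (rule conts) (auto intro: continuous_intros simp: Y_def affine_arr_def)
    show ?thesis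
      unfolding \<Phi>_def
      by (rule continuous_on_coordinatewise_then_product, intro continuous_intros 1 2) (use s0 in auto)
  qed
  have homeo: "top_of_set M homeomorphic_space top_of_set (Y \<times> T)"
    if "M \<subseteq> N" "T \<subseteq> ball 0 1" "\<Psi> ` M \<subseteq> Y \<times> T" "\<Phi> ` (Y \<times> T) \<subseteq> M" for M T
    unfolding homeomorphic_space_def homeomorphic_maps_def
  proof (intro exI conjI)
    show "continuous_map (top_of_set M) (top_of_set (Y \<times> T)) \<Psi>"
      using that continuous_on_subset[OF cont\<Psi>] by (auto simp: continuous_map_in_subtopology)
    show "continuous_map (top_of_set (Y \<times> T)) (top_of_set M) \<Phi>"
      using that cont\<Phi> by (auto simp: continuous_map_in_subtopology)
  qed (use \<Phi>\<Psi> \<Psi>\<Phi> in auto)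
  show ?thesis
  proof (rule that[of N])
    show "N \<subseteq> X" by (auto simp: N_def)
    have "D = (\<Inter>j\<in>A. {\<alpha>. ?h j (\<pi> \<alpha>) \<noteq> 0})" by (auto simp: D_def)
    then have "open D"
      using A by (auto intro!: open_INT open_Collect_neq continuous_on_lform cont\<pi>)
    moreover have "open {\<alpha> \<in> D. norm (?h x \<alpha>) * s (\<pi> \<alpha>) < 1}"
    proof -
      have "continuous_on D (\<lambda>\<alpha>. norm (?h x \<alpha>) * s (\<pi> \<alpha>))"
        by (intro continuous_intros continuous_on_lform contsd)
      then have "open (D \<inter> (\<lambda>\<alpha>. norm (?h x \<alpha>) * s (\<pi> \<alpha>)) -` {..<1})"
        using \<open>open D\<close> by (intro continuous_open_preimage) auto
      moreover have "{\<alpha> \<in> D. norm (?h x \<alpha>) * s (\<pi> \<alpha>) < 1} = D \<inter> (\<lambda>\<alpha>. norm (?h x \<alpha>) * s (\<pi> \<alpha>)) -` {..<1}"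
        by auto
      ultimately show ?thesis by simp
    qed
    moreover have "N = X \<inter> {\<alpha> \<in> D. norm (?h x \<alpha>) * s (\<pi> \<alpha>) < 1}" by (auto simp: N_def)
    ultimately show "openin (top_of_set X) N" by (auto simp: openin_open)
    show "Y \<subseteq> N"
    proof
      fix y assume y: "y \<in> Y"
      have "\<Phi> (y, 0) = y" by (simp add: \<Phi>_def)
      then show "y \<in> N" using \<Phi>N[OF y, of 0] by simp
    qed
    show "top_of_set N homeomorphic_space top_of_set (Y \<times> ball (0::complex) 1)"
    proof (rule homeo)
      show "\<Psi> ` N \<subseteq> Y \<times> ball 0 1" using \<Psi>N by blast
      show "\<Phi> ` (Y \<times> ball 0 1) \<subseteq> N" using \<Phi>N by auto
    qed auto
    show "top_of_set (N - {\<alpha>. ?h x \<alpha> = 0}) homeomorphic_space top_of_set (Y \<times> (ball (0::complex) 1 - {0}))"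
    proof (rule homeo)
      have "\<Psi> \<alpha> \<in> Y \<times> (ball 0 1 - {0})" if "\<alpha> \<in> N" "?h x \<alpha> \<noteq> 0" for \<alpha>
        using \<Psi>N[OF that(1)] that(2) s0[of "\<pi> \<alpha>"] by (auto simp: \<Psi>_def)
      then show "\<Psi> ` (N - {\<alpha>. ?h x \<alpha> = 0}) \<subseteq> Y \<times> (ball 0 1 - {0})" by blast
      have "?h x (\<Phi> (y, t)) \<noteq> 0" if "y \<in> Y" "t \<noteq> 0" for y t
        using \<Phi>1(1)[OF that(1)] that(2) s0[of y] by simp
      then show "\<Phi> ` (Y \<times> (ball 0 1 - {0})) \<subseteq> N - {\<alpha>. ?h x \<alpha> = 0}" using \<Phi>N by auto
    qed auto
  qed
qed

lemma top_of_set_Times: "top_of_set (S \<times> T) = prod_topology (top_of_set S) (top_of_set T)"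
  by (simp add: subtopology_Times)

text \<open>The tube \<open>N\<close> and the complement of the new hyperplane cover
  \<open>?X\<close> and meet in the punctured tube. The tube has the Euler characteristic of
  \<open>?Y\<close>, the punctured tube has 0.\<close>

lemma euler_tubular:
  assumes A: "finite A"
    and v: "v \<in> flat k c B" "v 0 = 0" "lform k c x v = 1"
    and fin: "finite_homology (top_of_set (affine_arr k c B A))"
      "finite_homology (top_of_set (affine_arr k c (insert x B) A))"
  shows "finite_homology (top_of_set (affine_arr k c B (insert x A)))"
    and "euler_characteristic (top_of_set (affine_arr k c B A)) =
      euler_characteristic (top_of_set (affine_arr k c B (insert x A))) +
      euler_characteristic (top_of_set (affine_arr k c (insert x B) A))"
proof -
  let ?X = "affine_arr k c B A" and ?Y = "affine_arr k c (insert x B) A" and ?Z = "affine_arr k c B (insert x A)"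
  obtain N where N: "N \<subseteq> ?X" "openin (top_of_set ?X) N" "?Y \<subseteq> N"
    "top_of_set N homeomorphic_space top_of_set (?Y \<times> ball (0::complex) 1)"
    "top_of_set (N - {\<alpha>. lform k c x \<alpha> = 0}) homeomorphic_space top_of_set (?Y \<times> (ball (0::complex) 1 - {0}))"
    using tubular_neighbourhood[OF A v] .
  have Z: "?Z = ?X - {\<alpha>. lform k c x \<alpha> = 0}" by (auto simp: affine_arr_def)
  have NZ: "N \<inter> ?Z = N - {\<alpha>. lform k c x \<alpha> = 0}" unfolding Z using N(1) by blast
  have YZ: "?X - ?Z = ?Y" by (auto simp: affine_arr_def flat_def)
  have "open {\<alpha>. lform k c x \<alpha> \<noteq> 0}"
    by (intro open_Collect_neq continuous_on_lform) (auto intro: continuous_intros)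
  moreover have "?Z = ?X \<inter> {\<alpha>. lform k c x \<alpha> \<noteq> 0}" unfolding Z by blast
  ultimately have openZ: "openin (top_of_set ?X) ?Z" by (auto simp: openin_open)
  have "?Z \<subseteq> ?X" unfolding Z by blast
  then have cover: "N \<union> ?Z = topspace (top_of_set ?X)" using N(1,3) YZ by auto
  have sub: "subtopology (top_of_set ?X) N = top_of_set N" "subtopology (top_of_set ?X) ?Z = top_of_set ?Z"
    "subtopology (top_of_set ?X) (N \<inter> ?Z) = top_of_set (N - {\<alpha>. lform k c x \<alpha> = 0})"
    unfolding NZ[symmetric] using N(1) \<open>?Z \<subseteq> ?X\<close> by (simp_all add: subtopology_subtopology Int_absorb1 le_infI1)
  have "ball (0::complex) 1 \<noteq> {}" by simp
  note P = euler_prod_contractible[OF fin(2) convex_imp_contractible[OF convex_ball] this]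
  note Q = euler_prod_punctured_disc[OF fin(2)]
  have N': "finite_homology (top_of_set N)" "euler_characteristic (top_of_set N) = euler_characteristic (top_of_set ?Y)"
    using homotopy_equivalent_euler[OF homeomorphic_imp_homotopy_equivalent_space[OF
        homeomorphic_space_sym[THEN iffD1, OF N(4)[unfolded top_of_set_Times]]]] P by metis+
  have NH: "finite_homology (top_of_set (N - {\<alpha>. lform k c x \<alpha> = 0}))"
    "euler_characteristic (top_of_set (N - {\<alpha>. lform k c x \<alpha> = 0})) = 0"
    using homotopy_equivalent_euler[OF homeomorphic_imp_homotopy_equivalent_space[OF
        homeomorphic_space_sym[THEN iffD1, OF N(5)[unfolded top_of_set_Times]]]] Q by metis+
  note E = euler_open_cover[OF N(2) openZ cover, unfolded sub, OF N'(1) NH(1) disjI2, OF fin(1)]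
  show "finite_homology (top_of_set ?Z)" by (rule E(1))
  show "euler_characteristic (top_of_set ?X) = euler_characteristic (top_of_set ?Z) + euler_characteristic (top_of_set ?Y)"
    using E(3) N'(2) NH(2) by simp
qed

text \<open>On the ambient affine flat the new form is identically 0, nowhere 0, or takes two
  values; only the last case calls for a tube. In the others one of the two new spaces is empty and
  the other is \<open>?X\<close>.\<close>

lemma euler_deletion_restriction:
  assumes A: "finite A"
    and fin: "finite_homology (top_of_set (affine_arr k c B A))"
      "finite_homology (top_of_set (affine_arr k c (insert x B) A))"
  shows "finite_homology (top_of_set (affine_arr k c B (insert x A))) \<and>
    euler_characteristic (top_of_set (affine_arr k c B A)) =
      euler_characteristic (top_of_set (affine_arr k c B (insert x A))) +
      euler_characteristic (top_of_set (affine_arr k c (insert x B) A))"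
proof -
  let ?L = "affine_arr k c B {}" and ?h = "lform k c x"
  let ?X = "affine_arr k c B A" and ?Y = "affine_arr k c (insert x B) A" and ?Z = "affine_arr k c B (insert x A)"
  have L: "?X \<subseteq> ?L" by (auto simp: affine_arr_def)
  consider "\<forall>p\<in>?L. ?h p = 0" | "\<forall>p\<in>?L. ?h p \<noteq> 0" | p q where "p \<in> ?L" "q \<in> ?L" "?h p \<noteq> ?h q"
    by metis
  then show ?thesis
  proof cases
    case 1
    then have "?Z = {}" "?Y = ?X" using L by (auto simp: affine_arr_def flat_def)
    then show ?thesis using euler_empty[of "top_of_set ?Z"] fin by simp
  next
    case 2
    then have "?Y = {}" "?Z = ?X" using L by (auto simp: affine_arr_def flat_def)
    then show ?thesis using euler_empty[of "top_of_set ?Y"] fin by simp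
  next
    case 3
    define d where "d = ?h q - ?h p"
    have d: "d \<noteq> 0" using 3 by (simp add: d_def)
    \<comment> \<open>A difference of two points of the chart has coordinate 0 equal to 0; division
      by \<open>d\<close> makes the form equal to 1 on it.\<close>
    define v where "v = (\<lambda>i. (1 / d) * q i + (- 1 / d) * p i)"
    have pq: "p \<in> flat k c B" "q \<in> flat k c B" "p 0 = 1" "q 0 = 1" using 3 by (auto simp: affine_arr_def)
    have "v \<in> flat k c B" unfolding v_def by (rule flat_comb[OF pq(2,1)])
    moreover have "v 0 = 0" using pq by (simp add: v_def)
    moreover have "?h v = 1"
    proof -
      have "?h v = (?h q - ?h p) / d" unfolding v_def lform_comb by (simp add: diff_divide_distrib)
      then show ?thesis using d by (simp add: d_def)
    qed
    ultimately show ?thesis using euler_tubular[OF A _ _ _ fin] by blast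
  qed
qed

text \<open>Deletion and restriction unrolled, with \<open>B\<close> arbitrary because restriction
  enlarges it. The recursion ends at affine subspaces, which count 1, or 0 if empty.\<close>

theorem euler_affine_arr:
  assumes "finite A"
  shows "finite_homology (top_of_set (affine_arr k c B A)) \<and>
    euler_characteristic (top_of_set (affine_arr k c B A)) =
      (\<Sum>C\<in>Pow A. (-1) ^ card C * (if affine_arr k c (B \<union> C) {} = {} then 0 else 1))"
  using assms
proof (induction A arbitrary: B)
  case empty
  show ?case
    using euler_contractible[of "top_of_set (affine_arr k c B {})"] euler_empty[of "top_of_set (affine_arr k c B {})"]
      contractible_affine_arr_empty[of k c B] by auto
next
  case (insert x A)
  let ?g = "\<lambda>C. if affine_arr k c C {} = {} then 0 else 1 :: int"
  have "(\<Sum>C\<in>Pow (insert x A). (-1) ^ card C * ?g (B \<union> C)) =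
    (\<Sum>C\<in>Pow A. (-1) ^ card C * ?g (B \<union> C)) + (\<Sum>C\<in>insert x ` Pow A. (-1) ^ card C * ?g (B \<union> C))"
    using insert.hyps by (subst Pow_insert, intro sum.union_disjoint) auto
  also have "(\<Sum>C\<in>insert x ` Pow A. (-1) ^ card C * ?g (B \<union> C)) =
    (\<Sum>C\<in>Pow A. (-1) ^ card (insert x C) * ?g (B \<union> insert x C))"
    using insert.hyps by (subst sum.reindex) (auto intro!: inj_onI)
  also have "\<dots> = - (\<Sum>C\<in>Pow A. (-1) ^ card C * ?g (insert x B \<union> C))"
    unfolding sum_negf[symmetric]
  proof (rule sum.cong[OF refl])
    fix C assume "C \<in> Pow A"
    then have "finite C" "x \<notin> C" using insert.hyps finite_subset by auto
    then show "(-1) ^ card (insert x C) * ?g (B \<union> insert x C) = - ((-1) ^ card C * ?g (insert x B \<union> C))" by simp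
  qed
  finally show ?case
    using euler_deletion_restriction[OF insert.hyps(1), of k c B x] insert.IH[of B] insert.IH[of "insert x B"] by auto
qed


section \<open>Dehomogenisation\<close>

definition arr_coeff :: "nat \<Rightarrow> nat \<Rightarrow> complex mat \<Rightarrow> nat \<Rightarrow> nat \<Rightarrow> complex" where
  "arr_coeff k n z j i = extended_mat k n z $$ (i, j)"

lemma lin_form_eq_lform: "(\<And>i. i \<le> k \<Longrightarrow> \<alpha> i = \<beta> i) \<Longrightarrow> lin_form k n j \<alpha> z = lform k (arr_coeff k n z) j \<beta>"
  unfolding lin_form_def lform_def arr_coeff_def atLeast0AtMost by (intro sum.cong) auto

lemma lform_arr_coeff_coord: "j \<le> k \<Longrightarrow> j \<le> n \<Longrightarrow> lform k (arr_coeff k n z) j \<alpha> = \<alpha> j"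
  by (simp add: lform_def arr_coeff_def extended_mat_def if_distrib[of "\<lambda>x. x * _"] cong: if_cong)

lemma lform_mult: "lform k c j (\<lambda>i. t * \<alpha> i) = t * lform k c j \<alpha>"
  by (simp add: lform_def sum_distrib_left mult_ac)

lemma proj_point_eqD:
  assumes "proj_point k \<alpha> = proj_point k \<beta>" "\<alpha> \<in> topspace (complex_space k)"
  obtains t where "t \<noteq> 0" "\<And>i. i \<le> k \<Longrightarrow> \<alpha> i = t * \<beta> i"
proof -
  have "(\<lambda>i\<in>{0..k}. 1 * \<alpha> i) \<in> proj_point k \<alpha>" unfolding proj_point_def by (intro CollectI exI[of _ 1]) auto
  then obtain t where t: "t \<noteq> 0" "(\<lambda>i\<in>{0..k}. 1 * \<alpha> i) = (\<lambda>i\<in>{0..k}. t * \<beta> i)"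
    unfolding assms(1) by (auto simp: proj_point_def)
  have "\<alpha> i = t * \<beta> i" if "i \<le> k" for i
    using fun_cong[OF t(2), of i] that by simp
  then show ?thesis using t(1) that by blast
qed

lemma proj_point_eqI:
  assumes "t \<noteq> 0" "\<And>i. i \<le> k \<Longrightarrow> \<alpha> i = t * \<beta> i"
  shows "proj_point k \<alpha> = proj_point k \<beta>"
proof -
  have "\<exists>t'. (\<lambda>i\<in>{0..k}. s * \<alpha> i) = (\<lambda>i\<in>{0..k}. t' * \<beta> i) \<and> t' \<noteq> 0" if "s \<noteq> 0" for s
    using that assms by (intro exI[of _ "s * t"]) (auto simp: fun_eq_iff restrict_def)
  moreover have "\<exists>t'. (\<lambda>i\<in>{0..k}. s * \<beta> i) = (\<lambda>i\<in>{0..k}. t' * \<alpha> i) \<and> t' \<noteq> 0" if "s \<noteq> 0" for s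
    using that assms by (intro exI[of _ "s / t"]) (auto simp: fun_eq_iff restrict_def)
  ultimately show ?thesis unfolding proj_point_def by blast
qed

text \<open>Form 0 is coordinate 0, so it is nonzero on the complement, and dividing by it selects a
  representative; this leaves only the indices \<open>{1..n}\<close> to be avoided. Continuity of
  the normalisation on the projective side comes from the universal property of the quotient map
  over an open set.\<close>

lemma arr_complement_homeomorphic:
  assumes "k \<le> n"
  shows "arr_complement k n z homeomorphic_space top_of_set (affine_arr k (arr_coeff k n z) {} {1..n})"
proof -
  let ?c = "arr_coeff k n z"
  let ?U = "affine_arr k ?c {} {1..n}"
  let ?\<pi> = "proj_point k"
  \<comment> \<open>Representatives are undefined beyond \<open>k\<close>; \<open>e\<close> replaces
    these values by 0, and \<open>\<sigma>\<close> below goes back.\<close>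
  define e where "e = (\<lambda>\<alpha> i. if i \<le> k then \<alpha> i else (0::complex))"
  define \<rho> where "\<rho> = (\<lambda>\<alpha> i. e \<alpha> i / \<alpha> 0)"
  define P where "P = {\<alpha> \<in> topspace (punctured_space k). \<forall>j\<in>{0..n}. lin_form k n j \<alpha> z \<noteq> 0}"
  define V where "V = topspace (projective_space k) - (\<Union>j\<in>{0..n}. hyperplane k n z j)"
  have le: "lin_form k n j \<alpha> z = lform k ?c j (e \<alpha>)" for j \<alpha>
    by (rule lin_form_eq_lform) (simp add: e_def)
  have quo: "quotient_map (punctured_space k) (projective_space k) ?\<pi>"
    unfolding projective_space_def by (rule quotient_map_quotient_topology)
  have tp: "topspace (projective_space k) = ?\<pi> ` topspace (punctured_space k)"
    using quo by (simp add: quotient_map_def)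
  have pc: "\<alpha> \<in> topspace (complex_space k)" if "\<alpha> \<in> topspace (punctured_space k)" for \<alpha>
    using that by (simp add: punctured_space_def)
  have PV: "{\<alpha> \<in> topspace (punctured_space k). ?\<pi> \<alpha> \<in> V} = P"
  proof -
    have "?\<pi> \<alpha> \<in> V \<longleftrightarrow> (\<forall>j\<in>{0..n}. lin_form k n j \<alpha> z \<noteq> 0)" if \<alpha>: "\<alpha> \<in> topspace (punctured_space k)" for \<alpha>
    proof -
      have "?\<pi> \<alpha> \<in> hyperplane k n z j \<longleftrightarrow> lin_form k n j \<alpha> z = 0" for j
      proof
        assume "?\<pi> \<alpha> \<in> hyperplane k n z j"
        then obtain \<beta> where b: "\<beta> \<in> topspace (punctured_space k)" "lin_form k n j \<beta> z = 0" "?\<pi> \<alpha> = ?\<pi> \<beta>"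
          by (auto simp: hyperplane_def)
        obtain t where t: "t \<noteq> 0" "\<And>i. i \<le> k \<Longrightarrow> \<alpha> i = t * \<beta> i"
          using proj_point_eqD[OF b(3) pc[OF \<alpha>]] by blast
        have "lin_form k n j \<alpha> z = lform k ?c j (\<lambda>i. t * e \<beta> i)"
          using t by (intro lin_form_eq_lform) (simp add: e_def)
        then show "lin_form k n j \<alpha> z = 0" using b(2) by (simp add: lform_mult le)
      qed (use \<alpha> in \<open>auto simp: hyperplane_def\<close>)
      then show ?thesis using \<alpha> unfolding V_def tp by auto
    qed
    then show ?thesis by (auto simp: P_def)
  qed
  have cont_e: "continuous_map (complex_space k) euclidean e"
  proof -
    have "continuous_map (complex_space k) euclidean (\<lambda>\<alpha>. e \<alpha> i)" for i
      by (cases "i \<le> k") (auto simp: e_def complex_space_def intro: continuous_map_product_projection)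
    then show ?thesis
      by (subst euclidean_product_topology[symmetric]) (simp add: continuous_map_componentwise_UNIV)
  qed
  have openW: "open {x. \<forall>j\<in>{0..n}. lform k ?c j x \<noteq> 0}"
  proof -
    have "{x. \<forall>j\<in>{0..n}. lform k ?c j x \<noteq> 0} = (\<Inter>j\<in>{0..n}. {x. lform k ?c j x \<noteq> 0})" by auto
    moreover have "open {x. lform k ?c j x \<noteq> 0}" for j
      by (intro open_Collect_neq continuous_on_lform) (auto intro: continuous_intros)
    ultimately show ?thesis by (simp add: open_INT)
  qed
  have P': "P = topspace (punctured_space k) \<inter> {\<alpha> \<in> topspace (complex_space k). e \<alpha> \<in> {x. \<forall>j\<in>{0..n}. lform k ?c j x \<noteq> 0}}"
    using pc by (auto simp: P_def le)
  have "openin (complex_space k) {\<alpha> \<in> topspace (complex_space k). e \<alpha> \<in> {x. \<forall>j\<in>{0..n}. lform k ?c j x \<noteq> 0}}"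
    using openin_continuous_map_preimage[OF cont_e, of "{x. \<forall>j\<in>{0..n}. lform k ?c j x \<noteq> 0}"] openW by simp
  then have "openin (punctured_space k) P"
    unfolding P' punctured_space_def topspace_subtopology by (auto simp: openin_subtopology)
  then have "openin (projective_space k) V"
    using PV unfolding projective_space_def openin_quotient_topology
    by (auto simp: V_def tp)
  \<comment> \<open>A quotient map restricts to a quotient map over an open set, here from its full
    preimage \<open>P\<close>.\<close>
  then have quoP: "quotient_map (subtopology (punctured_space k) P) (arr_complement k n z) ?\<pi>"
    unfolding arr_complement_def V_def[symmetric] by (intro quotient_map_restriction[OF quo PV]) simp
  have topP: "topspace (subtopology (punctured_space k) P) = P" by (auto simp: P_def)
  have P0: "\<alpha> 0 \<noteq> 0" if "\<alpha> \<in> P" for \<alpha>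
    using that lform_arr_coeff_coord[of 0 k n z "e \<alpha>"] by (auto simp: P_def le e_def)
  have \<rho>U: "\<rho> \<alpha> \<in> ?U" if "\<alpha> \<in> P" for \<alpha>
  proof -
    have "lform k ?c j (\<rho> \<alpha>) = lform k ?c j (e \<alpha>) / \<alpha> 0" for j
      using lform_mult[of k ?c j "1 / \<alpha> 0" "e \<alpha>"] by (simp add: \<rho>_def)
    then show ?thesis
      using that P0[OF that] by (auto simp: affine_arr_def flat_def P_def le) (auto simp: \<rho>_def e_def)
  qed
  have contP: "continuous_map (subtopology (punctured_space k) P) (top_of_set ?U) \<rho>"
  proof -
    have "continuous_map (subtopology (punctured_space k) P) (top_of_set {x. x 0 \<noteq> 0}) e"
      using cont_e P0 topP unfolding continuous_map_in_subtopology punctured_space_def subtopology_subtopology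
      by (auto intro: continuous_map_from_subtopology simp: e_def)
    moreover have "continuous_map (top_of_set {x. x 0 \<noteq> 0}) euclidean (\<lambda>(x :: nat \<Rightarrow> complex) i. x i / x 0)"
    proof -
      have c: "continuous_on {x. x 0 \<noteq> (0::complex)} (\<lambda>x. x i)" for i :: nat
        by (rule continuous_on_product_then_coordinatewise) (intro continuous_intros)
      have "continuous_on {x. x 0 \<noteq> 0} (\<lambda>(x :: nat \<Rightarrow> complex) i. x i / x 0)"
        by (rule continuous_on_coordinatewise_then_product, rule continuous_on_divide[OF c c]) auto
      then show ?thesis by simp
    qed
    ultimately have "continuous_map (subtopology (punctured_space k) P) euclidean ((\<lambda>x i. x i / x 0) \<circ> e)"
      by (rule continuous_map_compose)
    moreover have "(\<lambda>x i. x i / x 0) \<circ> e = \<rho>" by (auto simp: fun_eq_iff \<rho>_def e_def)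
    ultimately show ?thesis using \<rho>U topP by (auto simp: continuous_map_in_subtopology)
  qed
  have inv: "\<rho> \<alpha> = \<rho> \<beta>" if "\<alpha> \<in> P" "\<beta> \<in> P" "?\<pi> \<alpha> = ?\<pi> \<beta>" for \<alpha> \<beta>
  proof -
    have "\<alpha> \<in> topspace (complex_space k)" using that(1) pc by (simp add: P_def)
    from proj_point_eqD[OF that(3) this] obtain t where t: "t \<noteq> 0" "\<And>i. i \<le> k \<Longrightarrow> \<alpha> i = t * \<beta> i" by blast
    then show ?thesis using P0[OF that(2)] by (auto simp: fun_eq_iff \<rho>_def e_def)
  qed
  obtain g where g: "continuous_map (arr_complement k n z) (top_of_set ?U) g" "\<And>\<alpha>. \<alpha> \<in> P \<Longrightarrow> g (?\<pi> \<alpha>) = \<rho> \<alpha>"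
    using quotient_map_lift_exists[OF quoP contP] inv unfolding topP by metis
  define \<sigma> where "\<sigma> = (\<lambda>x::nat \<Rightarrow> complex. restrict x {0..k})"
  have \<sigma>P: "\<sigma> x \<in> P" if "x \<in> ?U" for x
  proof -
    have x: "x 0 = 1" "\<And>j. j \<in> {1..n} \<Longrightarrow> lform k ?c j x \<noteq> 0" "e (\<sigma> x) = x" using that
      by (auto simp: affine_arr_def flat_def e_def \<sigma>_def fun_eq_iff)
    then have "\<sigma> x 0 \<noteq> 0" by (simp add: \<sigma>_def)
    moreover have "lform k ?c 0 x \<noteq> 0" using x(1) by (simp add: lform_arr_coeff_coord)
    then have "lform k ?c j x \<noteq> 0" if "j \<in> {0..n}" for j using x(2)[of j] that by (cases "j = 0") auto
    ultimately show ?thesis using x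
      by (auto simp: P_def le punctured_space_def complex_space_def \<sigma>_def PiE_def intro!: bexI[of _ 0])
  qed
  have cont\<sigma>: "continuous_map (top_of_set ?U) (subtopology (punctured_space k) P) \<sigma>"
  proof -
    have "continuous_map (top_of_set ?U) (complex_space k) \<sigma>"
      unfolding complex_space_def continuous_map_componentwise
    proof (intro conjI ballI)
      fix i assume "i \<in> {0..k}"
      have "continuous_on ?U (\<lambda>x. x i)"
        by (rule continuous_on_product_then_coordinatewise) (intro continuous_intros)
      then show "continuous_map (top_of_set ?U) euclidean (\<lambda>x. \<sigma> x i)" using \<open>i \<in> {0..k}\<close> by (simp add: \<sigma>_def)
    qed (auto simp: \<sigma>_def)
    then show ?thesis
      using \<sigma>P by (auto simp: continuous_map_in_subtopology punctured_space_def P_def)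
  qed
  have "homeomorphic_maps (arr_complement k n z) (top_of_set ?U) g (?\<pi> \<circ> \<sigma>)"
    unfolding homeomorphic_maps_def
  proof (intro conjI ballI)
    show "continuous_map (top_of_set ?U) (arr_complement k n z) (?\<pi> \<circ> \<sigma>)"
      using cont\<sigma> quotient_imp_continuous_map[OF quoP] by (rule continuous_map_compose)
    fix p assume "p \<in> topspace (arr_complement k n z)"
    moreover have "?\<pi> ` P = topspace (arr_complement k n z)"
      using quoP topP by (simp add: quotient_map_def)
    ultimately obtain \<alpha> where \<alpha>: "\<alpha> \<in> P" "p = ?\<pi> \<alpha>" by blast
    have "?\<pi> (\<sigma> (\<rho> \<alpha>)) = ?\<pi> \<alpha>"
      using P0[OF \<alpha>(1)] by (intro proj_point_eqI[of "1 / \<alpha> 0"]) (auto simp: \<sigma>_def \<rho>_def e_def)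
    then show "(?\<pi> \<circ> \<sigma>) (g p) = p" using g(2)[OF \<alpha>(1)] \<alpha>(2) by simp
  next
    fix x assume "x \<in> topspace (top_of_set ?U)"
    then have x: "x \<in> ?U" by simp
    then have "\<rho> (\<sigma> x) = x" by (auto simp: fun_eq_iff \<rho>_def \<sigma>_def e_def affine_arr_def flat_def)
    then show "g ((?\<pi> \<circ> \<sigma>) x) = x" using g(2)[OF \<sigma>P[OF x]] by simp
  qed (rule g(1))
  then show ?thesis unfolding homeomorphic_space_def by blast
qed

lemma euler_arr_complement:
  assumes "k \<le> n"
  shows "euler_characteristic (arr_complement k n z) =
    (\<Sum>C\<in>Pow {1..n}. (-1) ^ card C * (if affine_arr k (arr_coeff k n z) C {} = {} then 0 else 1))"
proof -
  let ?U = "affine_arr k (arr_coeff k n z) {} {1..n}"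
  have "top_of_set ?U homotopy_equivalent_space arr_complement k n z"
    using arr_complement_homeomorphic[OF assms]
    by (intro homeomorphic_imp_homotopy_equivalent_space) (rule homeomorphic_space_sym[THEN iffD1])
  from homotopy_equivalent_euler(2)[OF this] euler_affine_arr[of "{1..n}" k "arr_coeff k n z" "{}"]
  show ?thesis by simp
qed


section \<open>The matroid of an arrangement\<close>

interpretation fun_space: vector_space "\<lambda>(a::complex) (f::nat \<Rightarrow> complex) i. a * f i"
  by unfold_locales (auto simp: fun_eq_iff algebra_simps)

text \<open>The ambient function space is infinite-dimensional, where \<open>dim\<close> is
  informative only if bases are finite. This inclusion makes all bases of flats finite.\<close>

lemma flat_subset_span: "flat k c B \<subseteq> fun_space.span ((\<lambda>m i. if i = m then 1 else 0) ` {..k})"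
proof
  let ?e = "\<lambda>m i. if i = m then 1 else 0 :: complex"
  fix x assume "x \<in> flat k c B"
  then have x: "x i = 0" if "i > k" for i using that by (simp add: flat_def)
  have app: "(\<Sum>m\<in>M. f m) i = (\<Sum>m\<in>M. f m i)" for f :: "nat \<Rightarrow> nat \<Rightarrow> complex" and M i
    by (induction M rule: infinite_finite_induct) auto
  have "x = (\<Sum>m\<le>k. (\<lambda>i. x m * ?e m i))"
  proof
    fix i
    show "x i = (\<Sum>m\<le>k. (\<lambda>i. x m * ?e m i)) i"
      unfolding app using x[of i] by (cases "i \<le> k") (auto simp: if_distrib[of "\<lambda>t. _ * t"] cong: if_cong)
  qed
  also have "\<dots> \<in> fun_space.span (?e ` {..k})"
    by (intro fun_space.span_sum fun_space.span_scale fun_space.span_base) auto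
  finally show "x \<in> fun_space.span (?e ` {..k})" .
qed

lemma subspace_flat: "fun_space.subspace (flat k c B)"
proof (rule fun_space.subspaceI)
  show "0 \<in> flat k c B" by (simp add: flat_def lform_def)
  show "x + y \<in> flat k c B" if "x \<in> flat k c B" "y \<in> flat k c B" for x y
    using flat_comb[OF that, of 1 1] by (simp add: plus_fun_def)
  show "(\<lambda>i. a * x i) \<in> flat k c B" if "x \<in> flat k c B" for a x
    using flat_comb[OF that that, of a 0] by simp
qed

text \<open>The new flat is the kernel of a linear form on the old one. Unless the form vanishes
  there, a basis of the kernel and one vector \<open>v\<close> outside form a basis, since
  subtracting a multiple of \<open>v\<close> moves any vector into the kernel.\<close>

lemma dim_flat_insert:
  "fun_space.dim (flat k c B) = fun_space.dim (flat k c (insert x B)) +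
     (if \<exists>\<alpha>\<in>flat k c B. lform k c x \<alpha> \<noteq> 0 then 1 else 0)"
proof (cases "\<exists>\<alpha>\<in>flat k c B. lform k c x \<alpha> \<noteq> 0")
  case False
  then have "flat k c (insert x B) = flat k c B" by (auto simp: flat_def)
  with False show ?thesis by simp
next
  case True
  then obtain v where v: "v \<in> flat k c B" "lform k c x v \<noteq> 0" by blast
  let ?W = "flat k c (insert x B)"
  have spanW: "fun_space.span ?W = ?W" and spanV: "fun_space.span (flat k c B) = flat k c B"
    using subspace_flat by (simp_all add: fun_space.span_eq_iff)
  obtain b where b: "b \<subseteq> ?W" "fun_space.independent b" "?W \<subseteq> fun_space.span b" "card b = fun_space.dim ?W"
    using fun_space.basis_exists .
  have bspan: "fun_space.span b = ?W" using b(1,3) spanW fun_space.span_mono by blast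
  have "finite b"
    using fun_space.independent_span_bound[OF _ b(2), of "(\<lambda>m i. if i = m then 1 else 0) ` {..k}"]
      b(1) flat_subset_span by blast
  have vW: "v \<notin> ?W" using v by (auto simp: flat_def)
  then have "v \<notin> b" using b(1) by blast
  have ind: "fun_space.independent (insert v b)"
    using vW b(2) by (intro fun_space.independent_insertI) (simp_all add: bspan)
  have "?W \<subseteq> flat k c B" by (auto simp: flat_def)
  then have sub: "insert v b \<subseteq> flat k c B" using v b(1) by blast
  have "flat k c B \<subseteq> fun_space.span (insert v b)"
  proof
    fix y assume y: "y \<in> flat k c B"
    let ?t = "lform k c x y / lform k c x v"
    define w where "w = (\<lambda>i. 1 * y i + (- ?t) * v i)"
    have "w \<in> flat k c B" unfolding w_def by (rule flat_comb[OF y v(1)])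
    moreover have "lform k c x w = 0" unfolding w_def lform_comb using v(2) by simp
    ultimately have "w \<in> ?W" by (simp add: flat_def)
    then have "w \<in> fun_space.span (insert v b)"
      unfolding bspan[symmetric] using fun_space.span_mono[of b "insert v b"] by blast
    moreover have "(\<lambda>i. ?t * v i) \<in> fun_space.span (insert v b)"
      by (intro fun_space.span_scale fun_space.span_base) simp
    ultimately have "w + (\<lambda>i. ?t * v i) \<in> fun_space.span (insert v b)" by (rule fun_space.span_add)
    moreover have "w + (\<lambda>i. ?t * v i) = y" by (auto simp: w_def fun_eq_iff)
    ultimately show "y \<in> fun_space.span (insert v b)" by simp
  qed
  from fun_space.dim_unique[OF sub this ind refl] show ?thesis
    using True \<open>v \<notin> b\<close> \<open>finite b\<close> b(4) by simp
qed

text \<open>For finite \<open>A\<close> this is the codimension of the common kernel, that is, the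
  rank of the columns with index in \<open>A\<close>. In this form rank increments are read off from
  whether a form vanishes on a flat.\<close>

definition arr_rank :: "nat \<Rightarrow> (nat \<Rightarrow> nat \<Rightarrow> complex) \<Rightarrow> nat set \<Rightarrow> nat" where
  "arr_rank k c A = fun_space.dim (flat k c {}) - fun_space.dim (flat k c A)"

lemma dim_flat_le: "finite A \<Longrightarrow> fun_space.dim (flat k c A) \<le> fun_space.dim (flat k c {})"
proof (induction A rule: finite_induct)
  case (insert x A)
  then show ?case using dim_flat_insert[of k c A x] by simp
qed simp

lemma arr_rank_insert:
  assumes "finite A"
  shows "arr_rank k c (insert x A) = arr_rank k c A + (if \<exists>\<alpha>\<in>flat k c A. lform k c x \<alpha> \<noteq> 0 then 1 else 0)"
  using dim_flat_insert[of k c A x] dim_flat_le[of A k c] dim_flat_le[of "insert x A" k c] assms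
  by (auto simp: arr_rank_def)

text \<open>Diminishing returns: a form that is nonzero somewhere on the flat of \<open>B\<close> is
  nonzero somewhere on the larger flat of \<open>A\<close>.\<close>

lemma rank_fun_arr_rank:
  assumes "finite E"
  shows "rank_fun E (arr_rank k c)"
  unfolding rank_fun_def
proof (intro conjI allI impI)
  show "arr_rank k c {} = 0" by (simp add: arr_rank_def)
  fix A x assume "A \<subseteq> E"
  then have fin: "finite A" using assms finite_subset by blast
  show "arr_rank k c A \<le> arr_rank k c (insert x A)" "arr_rank k c (insert x A) \<le> arr_rank k c A + 1"
    using arr_rank_insert[OF fin, of k c x] by auto
next
  fix A B x assume AB: "A \<subseteq> B" "B \<subseteq> E"
  have fin: "finite B" "finite A"
    using finite_subset[OF AB(2) assms] finite_subset[OF AB(1)] by auto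
  have "flat k c B \<subseteq> flat k c A" using AB by (auto simp: flat_def)
  then show "arr_rank k c (insert x B) + arr_rank k c A \<le> arr_rank k c (insert x A) + arr_rank k c B"
    unfolding arr_rank_insert[OF fin(1)] arr_rank_insert[OF fin(2)]
    by (cases "\<exists>\<alpha>\<in>flat k c B. lform k c x \<alpha> \<noteq> 0") (auto simp: subset_iff)
qed (rule assms)

lemma dim_flat_eq_0_iff: "fun_space.dim (flat k c A) = 0 \<longleftrightarrow> flat k c A = {0}"
proof
  assume 0: "fun_space.dim (flat k c A) = 0"
  obtain b where b: "b \<subseteq> flat k c A" "fun_space.independent b" "flat k c A \<subseteq> fun_space.span b" "card b = 0"
    using fun_space.basis_exists[of "flat k c A"] unfolding 0 by blast
  \<comment> \<open>Cardinality 0 alone would also allow an infinite set.\<close>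
  have "finite b"
    using fun_space.independent_span_bound[OF _ b(2), of "(\<lambda>m i. if i = m then 1 else 0) ` {..k}"]
      b(1) flat_subset_span by blast
  then have "flat k c A \<subseteq> {0}" using b by simp
  moreover have "0 \<in> flat k c A" using subspace_flat by (rule fun_space.subspace_0)
  ultimately show "flat k c A = {0}" by blast
next
  assume "flat k c A = {0}"
  moreover have "fun_space.dim {0} = card ({} :: (nat \<Rightarrow> complex) set)"
    by (rule fun_space.dim_eq_card) (auto simp: fun_space.independent_empty fun_space.span_insert_0)
  ultimately show "fun_space.dim (flat k c A) = 0" by simp
qed

text \<open>The flat of the empty set is the same for all coefficients, so coordinate forms may be
  taken: each of the \<open>k + 1\<close> lowers the dimension by one, down to the zero
  space.\<close>

lemma dim_flat_empty:
  "fun_space.dim (flat k c {}) = k + 1"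
proof -
  let ?c = "\<lambda>j i. if j = i then 1 else 0 :: complex"
  have lf: "lform k ?c j x = x j" if "j \<le> k" for j x
    using that by (simp add: lform_def if_distrib[of "\<lambda>t. t * _"] cong: if_cong)
  have flat: "flat k ?c {..<m} = {x. (\<forall>i>k. x i = 0) \<and> (\<forall>j<m. x j = 0)}" if "m \<le> k + 1" for m
    using that lf by (auto simp: flat_def)
  have "fun_space.dim (flat k ?c {}) = fun_space.dim (flat k ?c {..<m}) + m" if "m \<le> k + 1" for m
    using that
  proof (induction m)
    case (Suc m)
    have "(\<lambda>i. if i = m then 1 else 0) \<in> flat k ?c {..<m}" using Suc.prems by (subst flat) auto
    moreover have "lform k ?c m (\<lambda>i. if i = m then 1 else 0) \<noteq> 0" using Suc.prems by (subst lf) auto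
    ultimately have "\<exists>\<alpha>\<in>flat k ?c {..<m}. lform k ?c m \<alpha> \<noteq> 0" by blast
    then show ?case using Suc dim_flat_insert[of k ?c "{..<m}" m] by (simp add: lessThan_Suc)
  qed simp
  from this[of "k + 1"] have "fun_space.dim (flat k ?c {}) = fun_space.dim (flat k ?c {..<k + 1}) + (k + 1)" by simp
  moreover have "flat k ?c {..<k + 1} = {0}"
  proof -
    have "x = 0" if "\<forall>i>k. x i = 0" "\<forall>j<k + 1. x j = 0" for x :: "nat \<Rightarrow> complex"
    proof
      fix i show "x i = 0 i" using that by (cases "i > k") auto
    qed
    then show ?thesis unfolding flat[OF order_refl] by auto
  qed
  moreover have "flat k c {} = flat k ?c {}" by (simp add: flat_def)
  ultimately show ?thesis using dim_flat_eq_0_iff[of k ?c "{..<k + 1}"] by simp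
qed

lemma arr_rank_full_iff:
  "arr_rank k c A = k + 1 \<longleftrightarrow> flat k c A = {0}"
proof -
  have "arr_rank k c A = k + 1 \<longleftrightarrow> fun_space.dim (flat k c A) = 0"
    unfolding arr_rank_def dim_flat_empty by arith
  then show ?thesis unfolding dim_flat_eq_0_iff .
qed

text \<open>The subsets are paired along element 0, the hyperplane at infinity. It raises the rank
  of \<open>C\<close> exactly if the flat of \<open>C\<close> reaches the chart, that is, if the
  affine intersection is nonempty. The sign \<open>(-1) ^ (k + 1)\<close> of the rank and the minus
  sign of the pairing combine to \<open>(-1) ^ k\<close>.\<close>

lemma euler_sum_arr_rank:
  assumes c0: "\<And>\<alpha>. lform k c 0 \<alpha> = \<alpha> 0" and rk: "arr_rank k c {0..n} = k + 1"
  shows "(-1) ^ k * (\<Sum>C\<in>Pow {1..n}. (-1) ^ card C * (if affine_arr k c C {} = {} then 0 else 1)) =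
    crapo_beta {0..n} (arr_rank k c)"
proof -
  have E: "{0..n} - {0} = {1..n}" by auto
  have ind: "(if affine_arr k c C {} = {} then 0 else 1) = int (arr_rank k c (insert 0 C)) - int (arr_rank k c C)"
    if "finite C" for C
  proof -
    have "affine_arr k c C {} \<noteq> {} \<longleftrightarrow> (\<exists>\<alpha>\<in>flat k c C. lform k c 0 \<alpha> \<noteq> 0)"
    proof
      assume "\<exists>\<alpha>\<in>flat k c C. lform k c 0 \<alpha> \<noteq> 0"
      then obtain \<alpha> where \<alpha>: "\<alpha> \<in> flat k c C" "\<alpha> 0 \<noteq> 0" using c0 by auto
      then have "(\<lambda>i. (1 / \<alpha> 0) * \<alpha> i + 0 * \<alpha> i) \<in> affine_arr k c C {}"
        unfolding affine_arr_def using flat_comb[OF \<alpha>(1) \<alpha>(1), of "1 / \<alpha> 0" 0] by simp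
      then show "affine_arr k c C {} \<noteq> {}" by blast
    next
      assume "affine_arr k c C {} \<noteq> {}"
      then obtain \<alpha> where "\<alpha> \<in> flat k c C" "\<alpha> 0 = 1" by (auto simp: affine_arr_def)
      then show "\<exists>\<alpha>\<in>flat k c C. lform k c 0 \<alpha> \<noteq> 0" using c0 by (intro bexI[of _ \<alpha>]) auto
    qed
    then show ?thesis using arr_rank_insert[OF that, of k c 0] by auto
  qed
  have "alt_sum {0..n} (arr_rank k c) =
      (\<Sum>C\<in>Pow {1..n}. (-1) ^ card C * (int (arr_rank k c C) - int (arr_rank k c (insert 0 C))))"
    using alt_sum_remove[of "{0..n}" 0 "arr_rank k c"] unfolding E by simp
  also have "\<dots> = (\<Sum>C\<in>Pow {1..n}. - ((-1) ^ card C * (if affine_arr k c C {} = {} then 0 else 1)))"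
  proof (rule sum.cong[OF refl])
    fix C assume "C \<in> Pow {1..n}"
    then have "finite C" using finite_subset by auto
    from ind[OF this] show "(-1) ^ card C * (int (arr_rank k c C) - int (arr_rank k c (insert 0 C))) =
        - ((-1) ^ card C * (if affine_arr k c C {} = {} then 0 else 1))"
      by (simp add: right_diff_distrib)
  qed
  finally show ?thesis unfolding crapo_beta_def rk by (simp add: sum_negf)
qed


section \<open>Minors and generic points\<close>

text \<open>The identity block contains all coordinate forms, so the total rank is
  \<open>k + 1\<close> for every \<open>z\<close>; this is what makes the weak maps between these
  matroids rank-preserving.\<close>

lemma signed_euler_eq_crapo_beta:
  assumes "k \<le> n"
  shows "arr_rank k (arr_coeff k n z) {0..n} = k + 1"
    and "signed_euler k n z = crapo_beta {0..n} (arr_rank k (arr_coeff k n z))"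
proof -
  have "flat k (arr_coeff k n z) {0..n} \<subseteq> {0}"
  proof
    fix \<alpha> assume \<alpha>: "\<alpha> \<in> flat k (arr_coeff k n z) {0..n}"
    have "\<alpha> i = 0" for i
    proof (cases "i \<le> k")
      case True
      then have "i \<in> {0..n}" using assms by simp
      then have "lform k (arr_coeff k n z) i \<alpha> = 0" using \<alpha> unfolding flat_def by blast
      then show ?thesis using lform_arr_coeff_coord[OF True, of n z \<alpha>] True assms by simp
    qed (use \<alpha> in \<open>simp add: flat_def\<close>)
    then have "\<alpha> = 0" by (simp add: fun_eq_iff)
    then show "\<alpha> \<in> {0}" by simp
  qed
  moreover have "0 \<in> flat k (arr_coeff k n z) {0..n}" using subspace_flat by (rule fun_space.subspace_0)
  ultimately have "flat k (arr_coeff k n z) {0..n} = {0}" by blast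
  then show rk: "arr_rank k (arr_coeff k n z) {0..n} = k + 1" by (simp only: arr_rank_full_iff)
  show "signed_euler k n z = crapo_beta {0..n} (arr_rank k (arr_coeff k n z))"
    unfolding signed_euler_def euler_arr_complement[OF assms]
    by (rule euler_sum_arr_rank[OF _ rk]) (simp add: lform_arr_coeff_coord)
qed

section \<open>Minors and bases of the matroid\<close>

lemma bij_betw_pick:
  assumes "finite S"
  shows "bij_betw (pick S) {0..<card S} S"
proof -
  have inj: "inj_on (pick S) {0..<card S}"
  proof (rule linorder_inj_onI)
    show "pick S x \<noteq> pick S y" if "x < y" "x \<in> {0..<card S}" "y \<in> {0..<card S}" for x y
      using pick_mono_le[of y S x] that by simp
  qed auto
  moreover have "pick S ` {0..<card S} \<subseteq> S" using pick_in_set_le by auto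
  then have "pick S ` {0..<card S} = S" using assms card_image[OF inj] by (intro card_subset_eq) auto
  ultimately show ?thesis by (simp add: bij_betw_def)
qed

text \<open>The transpose is used because its kernel consists of vectors on the rows
  \<open>I\<close> annihilated by the forms of \<open>J\<close>. Through \<open>pick\<close>,
  positions in the submatrix become original indices, and the criterion is free of
  enumerations.\<close>

lemma minor_eq_0_iff:
  assumes I: "I \<subseteq> {0..k}" and J: "J \<subseteq> {k+1..n}" and IJ: "card I = card J"
  shows "minor k n I J z = 0 \<longleftrightarrow>
    (\<exists>w. (\<exists>i\<in>I. w i \<noteq> 0) \<and> (\<forall>j\<in>J. (\<Sum>i\<in>I. arr_coeff k n z j i * w i) = 0))"
proof -
  let ?M = "submatrix (extended_mat k n z) I J" and ?m = "card I"
  have fin: "finite I" "finite J" using I J finite_subset by auto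
  have sI: "{i. i < dim_row (extended_mat k n z) \<and> i \<in> I} = I" using I by (auto simp: extended_mat_def)
  have sJ: "{j. j < dim_col (extended_mat k n z) \<and> j \<in> J} = J" using J by (auto simp: extended_mat_def)
  have M: "?M \<in> carrier_mat ?m ?m"
    by (rule carrier_matI) (simp_all only: dim_submatrix sI sJ IJ)
  have ent: "?M $$ (a, b) = arr_coeff k n z (pick J b) (pick I a)" if "a < ?m" "b < ?m" for a b
    using submatrix_index[of a "extended_mat k n z" I b J] that by (simp only: sI sJ IJ arr_coeff_def)
  have bI: "bij_betw (pick I) {0..<?m} I" and bJ: "bij_betw (pick J) {0..<?m} J"
    using bij_betw_pick[OF fin(1)] bij_betw_pick[OF fin(2)] IJ by simp_all
  have prod: "(transpose_mat ?M *\<^sub>v v) $ b = (\<Sum>i\<in>I. arr_coeff k n z (pick J b) i * w i)"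
    if "v \<in> carrier_vec ?m" "b < ?m" "\<And>a. a < ?m \<Longrightarrow> w (pick I a) = v $ a" for v w b
  proof -
    have "(transpose_mat ?M *\<^sub>v v) $ b = (\<Sum>a = 0..<?m. ?M $$ (a, b) * v $ a)"
      using that(1,2) M by (simp add: scalar_prod_def)
    also have "\<dots> = (\<Sum>a = 0..<?m. arr_coeff k n z (pick J b) (pick I a) * w (pick I a))"
      using that(2,3) by (intro sum.cong) (auto simp: ent)
    also have "\<dots> = (\<Sum>i\<in>I. arr_coeff k n z (pick J b) i * w i)"
      by (rule sum.reindex_bij_betw[OF bI])
    finally show ?thesis .
  qed
  have "minor k n I J z = 0 \<longleftrightarrow> (\<exists>v. v \<in> carrier_vec ?m \<and> v \<noteq> 0\<^sub>v ?m \<and> transpose_mat ?M *\<^sub>v v = 0\<^sub>v ?m)"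
    unfolding minor_def det_transpose[OF M, symmetric]
    using M by (intro det_0_iff_vec_prod_zero_field) simp
  also have "\<dots> \<longleftrightarrow> (\<exists>w. (\<exists>i\<in>I. w i \<noteq> 0) \<and> (\<forall>j\<in>J. (\<Sum>i\<in>I. arr_coeff k n z j i * w i) = 0))"
  proof
    assume "\<exists>v. v \<in> carrier_vec ?m \<and> v \<noteq> 0\<^sub>v ?m \<and> transpose_mat ?M *\<^sub>v v = 0\<^sub>v ?m"
    then obtain v where v: "v \<in> carrier_vec ?m" "v \<noteq> 0\<^sub>v ?m" "transpose_mat ?M *\<^sub>v v = 0\<^sub>v ?m" by blast
    define w where "w i = v $ inv_into {0..<?m} (pick I) i" for i
    have w: "w (pick I a) = v $ a" if "a < ?m" for a
      using that bI by (simp add: w_def bij_betw_def inv_into_f_f)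
    obtain a where a: "a < ?m" "v $ a \<noteq> 0"
    proof (rule ccontr)
      assume "\<not> thesis"
      then have "v = 0\<^sub>v ?m" using v(1) that by (intro eq_vecI) auto
      with v(2) show False ..
    qed
    have "pick I a \<in> I" using a(1) bI by (auto simp: bij_betw_def)
    moreover have "w (pick I a) \<noteq> 0" using w a by simp
    moreover have "(\<Sum>i\<in>I. arr_coeff k n z j i * w i) = 0" if "j \<in> J" for j
    proof -
      have "j \<in> pick J ` {0..<?m}" using that bij_betw_imp_surj_on[OF bJ] by simp
      then obtain b where b: "b < ?m" "j = pick J b" by auto
      show ?thesis using prod[OF v(1) b(1) w] v(3) b by simp
    qed
    ultimately show "\<exists>w. (\<exists>i\<in>I. w i \<noteq> 0) \<and> (\<forall>j\<in>J. (\<Sum>i\<in>I. arr_coeff k n z j i * w i) = 0)" by blast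
  next
    assume "\<exists>w. (\<exists>i\<in>I. w i \<noteq> 0) \<and> (\<forall>j\<in>J. (\<Sum>i\<in>I. arr_coeff k n z j i * w i) = 0)"
    then obtain w i where w: "i \<in> I" "w i \<noteq> 0" "\<And>j. j \<in> J \<Longrightarrow> (\<Sum>i\<in>I. arr_coeff k n z j i * w i) = 0" by blast
    define v where "v = vec ?m (\<lambda>a. w (pick I a))"
    have v: "v \<in> carrier_vec ?m" by (simp add: v_def)
    have "i \<in> pick I ` {0..<?m}" using w(1) bij_betw_imp_surj_on[OF bI] by simp
    then obtain a where a: "a < ?m" "i = pick I a" by auto
    then have "v $ a \<noteq> 0" using w(2) by (simp add: v_def)
    then have "v \<noteq> 0\<^sub>v ?m" using a(1) by auto
    moreover have "transpose_mat ?M *\<^sub>v v = 0\<^sub>v ?m"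
    proof (rule eq_vecI)
      fix b assume "b < dim_vec (0\<^sub>v ?m :: complex vec)"
      then have b: "b < ?m" by simp
      then have "pick J b \<in> J" using bJ by (auto simp: bij_betw_def)
      then show "(transpose_mat ?M *\<^sub>v v) $ b = 0\<^sub>v ?m $ b"
        using prod[OF v b, of w] w(3) b by (simp add: v_def)
    qed (use M in simp)
    ultimately show "\<exists>v. v \<in> carrier_vec ?m \<and> v \<noteq> 0\<^sub>v ?m \<and> transpose_mat ?M *\<^sub>v v = 0\<^sub>v ?m"
      using v by blast
  qed
  finally show ?thesis .
qed

text \<open>The coordinate forms outside \<open>I\<close> force a vector of the flat to be supported
  on \<open>I\<close>; what remains is the square system of the forms \<open>J\<close> in these
  unknowns.\<close>

lemma basis_iff_minor:
  assumes kn: "k \<le> n" and I: "I \<subseteq> {0..k}" and J: "J \<subseteq> {k+1..n}" and IJ: "card I = card J"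
  shows "arr_rank k (arr_coeff k n z) (({0..k} - I) \<union> J) = k + 1 \<longleftrightarrow> minor k n I J z \<noteq> 0"
proof -
  let ?B = "({0..k} - I) \<union> J" and ?c = "arr_coeff k n z"
  have coord: "lform k ?c i \<alpha> = \<alpha> i" if "i \<le> k" for i \<alpha> using that kn by (simp add: lform_arr_coeff_coord)
  have restr: "lform k ?c j \<alpha> = (\<Sum>i\<in>I. ?c j i * \<alpha> i)" if "\<And>i. i \<in> {0..k} - I \<Longrightarrow> \<alpha> i = 0" for j \<alpha>
    unfolding lform_def using I that by (intro sum.mono_neutral_right) auto
  have "flat k ?c ?B \<noteq> {0} \<longleftrightarrow>
      (\<exists>w. (\<exists>i\<in>I. w i \<noteq> 0) \<and> (\<forall>j\<in>J. (\<Sum>i\<in>I. ?c j i * w i) = 0))" (is "?L \<longleftrightarrow> ?R")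
  proof
    assume ?L
    moreover have "0 \<in> flat k ?c ?B" using subspace_flat by (rule fun_space.subspace_0)
    ultimately obtain \<alpha> where \<alpha>: "\<alpha> \<in> flat k ?c ?B" "\<alpha> \<noteq> 0" by blast
    have z: "\<alpha> i = 0" if "i \<in> {0..k} - I" for i
    proof -
      have "lform k ?c i \<alpha> = 0" using \<alpha>(1) that unfolding flat_def by blast
      then show ?thesis using coord[of i \<alpha>] that by simp
    qed
    obtain i where "\<alpha> i \<noteq> 0" using \<alpha>(2) by (auto simp: fun_eq_iff)
    moreover have "i \<in> I"
    proof (rule ccontr)
      assume "i \<notin> I"
      with z[of i] \<open>\<alpha> i \<noteq> 0\<close> have "\<not> i \<le> k" by auto
      then have "i > k" by simp
      then show False using \<alpha>(1) \<open>\<alpha> i \<noteq> 0\<close> by (simp add: flat_def)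
    qed
    moreover have "(\<Sum>i\<in>I. ?c j i * \<alpha> i) = 0" if "j \<in> J" for j
    proof -
      have "lform k ?c j \<alpha> = 0" using \<alpha>(1) that unfolding flat_def by blast
      then show ?thesis using restr[OF z] by simp
    qed
    ultimately show ?R by blast
  next
    assume ?R
    then obtain w i where w: "i \<in> I" "w i \<noteq> 0" "\<And>j. j \<in> J \<Longrightarrow> (\<Sum>i\<in>I. ?c j i * w i) = 0" by blast
    define \<alpha> where "\<alpha> i = (if i \<in> I then w i else 0)" for i
    have z: "\<alpha> i = 0" if "i \<in> {0..k} - I" for i using that by (simp add: \<alpha>_def)
    have "lform k ?c j \<alpha> = 0" if "j \<in> J" for j
    proof -
      have "lform k ?c j \<alpha> = (\<Sum>i\<in>I. ?c j i * \<alpha> i)" by (rule restr) (rule z)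
      also have "\<dots> = (\<Sum>i\<in>I. ?c j i * w i)" by (intro sum.cong) (auto simp: \<alpha>_def)
      finally show ?thesis using w(3)[OF that] by simp
    qed
    moreover have "lform k ?c j \<alpha> = 0" if "j \<in> {0..k} - I" for j
      using coord[of j \<alpha>] z[OF that] that by simp
    moreover have "\<alpha> i = 0" if "i > k" for i using that I by (auto simp: \<alpha>_def)
    ultimately have "\<alpha> \<in> flat k ?c ?B" unfolding flat_def by blast
    moreover have "\<alpha> i \<noteq> 0" using w by (simp add: \<alpha>_def)
    then have "\<alpha> \<noteq> 0" by (auto simp: fun_eq_iff)
    ultimately show ?L by blast
  qed
  then show ?thesis using minor_eq_0_iff[OF I J IJ, of z] by (simp only: arr_rank_full_iff) blast
qed

text \<open>\<open>I\<close> is what the set omits among the identity columns and \<open>J\<close>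
  what it takes from \<open>z\<close>; the cardinality \<open>k + 1\<close> makes the two equally
  large.\<close>

lemma basis_complementary_minor:
  assumes B: "B \<subseteq> {0..n}" "card B = k + 1"
  obtains I J where "I \<subseteq> {0..k}" "J \<subseteq> {k+1..n}" "card I = card J" "B = ({0..k} - I) \<union> J"
proof -
  let ?I = "{0..k} - B" and ?J = "B \<inter> {k+1..n}"
  have fin: "finite B" using B(1) finite_subset by blast
  have e1: "B \<inter> {0..k} \<union> ?J = B" "B \<inter> {0..k} \<union> ?I = {0..k}" using B(1) by auto
  have "card (B \<inter> {0..k}) + card ?J = card B"
    using fin card_Un_disjoint[of "B \<inter> {0..k}" ?J] unfolding e1 by fastforce
  moreover have "card (B \<inter> {0..k}) + card ?I = card {0..k}"
    using fin card_Un_disjoint[of "B \<inter> {0..k}" ?I] unfolding e1 by fastforce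
  ultimately have "card ?I = card ?J" using B(2) by simp
  moreover have "B = ({0..k} - ?I) \<union> ?J" using B(1) by auto
  ultimately show ?thesis using that[of ?I ?J] by blast
qed

section \<open>Polynomial functions and generic points\<close>

lemma polynomial_fun_sum:
  "(\<And>x. x \<in> S \<Longrightarrow> polynomial_fun r c (f x)) \<Longrightarrow> polynomial_fun r c (\<lambda>z. \<Sum>x\<in>S. f x z)"
  by (induction S rule: infinite_finite_induct) (auto intro: polynomial_fun.intros)

lemma polynomial_fun_prod:
  "(\<And>x. x \<in> S \<Longrightarrow> polynomial_fun r c (f x)) \<Longrightarrow> polynomial_fun r c (\<lambda>z. \<Prod>x\<in>S. f x z)"
  by (induction S rule: infinite_finite_induct) (auto intro: polynomial_fun.intros)

text \<open>Leibniz expansion: \<open>J\<close> avoids the identity block, so all entries of the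
  submatrix are entries of \<open>z\<close>, with columns shifted by \<open>k + 1\<close>.\<close>

lemma polynomial_fun_minor:
  assumes I: "I \<subseteq> {0..k}" and J: "J \<subseteq> {k+1..n}" and IJ: "card I = card J"
  shows "polynomial_fun (k + 1) (n - k) (minor k n I J)"
proof -
  let ?m = "card I"
  have fin: "finite I" "finite J" using I J finite_subset by auto
  have sI: "{i. i < k + 1 \<and> i \<in> I} = I" using I by auto
  have sJ: "{j. j < n + 1 \<and> j \<in> J} = J" using J by auto
  have ent: "submatrix (extended_mat k n z) I J $$ (a, b) = z $$ (pick I a, pick J b - (k + 1))"
    and bnd: "pick I a < k + 1" "pick J b - (k + 1) < n - k" if "a < ?m" "b < ?m" for a b z
  proof -
    have ij: "pick I a \<in> I" "pick J b \<in> J" using that IJ by (auto intro: pick_in_set_le)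
    show "pick I a < k + 1" "pick J b - (k + 1) < n - k" using ij I J by fastforce+
    have "pick I a < k + 1" "pick J b < n + 1" "\<not> pick J b \<le> k" using ij I J by fastforce+
    then show "submatrix (extended_mat k n z) I J $$ (a, b) = z $$ (pick I a, pick J b - (k + 1))"
      using that by (subst submatrix_index) (simp_all add: extended_mat_def sI[simplified] sJ[simplified] IJ)
  qed
  have "minor k n I J z = (\<Sum>p\<in>{p. p permutes {0..<?m}}. signof p * (\<Prod>i = 0..<?m. z $$ (pick I i, pick J (p i) - (k + 1))))" for z
  proof -
    have dims: "dim_row (submatrix (extended_mat k n z) I J) = ?m" "dim_col (submatrix (extended_mat k n z) I J) = ?m"
      by (simp_all add: dim_submatrix extended_mat_def sI[simplified] sJ[simplified] IJ)
    show ?thesis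
      unfolding minor_def Determinant.det_def dims if_P[OF refl]
    proof (intro sum.cong refl arg_cong2[where f = "(*)"] prod.cong)
      fix p i assume "p \<in> {p. p permutes {0..<?m}}" "i \<in> {0..<?m}"
      moreover from this have "p i \<in> {0..<?m}" by (simp only: mem_Collect_eq permutes_in_image)
      ultimately show "submatrix (extended_mat k n z) I J $$ (i, p i) = z $$ (pick I i, pick J (p i) - (k + 1))"
        by (intro ent) auto
    qed
  qed
  moreover have "polynomial_fun (k + 1) (n - k)
    (\<lambda>z. \<Sum>p\<in>{p. p permutes {0..<?m}}. signof p * (\<Prod>i = 0..<?m. z $$ (pick I i, pick J (p i) - (k + 1))))"
  proof (intro polynomial_fun_sum polynomial_fun.mult polynomial_fun.const polynomial_fun_prod)
    fix p i assume "p \<in> {p. p permutes {0..<?m}}" "i \<in> {0..<?m}"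
    moreover from this have "p i \<in> {0..<?m}" by (simp only: mem_Collect_eq permutes_in_image)
    ultimately show "polynomial_fun (k + 1) (n - k) (\<lambda>z. z $$ (pick I i, pick J (p i) - (k + 1)))"
      by (intro polynomial_fun.coord bnd) auto
  qed
  ultimately show ?thesis by presburger
qed

lemma zariski_closed_zero_set: "polynomial_fun r c f \<Longrightarrow> zariski_closed r c {z \<in> carrier_mat r c. f z = 0}"
  unfolding zariski_closed_def by (intro exI[of _ "{f}"]) auto

text \<open>Irreducibility makes finitely many nonempty open conditions compatible. The induction is
  on the product of the functions, so each step involves a cover by only two zero sets.\<close>

lemma subvariety_generic_point:
  assumes Z: "subvariety r c Z" and "finite S"
    and f: "\<And>s. s \<in> S \<Longrightarrow> polynomial_fun r c (f s)" "\<And>s. s \<in> S \<Longrightarrow> \<exists>z\<in>Z. f s z \<noteq> 0"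
  shows "\<exists>z\<in>Z. \<forall>s\<in>S. f s z \<noteq> 0"
proof -
  have sub: "Z \<subseteq> carrier_mat r c" using Z by (auto simp: subvariety_def zariski_closed_def)
  have "\<exists>z\<in>Z. (\<Prod>s\<in>S. f s z) \<noteq> 0"
    using assms(2) f
  proof induction
    case empty
    then show ?case using Z by (auto simp: subvariety_def)
  next
    case (insert s S)
    let ?V = "\<lambda>g. {z \<in> carrier_mat r c. g z = (0::complex)}" and ?g = "\<lambda>z. \<Prod>s\<in>S. f s z"
    have "\<exists>z\<in>Z. ?g z \<noteq> 0" by (rule insert.IH) (use insert.prems in auto)
    then have "\<not> Z \<subseteq> ?V ?g" by auto
    moreover have "\<not> Z \<subseteq> ?V (f s)" using insert.prems(2)[of s] by auto
    moreover have "zariski_closed r c (?V ?g)" "zariski_closed r c (?V (f s))"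
      by (intro zariski_closed_zero_set polynomial_fun_prod; use insert.prems in auto)+
    ultimately have "\<not> Z \<subseteq> ?V (f s) \<union> ?V ?g" using Z unfolding subvariety_def by blast
    then show ?case using sub insert.hyps by auto
  qed
  then show ?thesis using assms(2) by (auto simp: prod_zero_iff)
qed

theorem theorem4p1:
  fixes k n :: nat and Z :: "complex mat set"
  assumes "k \<le> n"
    and "subvariety (k + 1) (n - k) Z"
    and "\<exists>z\<in>Z. signed_euler k n z > 0"
  shows "euler_discriminant k n Z = {z \<in> Z. reduced_discriminant k n Z z = 0}"
proof -
  let ?E = "{0..n}" and ?S = "nonzero_minors k n Z"
  define r where "r z = arr_rank k (arr_coeff k n z)" for z
  have se: "signed_euler k n z = crapo_beta ?E (r z)" and rE: "r z ?E = k + 1" for z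
    using signed_euler_eq_crapo_beta[OF assms(1)] by (auto simp: r_def)
  have rf: "rank_fun ?E (r z)" for z unfolding r_def by (rule rank_fun_arr_rank) simp
  have "?S \<subseteq> Pow {0..k} \<times> Pow {k+1..n}" by (auto simp: nonzero_minors_def)
  then have finS: "finite ?S" by (rule finite_subset) simp
  \<comment> \<open>The matroid of the generic point \<open>g\<close> has every basis that occurs
    anywhere on \<open>Z\<close>.\<close>
  have "\<exists>z\<in>Z. \<forall>s\<in>?S. (case s of (I, J) \<Rightarrow> minor k n I J z) \<noteq> 0"
    using polynomial_fun_minor by (intro subvariety_generic_point[OF assms(2) finS]) (auto simp: nonzero_minors_def)
  then obtain g where gZ: "g \<in> Z" and gS: "\<forall>s\<in>?S. (case s of (I, J) \<Rightarrow> minor k n I J g) \<noteq> 0" by blast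
  have g: "g \<in> Z" "\<And>I J. (I, J) \<in> ?S \<Longrightarrow> minor k n I J g \<noteq> 0"
    using gZ bspec[OF gS] by auto
  have basis: "r z (({0..k} - I) \<union> J) = k + 1 \<longleftrightarrow> minor k n I J z \<noteq> 0" if "(I, J) \<in> ?S" for I J z
    using that basis_iff_minor[OF assms(1)] unfolding r_def nonzero_minors_def by simp
  have ex: "\<exists>I J. (I, J) \<in> ?S \<and> B = ({0..k} - I) \<union> J"
    if z: "z \<in> Z" and B: "B \<subseteq> ?E" "card B = k + 1" "r z B = k + 1" for B z
  proof -
    obtain I J where IJ: "I \<subseteq> {0..k}" "J \<subseteq> {k+1..n}" "card I = card J" "B = ({0..k} - I) \<union> J"
      using basis_complementary_minor[OF B(1,2)] .
    then have "minor k n I J z \<noteq> 0" using basis_iff_minor[OF assms(1) IJ(1-3), of z] B(3) by (simp add: r_def)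
    then show ?thesis using IJ z by (auto simp: nonzero_minors_def)
  qed
  \<comment> \<open>A basis at \<open>z\<close> is a minor that is nonzero at \<open>z\<close>; it
    therefore belongs to \<open>?S\<close> and is nonzero at \<open>g\<close>.\<close>
  have weak: "r z A \<le> r g A" if z: "z \<in> Z" and A: "A \<subseteq> ?E" for z A
  proof (rule rank_fun_le_if_bases_subset[OF rf rf _ A])
    fix B assume B: "B \<subseteq> ?E" "card B = r z ?E" "r z B = r z ?E"
    then obtain I J where "(I, J) \<in> ?S" "B = ({0..k} - I) \<union> J" using ex[OF z] rE by metis
    then show "r g B = card B" using basis[of I J g] g(2)[of I J] B rE by simp
  qed
  have cb: "crapo_beta ?E (r z) \<le> crapo_beta ?E (r g) \<and>
      (0 < crapo_beta ?E (r g) \<longrightarrow> crapo_beta ?E (r z) = crapo_beta ?E (r g) \<longrightarrow> (\<forall>A\<subseteq>?E. r z A = r g A))"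
    if "z \<in> Z" for z
    using weak[OF that] by (intro crapo_beta_weak_map rf) (simp_all add: rE)
  have max: "max_signed_euler k n Z = crapo_beta ?E (r g)"
    unfolding max_signed_euler_def
  proof (rule Max_eqI)
    \<comment> \<open>\<open>Max\<close> is meaningful because all values are integers between 0 and
      the generic one.\<close>
    have "signed_euler k n ` Z \<subseteq> {0..crapo_beta ?E (r g)}"
      using cb crapo_beta_nonneg[OF rf] by (auto simp: se)
    then show "finite (signed_euler k n ` Z)" by (rule finite_subset) simp
    show "y \<le> crapo_beta ?E (r g)" if "y \<in> signed_euler k n ` Z" for y
      using that cb by (auto simp: se)
    show "crapo_beta ?E (r g) \<in> signed_euler k n ` Z" using g(1) se by (metis imageI)
  qed
  \<comment> \<open>Positivity at some point passes to \<open>g\<close>, where the strict part of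
    the weak-map result asks for it.\<close>
  have pos: "crapo_beta ?E (r g) > 0"
  proof -
    obtain z where z: "z \<in> Z" "crapo_beta ?E (r z) > 0" using assms(3) unfolding se by blast
    then show ?thesis using cb[OF z(1)] by linarith
  qed
  have "signed_euler k n z < max_signed_euler k n Z \<longleftrightarrow> reduced_discriminant k n Z z = 0" if z: "z \<in> Z" for z
  proof -
    have red: "reduced_discriminant k n Z z = 0 \<longleftrightarrow> (\<exists>I J. (I, J) \<in> ?S \<and> minor k n I J z = 0)"
      unfolding reduced_discriminant_def prod_zero_iff[OF finS] Bex_def split_paired_Ex by simp
    have "crapo_beta ?E (r z) \<noteq> crapo_beta ?E (r g) \<longleftrightarrow> (\<exists>I J. (I, J) \<in> ?S \<and> minor k n I J z = 0)"
    proof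
      assume ne: "crapo_beta ?E (r z) \<noteq> crapo_beta ?E (r g)"
      show "\<exists>I J. (I, J) \<in> ?S \<and> minor k n I J z = 0"
      proof (rule ccontr)
        assume no: "\<not> ?thesis"
        \<comment> \<open>If no factor vanishes at \<open>z\<close>, the bases at \<open>g\<close>
          are bases at \<open>z\<close> too, and the weak order holds in both directions.\<close>
        have "r g A \<le> r z A" if A: "A \<subseteq> ?E" for A
        proof (rule rank_fun_le_if_bases_subset[OF rf rf _ A])
          fix B assume B: "B \<subseteq> ?E" "card B = r g ?E" "r g B = r g ?E"
          then obtain I J where "(I, J) \<in> ?S" "B = ({0..k} - I) \<union> J" using ex[OF g(1)] rE by metis
          then show "r z B = card B" using basis[of I J z] no B rE by auto
        qed
        then have "crapo_beta ?E (r z) = crapo_beta ?E (r g)"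
          using weak[OF z] by (intro crapo_beta_eqI) (simp add: le_antisym)
        with ne show False ..
      qed
    next
      assume "\<exists>I J. (I, J) \<in> ?S \<and> minor k n I J z = 0"
      then obtain I J where IJ: "(I, J) \<in> ?S" "minor k n I J z = 0" by blast
      let ?B = "({0..k} - I) \<union> J"
      \<comment> \<open>The basis belonging to the vanishing minor is lost at \<open>z\<close>, so
        the rank functions differ and the values of beta cannot agree.\<close>
      have "r z ?B \<noteq> r g ?B" using basis[OF IJ(1), of z] basis[OF IJ(1), of g] g(2)[OF IJ(1)] IJ(2) by auto
      moreover have "?B \<subseteq> ?E" using IJ(1) assms(1) by (auto simp: nonzero_minors_def)
      ultimately show "crapo_beta ?E (r z) \<noteq> crapo_beta ?E (r g)" using cb[OF z] pos by auto
    qed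
    moreover have "crapo_beta ?E (r z) \<le> crapo_beta ?E (r g)" using cb[OF z] by (rule conjunct1)
    ultimately show ?thesis unfolding red max se order.strict_iff_order by (simp only: simp_thms)
  qed
  then show ?thesis unfolding euler_discriminant_def by (intro Collect_cong) blast
qed

end
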